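(* Let $\mathcal{T}$ be a triangulated category with small coproducts and let $\mathcal{S}\subset\mathcal{T}$ be a full additive subcategory stable under taking direct summands such that: a) $\mathcal{S}$ compactly generates $\mathcal{T}$, i.e. for each $S\in\mathcal{S}$ the functor $\mathcal{T}(S,?):\mathcal{T}\to\mathrm{Mod}\,\mathbb{Z}$ commutes with small coproducts, and if $M\in\mathcal{T}$ satisfies $\mathcal{T}(\Sigma^p S,M)=0$ for all $p\in\mathbb{Z}$ and $S\in\mathcal{S}$, then $M=0$; b) $\mathcal{T}(L,\Sigma^p M)=0$ for all $L,M\in\mathcal{S}$ and all integers $p<0$; c) the category $\mathrm{Mod}\,\mathcal{S}$ of additive functors $\mathcal{S}^{op}\to\mathrm{Mod}\,\mathbb{Z}$ is semi-simple. For $X\in\mathcal{T}$ and $p\in\mathbb{Z}$, let $H^pX\in\mathrm{Mod}\,\mathcal{S}$ be the functor $L\mapsto\mathcal{T}(L,\Sigma^pX)$. Then: 1) There is a unique weight structure $(\mathcal{T}^{>0},\mathcal{T}^{\leq 0})$ on $\mathcal{T}$ such that $\mathcal{T}^{\leq 0}$ is formed by the objects $X$ with $H^pX=0$ for all $p>0$ and $\mathcal{T}^{>0}$ is formed by the objects $X$ with $H^pX=0$ for all $p\leq 0$. 2) For each object $X$ of $\mathcal{T}$, there is a truncation triangle $$\sigma_{>0}(X)\to X\to\sigma_{\leq 0}(X)\to\Sigma\sigma_{>0}(X)$$ (with $\sigma_{>0}(X)\in\mathcal{T}^{>0}$ and $\sigma_{\leq 0}(X)\in\mathcal{T}^{\leq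 0}$) such that the morphism $X\to\sigma_{\leq 0}(X)$ induces an isomorphism in $H^p$ for all $p\leq 0$ and the morphism $\sigma_{>0}(X)\to X$ induces an isomorphism in $H^p$ for all $p>0$.
   Context: $\Sigma$ denotes the shift functor of a triangulated category; "small" means set-indexed; $\mathcal{T}(X,Y)$ denotes the group of morphisms from $X$ to $Y$. A weight structure on a triangulated category $\mathcal{T}$ is a pair of full additive subcategories $\mathcal{T}^{>0}$ and $\mathcal{T}^{\leq 0}$ of $\mathcal{T}$ such that: (w0) both are stable under taking direct factors; (w1) $\mathcal{T}^{>0}$ is stable under $\Sigma^{-1}$ and $\mathcal{T}^{\leq 0}$ is stable under $\Sigma$; (w2) $\mathcal{T}(X,Y)=0$ for all $X\in\mathcal{T}^{>0}$ and all $Y\in\mathcal{T}^{\leq 0}$; (w3) for each object $X$ of $\mathcal{T}$ there is a triangle (called a truncation triangle) $\sigma_{>0}(X)\to X\to\sigma_{\leq 0}(X)\to\Sigma\sigma_{>0}(X)$ with $\sigma_{>0}(X)\in\mathcal{T}^{>0}$ and $\sigma_{\leq 0}(X)\in\mathcal{T}^{\leq 0}$. The truncation triangle is not required to be functorial or unique.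
   Formalization: The subcategory S is additionally assumed to be essentially small (a set of isomorphism classes), since without this truncation triangles can fail to exist; the shift functor is taken to be an automorphism and T to have small morphism groups, as usual. *)

theory Defs
  imports "HOL-Algebra.Free_Abelian_Groups"
begin

section \<open>Small sets\<close>

text \<open>
  A type \<open>'u\<close> plays the role of the universe of discourse: a set (over any type) is small if
  its cardinality is strictly below that of \<open>'u\<close>.  We ask only that countable sets be small and
  that small unions of small sets be small, i.e. that the cardinality of \<open>'u\<close> be uncountable
  and regular.  A strongly inaccessible cardinality gives the small sets of a Grothendieck
  universe.  Up to bijection the small sets are the small subsets of \<open>'u\<close>, so the latter
  suffice as index sets.
\<close>

definition small :: "'u itself \<Rightarrow> 'a set \<Rightarrow> bool"
  where "small _ A \<longleftrightarrow> A \<prec> (UNIV :: 'u set)"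

definition universe :: "'u itself \<Rightarrow> bool"
  where "universe U \<longleftrightarrow> small U (UNIV :: nat set) \<and>
    (\<forall>(I :: 'u set) (A :: 'u \<Rightarrow> 'u set).
       small U I \<and> (\<forall>i\<in>I. small U (A i)) \<longrightarrow> small U (\<Union>i\<in>I. A i))"


section \<open>Categories\<close>

record ('o, 'm) cat =
  obj :: "'o set"
  arr :: "'m set"
  src :: "'m \<Rightarrow> 'o"
  tgt :: "'m \<Rightarrow> 'o"
  idn :: "'o \<Rightarrow> 'm"
  cmp :: "'m \<Rightarrow> 'm \<Rightarrow> 'm"  (infixl \<open>\<cdot>\<index>\<close> 70)

definition Mor :: "('o, 'm, 'z) cat_scheme \<Rightarrow> 'o \<Rightarrow> 'o \<Rightarrow> 'm set"
  where "Mor C X Y = {f \<in> arr C. src C f = X \<and> tgt C f = Y}"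

locale category =
  fixes C :: "('o, 'm, 'z) cat_scheme" (structure)
  assumes src_obj: "f \<in> arr C \<Longrightarrow> src C f \<in> obj C"
    and tgt_obj: "f \<in> arr C \<Longrightarrow> tgt C f \<in> obj C"
    and idn_Mor: "X \<in> obj C \<Longrightarrow> idn C X \<in> Mor C X X"
    and cmp_Mor: "f \<in> Mor C X Y \<Longrightarrow> g \<in> Mor C Y Z \<Longrightarrow> g \<cdot> f \<in> Mor C X Z"
    and cmp_idn: "f \<in> Mor C X Y \<Longrightarrow> f \<cdot> idn C X = f"
    and idn_cmp: "f \<in> Mor C X Y \<Longrightarrow> idn C Y \<cdot> f = f"
    and cmp_assoc: "f \<in> Mor C W X \<Longrightarrow> g \<in> Mor C X Y \<Longrightarrow> h \<in> Mor C Y Z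
      \<Longrightarrow> (h \<cdot> g) \<cdot> f = h \<cdot> (g \<cdot> f)"

definition is_isom :: "('o, 'm, 'z) cat_scheme \<Rightarrow> 'o \<Rightarrow> 'o \<Rightarrow> 'm \<Rightarrow> bool"
  where "is_isom C X Y f \<longleftrightarrow> f \<in> Mor C X Y \<and>
    (\<exists>g \<in> Mor C Y X. g \<cdot>\<^bsub>C\<^esub> f = idn C X \<and> f \<cdot>\<^bsub>C\<^esub> g = idn C Y)"

definition isomorphic :: "('o, 'm, 'z) cat_scheme \<Rightarrow> 'o \<Rightarrow> 'o \<Rightarrow> bool"
  where "isomorphic C X Y \<longleftrightarrow> (\<exists>f. is_isom C X Y f)"

definition zero_object :: "('o, 'm, 'z) cat_scheme \<Rightarrow> 'o \<Rightarrow> bool"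
  where "zero_object C Z \<longleftrightarrow> Z \<in> obj C \<and>
    (\<forall>X \<in> obj C. (\<exists>!f. f \<in> Mor C X Z) \<and> (\<exists>!f. f \<in> Mor C Z X))"

definition is_coproduct ::
  "('o, 'm, 'z) cat_scheme \<Rightarrow> 'i set \<Rightarrow> ('i \<Rightarrow> 'o) \<Rightarrow> 'o \<Rightarrow> ('i \<Rightarrow> 'm) \<Rightarrow> bool"
  where "is_coproduct C I X P \<iota> \<longleftrightarrow> P \<in> obj C \<and> (\<forall>i\<in>I. \<iota> i \<in> Mor C (X i) P) \<and>
    (\<forall>Y \<in> obj C. \<forall>f. (\<forall>i\<in>I. f i \<in> Mor C (X i) Y) \<longrightarrow>
       (\<exists>!g. g \<in> Mor C P Y \<and> (\<forall>i\<in>I. g \<cdot>\<^bsub>C\<^esub> \<iota> i = f i)))"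

definition locally_small :: "'u itself \<Rightarrow> ('o, 'm, 'z) cat_scheme \<Rightarrow> bool"
  where "locally_small U C \<longleftrightarrow> (\<forall>X \<in> obj C. \<forall>Y \<in> obj C. small U (Mor C X Y))"

definition has_small_coproducts :: "'u itself \<Rightarrow> ('o, 'm, 'z) cat_scheme \<Rightarrow> bool"
  where "has_small_coproducts U C \<longleftrightarrow>
    (\<forall>(I :: 'u set) X. small U I \<and> (\<forall>i\<in>I. X i \<in> obj C) \<longrightarrow> (\<exists>P \<iota>. is_coproduct C I X P \<iota>))"

text \<open>A full subcategory is given by its set of objects.\<close>

definition essentially_small :: "'u itself \<Rightarrow> ('o, 'm, 'z) cat_scheme \<Rightarrow> 'o set \<Rightarrow> bool"
  where "essentially_small U C S \<longleftrightarrow>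
    (\<exists>S\<^sub>0 \<subseteq> S. small U S\<^sub>0 \<and> (\<forall>X \<in> S. \<exists>Y \<in> S\<^sub>0. isomorphic C X Y))"


section \<open>Additive categories\<close>

record ('o, 'm) additive_cat = "('o, 'm) cat" +
  mzero :: "'o \<Rightarrow> 'o \<Rightarrow> 'm"
  madd :: "'m \<Rightarrow> 'm \<Rightarrow> 'm"

text \<open>Abelian groups are commutative groups in the multiplicative notation of HOL-Algebra.\<close>

definition mor_group :: "('o, 'm, 'z) additive_cat_scheme \<Rightarrow> 'o \<Rightarrow> 'o \<Rightarrow> 'm monoid"
  where "mor_group A X Y =
    \<lparr>carrier = Mor A X Y, monoid.mult = madd A, one = mzero A X Y\<rparr>"

definition mneg :: "('o, 'm, 'z) additive_cat_scheme \<Rightarrow> 'm \<Rightarrow> 'm"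
  where "mneg A f = inv\<^bsub>mor_group A (src A f) (tgt A f)\<^esub> f"

text \<open>\<open>B\<close> is the biproduct of \<open>X\<close> and \<open>Y\<close>, with injections \<open>i\<close>, \<open>j\<close> and projections \<open>p\<close>, \<open>q\<close>.\<close>

definition is_biproduct ::
  "('o, 'm, 'z) additive_cat_scheme \<Rightarrow> 'o \<Rightarrow> 'o \<Rightarrow> 'o \<Rightarrow> 'm \<Rightarrow> 'm \<Rightarrow> 'm \<Rightarrow> 'm \<Rightarrow> bool"
  where "is_biproduct A X Y B i j p q \<longleftrightarrow>
    i \<in> Mor A X B \<and> j \<in> Mor A Y B \<and> p \<in> Mor A B X \<and> q \<in> Mor A B Y \<and>
    p \<cdot>\<^bsub>A\<^esub> i = idn A X \<and> q \<cdot>\<^bsub>A\<^esub> j = idn A Y \<and>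
    p \<cdot>\<^bsub>A\<^esub> j = mzero A Y X \<and> q \<cdot>\<^bsub>A\<^esub> i = mzero A X Y \<and>
    madd A (i \<cdot>\<^bsub>A\<^esub> p) (j \<cdot>\<^bsub>A\<^esub> q) = idn A B"

locale additive_category = category A
  for A :: "('o, 'm, 'z) additive_cat_scheme" (structure) +
  assumes mor_comm_group: "X \<in> obj A \<Longrightarrow> Y \<in> obj A \<Longrightarrow> comm_group (mor_group A X Y)"
    and cmp_madd_right: "f \<in> Mor A X Y \<Longrightarrow> f' \<in> Mor A X Y \<Longrightarrow> g \<in> Mor A Y Z
      \<Longrightarrow> g \<cdot> madd A f f' = madd A (g \<cdot> f) (g \<cdot> f')"
    and cmp_madd_left: "f \<in> Mor A X Y \<Longrightarrow> g \<in> Mor A Y Z \<Longrightarrow> g' \<in> Mor A Y Z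
      \<Longrightarrow> madd A g g' \<cdot> f = madd A (g \<cdot> f) (g' \<cdot> f)"
    and ex_zero_object: "\<exists>Z. zero_object A Z"
    and ex_biproduct: "X \<in> obj A \<Longrightarrow> Y \<in> obj A \<Longrightarrow>
      \<exists>B i j p q. B \<in> obj A \<and> is_biproduct A X Y B i j p q"

definition full_additive_subcategory :: "('o, 'm, 'z) additive_cat_scheme \<Rightarrow> 'o set \<Rightarrow> bool"
  where "full_additive_subcategory A S \<longleftrightarrow> S \<subseteq> obj A \<and> (\<exists>Z \<in> S. zero_object A Z) \<and>
    (\<forall>X \<in> S. \<forall>Y \<in> S. \<exists>B \<in> S. \<exists>i j p q. is_biproduct A X Y B i j p q)"

definition direct_summand :: "('o, 'm, 'z) additive_cat_scheme \<Rightarrow> 'o \<Rightarrow> 'o \<Rightarrow> bool"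
  where "direct_summand A X B \<longleftrightarrow> (\<exists>Y \<in> obj A. \<exists>i j p q. is_biproduct A X Y B i j p q)"

definition stable_under_summands :: "('o, 'm, 'z) additive_cat_scheme \<Rightarrow> 'o set \<Rightarrow> bool"
  where "stable_under_summands A S \<longleftrightarrow>
    (\<forall>B \<in> S. \<forall>X \<in> obj A. direct_summand A X B \<longrightarrow> X \<in> S)"

text \<open>
  The functor \<open>\<T>(S,?)\<close> commutes with small coproducts: the canonical map
  \<open>\<Oplus>\<^sub>i \<T>(S, X\<^sub>i) \<rightarrow> \<T>(S, \<Coprod>\<^sub>i X\<^sub>i)\<close> sending \<open>(\<phi>\<^sub>i)\<close> to the (finitely supported) sum of the
  \<open>\<iota>\<^sub>i \<cdot> \<phi>\<^sub>i\<close> is an isomorphism.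
\<close>

definition compact_object :: "'u itself \<Rightarrow> ('o, 'm, 'z) additive_cat_scheme \<Rightarrow> 'o \<Rightarrow> bool"
  where "compact_object U A S \<longleftrightarrow> S \<in> obj A \<and>
    (\<forall>(I :: 'u set) X P \<iota>. small U I \<and> (\<forall>i\<in>I. X i \<in> obj A) \<and> is_coproduct A I X P \<iota> \<longrightarrow>
       (\<lambda>\<phi>. gfinprod (mor_group A S P) (\<lambda>i. \<iota> i \<cdot>\<^bsub>A\<^esub> \<phi> i) I)
         \<in> iso (sum_group I (\<lambda>i. mor_group A S (X i))) (mor_group A S P))"


section \<open>Triangulated categories\<close>

text \<open>
  The shift functor is an automorphism; the structure records all its powers
  \<open>\<Sigma>\<^sup>p\<close>, for \<open>p\<close> an integer, on objects and on morphisms.  A member \<open>(f, g, h)\<close> of \<open>tri\<close> is a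
  (distinguished) triangle \<open>X \<rightarrow> Y \<rightarrow> Z \<rightarrow> \<Sigma>X\<close>.
\<close>

record ('o, 'm) triang_cat = "('o, 'm) additive_cat" +
  sh_obj :: "int \<Rightarrow> 'o \<Rightarrow> 'o"
  sh_mor :: "int \<Rightarrow> 'm \<Rightarrow> 'm"
  tri :: "('m \<times> 'm \<times> 'm) set"

definition triangle ::
  "('o, 'm, 'z) triang_cat_scheme \<Rightarrow> 'o \<Rightarrow> 'o \<Rightarrow> 'o \<Rightarrow> 'm \<Rightarrow> 'm \<Rightarrow> 'm \<Rightarrow> bool"
  where "triangle T X Y Z f g h \<longleftrightarrow>
    f \<in> Mor T X Y \<and> g \<in> Mor T Y Z \<and> h \<in> Mor T Z (sh_obj T 1 X) \<and> (f, g, h) \<in> tri T"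

locale triangulated_category = additive_category T
  for T :: "('o, 'm, 'z) triang_cat_scheme" (structure) +
  assumes sh_obj_closed: "X \<in> obj T \<Longrightarrow> sh_obj T p X \<in> obj T"
    and sh_mor_Mor: "f \<in> Mor T X Y \<Longrightarrow> sh_mor T p f \<in> Mor T (sh_obj T p X) (sh_obj T p Y)"
    and sh_mor_idn: "X \<in> obj T \<Longrightarrow> sh_mor T p (idn T X) = idn T (sh_obj T p X)"
    and sh_mor_cmp: "f \<in> Mor T X Y \<Longrightarrow> g \<in> Mor T Y Z
      \<Longrightarrow> sh_mor T p (g \<cdot> f) = sh_mor T p g \<cdot> sh_mor T p f"
    and sh_mor_madd: "f \<in> Mor T X Y \<Longrightarrow> g \<in> Mor T X Y
      \<Longrightarrow> sh_mor T p (madd T f g) = madd T (sh_mor T p f) (sh_mor T p g)"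
    and sh_obj_0: "X \<in> obj T \<Longrightarrow> sh_obj T 0 X = X"
    and sh_mor_0: "f \<in> arr T \<Longrightarrow> sh_mor T 0 f = f"
    and sh_obj_add: "X \<in> obj T \<Longrightarrow> sh_obj T (p + q) X = sh_obj T p (sh_obj T q X)"
    and sh_mor_add: "f \<in> arr T \<Longrightarrow> sh_mor T (p + q) f = sh_mor T p (sh_mor T q f)"
    and TR1_idn: "X \<in> obj T \<Longrightarrow> zero_object T Z
      \<Longrightarrow> triangle T X X Z (idn T X) (mzero T X Z) (mzero T Z (sh_obj T 1 X))"
    and TR1_cone: "f \<in> Mor T X Y \<Longrightarrow> \<exists>Z g h. triangle T X Y Z f g h"
    and TR1_isom: "triangle T X Y Z f g h \<Longrightarrow>
      f' \<in> Mor T X' Y' \<Longrightarrow> g' \<in> Mor T Y' Z' \<Longrightarrow> h' \<in> Mor T Z' (sh_obj T 1 X') \<Longrightarrow>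
      is_isom T X X' u \<Longrightarrow> is_isom T Y Y' v \<Longrightarrow> is_isom T Z Z' w \<Longrightarrow>
      v \<cdot> f = f' \<cdot> u \<Longrightarrow> w \<cdot> g = g' \<cdot> v \<Longrightarrow> sh_mor T 1 u \<cdot> h = h' \<cdot> w \<Longrightarrow>
      triangle T X' Y' Z' f' g' h'"
    and TR2: "f \<in> Mor T X Y \<Longrightarrow> g \<in> Mor T Y Z \<Longrightarrow> h \<in> Mor T Z (sh_obj T 1 X) \<Longrightarrow>
      triangle T X Y Z f g h \<longleftrightarrow>
      triangle T Y Z (sh_obj T 1 X) g h (mneg T (sh_mor T 1 f))"
    and TR3: "triangle T X Y Z f g h \<Longrightarrow> triangle T X' Y' Z' f' g' h' \<Longrightarrow>
      u \<in> Mor T X X' \<Longrightarrow> v \<in> Mor T Y Y' \<Longrightarrow> v \<cdot> f = f' \<cdot> u \<Longrightarrow>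
      \<exists>w \<in> Mor T Z Z'. w \<cdot> g = g' \<cdot> v \<and> sh_mor T 1 u \<cdot> h = h' \<cdot> w"
    and TR4: "triangle T X Y Z' f a b \<Longrightarrow> triangle T Y Z X' g c d \<Longrightarrow>
      triangle T X Z Y' (g \<cdot> f) e k \<Longrightarrow>
      \<exists>u v. triangle T Z' Y' X' u v (sh_mor T 1 a \<cdot> d) \<and>
        u \<cdot> a = e \<cdot> g \<and> k \<cdot> u = b \<and> v \<cdot> e = c \<and> d \<cdot> v = sh_mor T 1 f \<cdot> k"

definition truncation_triangle ::
  "('o, 'm, 'z) triang_cat_scheme \<Rightarrow> 'o set \<Rightarrow> 'o set \<Rightarrow> 'o \<Rightarrow> 'o \<Rightarrow> 'o \<Rightarrow> 'm \<Rightarrow> 'm \<Rightarrow> 'm \<Rightarrow> bool"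
  where "truncation_triangle T Tgt0 Tle0 U X V f g h \<longleftrightarrow>
    U \<in> Tgt0 \<and> V \<in> Tle0 \<and> triangle T U X V f g h"

definition weight_structure :: "('o, 'm, 'z) triang_cat_scheme \<Rightarrow> 'o set \<Rightarrow> 'o set \<Rightarrow> bool"
  where "weight_structure T Tgt0 Tle0 \<longleftrightarrow>
    full_additive_subcategory T Tgt0 \<and> full_additive_subcategory T Tle0 \<and>
    stable_under_summands T Tgt0 \<and> stable_under_summands T Tle0 \<and>
    (\<forall>X \<in> Tgt0. sh_obj T (-1) X \<in> Tgt0) \<and> (\<forall>X \<in> Tle0. sh_obj T 1 X \<in> Tle0) \<and>
    (\<forall>X \<in> Tgt0. \<forall>Y \<in> Tle0. Mor T X Y = {mzero T X Y}) \<and>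
    (\<forall>X \<in> obj T. \<exists>U V f g h. truncation_triangle T Tgt0 Tle0 U X V f g h)"

definition compactly_generates :: "'u itself \<Rightarrow> ('o, 'm, 'z) triang_cat_scheme \<Rightarrow> 'o set \<Rightarrow> bool"
  where "compactly_generates U T S \<longleftrightarrow>
    (\<forall>L \<in> S. compact_object U T L) \<and>
    (\<forall>M \<in> obj T. (\<forall>p. \<forall>L \<in> S. Mor T (sh_obj T p L) M = {mzero T (sh_obj T p L) M})
       \<longrightarrow> zero_object T M)"


section \<open>The category of additive functors from the opposite of S to abelian groups\<close>

text \<open>
  For a full subcategory \<open>S\<close>; the action \<open>act M f\<close> of \<open>f : L \<rightarrow> L'\<close> goes from \<open>M L'\<close> to \<open>M L\<close>.
\<close>

record ('o, 'm, 'g) smodule =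
  val :: "'o \<Rightarrow> 'g monoid"
  act :: "'m \<Rightarrow> 'g \<Rightarrow> 'g"

definition is_smodule ::
  "'u itself \<Rightarrow> ('o, 'm, 'z) additive_cat_scheme \<Rightarrow> 'o set \<Rightarrow> ('o, 'm, 'g) smodule \<Rightarrow> bool"
  where "is_smodule U A S M \<longleftrightarrow>
    (\<forall>L \<in> S. comm_group (val M L) \<and> small U (carrier (val M L))) \<and>
    (\<forall>L \<in> S. \<forall>L' \<in> S. \<forall>f \<in> Mor A L L'. act M f \<in> hom (val M L') (val M L)) \<and>
    (\<forall>L \<in> S. \<forall>x \<in> carrier (val M L). act M (idn A L) x = x) \<and>
    (\<forall>L \<in> S. \<forall>L' \<in> S. \<forall>L'' \<in> S. \<forall>f \<in> Mor A L L'. \<forall>g \<in> Mor A L' L''.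
       \<forall>x \<in> carrier (val M L''). act M (g \<cdot>\<^bsub>A\<^esub> f) x = act M f (act M g x)) \<and>
    (\<forall>L \<in> S. \<forall>L' \<in> S. \<forall>f \<in> Mor A L L'. \<forall>g \<in> Mor A L L'.
       \<forall>x \<in> carrier (val M L'). act M (madd A f g) x = act M f x \<otimes>\<^bsub>val M L\<^esub> act M g x)"

definition smodule_zero :: "'o set \<Rightarrow> ('o, 'm, 'g) smodule \<Rightarrow> bool"
  where "smodule_zero S M \<longleftrightarrow> (\<forall>L \<in> S. carrier (val M L) = {\<one>\<^bsub>val M L\<^esub>})"

definition smodule_hom ::
  "('o, 'm, 'z) additive_cat_scheme \<Rightarrow> 'o set \<Rightarrow> ('o, 'm, 'g) smodule \<Rightarrow> ('o, 'm, 'g) smodule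
    \<Rightarrow> ('o \<Rightarrow> 'g \<Rightarrow> 'g) \<Rightarrow> bool"
  where "smodule_hom A S M N \<eta> \<longleftrightarrow>
    (\<forall>L \<in> S. \<eta> L \<in> hom (val M L) (val N L)) \<and>
    (\<forall>L \<in> S. \<forall>L' \<in> S. \<forall>f \<in> Mor A L L'. \<forall>x \<in> carrier (val M L').
       \<eta> L (act M f x) = act N f (\<eta> L' x))"

definition smodule_iso ::
  "('o, 'm, 'z) additive_cat_scheme \<Rightarrow> 'o set \<Rightarrow> ('o, 'm, 'g) smodule \<Rightarrow> ('o, 'm, 'g) smodule
    \<Rightarrow> ('o \<Rightarrow> 'g \<Rightarrow> 'g) \<Rightarrow> bool"
  where "smodule_iso A S M N \<eta> \<longleftrightarrow> smodule_hom A S M N \<eta> \<and>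
    (\<exists>\<theta>. smodule_hom A S N M \<theta> \<and>
       (\<forall>L \<in> S. (\<forall>x \<in> carrier (val M L). \<theta> L (\<eta> L x) = x) \<and>
                 (\<forall>y \<in> carrier (val N L). \<eta> L (\<theta> L y) = y)))"

definition is_subfunctor ::
  "('o, 'm, 'z) additive_cat_scheme \<Rightarrow> 'o set \<Rightarrow> ('o, 'm, 'g) smodule \<Rightarrow> ('o \<Rightarrow> 'g set) \<Rightarrow> bool"
  where "is_subfunctor A S M N \<longleftrightarrow>
    (\<forall>L \<in> S. subgroup (N L) (val M L)) \<and>
    (\<forall>L \<in> S. \<forall>L' \<in> S. \<forall>f \<in> Mor A L L'. \<forall>x \<in> N L'. act M f x \<in> N L)"

definition subfunctor :: "('o, 'm, 'g) smodule \<Rightarrow> ('o \<Rightarrow> 'g set) \<Rightarrow> ('o, 'm, 'g) smodule"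
  where "subfunctor M N = \<lparr>val = (\<lambda>L. (val M L)\<lparr>carrier := N L\<rparr>), act = act M\<rparr>"

definition simple_smodule ::
  "('o, 'm, 'z) additive_cat_scheme \<Rightarrow> 'o set \<Rightarrow> ('o, 'm, 'g) smodule \<Rightarrow> bool"
  where "simple_smodule A S M \<longleftrightarrow> \<not> smodule_zero S M \<and>
    (\<forall>N. is_subfunctor A S M N \<longrightarrow>
       smodule_zero S (subfunctor M N) \<or> (\<forall>L \<in> S. N L = carrier (val M L)))"

text \<open>\<open>M\<close> is the (internal) direct sum of a family of simple subfunctors; sums are pointwise.\<close>

definition semisimple_smodule ::
  "('o, 'm, 'z) additive_cat_scheme \<Rightarrow> 'o set \<Rightarrow> ('o, 'm, 'g) smodule \<Rightarrow> bool"
  where "semisimple_smodule A S M \<longleftrightarrow>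
    (\<exists>J. (\<forall>N \<in> J. is_subfunctor A S M N \<and> simple_smodule A S (subfunctor M N)) \<and>
       (\<forall>L \<in> S. (\<lambda>x. gfinprod (val M L) x J)
          \<in> iso (sum_group J (\<lambda>N. val (subfunctor M N) L)) (val M L)))"

text \<open>
  \<open>Mod S\<close> is semi-simple.  The groups \<open>M L\<close> have carriers in the type \<open>'g\<close>; when \<open>'g\<close> has at least
  the cardinality of the universe \<open>'u\<close>, these are all the small abelian groups up to isomorphism.
\<close>

definition semisimple_Mod ::
  "'u itself \<Rightarrow> 'g itself \<Rightarrow> ('o, 'm, 'z) additive_cat_scheme \<Rightarrow> 'o set \<Rightarrow> bool"
  where "semisimple_Mod U _ A S \<longleftrightarrow>
    (\<forall>M :: ('o, 'm, 'g) smodule. is_smodule U A S M \<longrightarrow> semisimple_smodule A S M)"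


section \<open>The functors H^p\<close>

definition H_obj :: "('o, 'm, 'z) triang_cat_scheme \<Rightarrow> int \<Rightarrow> 'o \<Rightarrow> ('o, 'm, 'm) smodule"
  where "H_obj T p X =
    \<lparr>val = (\<lambda>L. mor_group T L (sh_obj T p X)), act = (\<lambda>f x. x \<cdot>\<^bsub>T\<^esub> f)\<rparr>"

definition H_mor :: "('o, 'm, 'z) triang_cat_scheme \<Rightarrow> int \<Rightarrow> 'm \<Rightarrow> 'o \<Rightarrow> 'm \<Rightarrow> 'm"
  where "H_mor T p g = (\<lambda>L x. sh_mor T p g \<cdot>\<^bsub>T\<^esub> x)"

lemma (in triangulated_category) H_obj_is_smodule:
  assumes "locally_small U T" "S \<subseteq> obj T" "X \<in> obj T"
  shows "is_smodule U T S (H_obj T p X)"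
proof -
  have Y: "sh_obj T p X \<in> obj T" using assms sh_obj_closed by blast
  show ?thesis
    unfolding is_smodule_def H_obj_def smodule.simps
  proof (intro conjI ballI)
    fix L assume "L \<in> S"
    then show "comm_group (mor_group T L (sh_obj T p X))"
      using Y assms mor_comm_group by blast
    show "small U (carrier (mor_group T L (sh_obj T p X)))"
      using \<open>L \<in> S\<close> Y assms by (auto simp: mor_group_def locally_small_def)
  qed (use cmp_Mor cmp_madd_left cmp_idn cmp_assoc cmp_madd_right in
        \<open>auto simp: mor_group_def hom_def\<close>)
qed

lemma (in triangulated_category) H_mor_hom:
  assumes "g \<in> Mor T X Y"
  shows "smodule_hom T S (H_obj T p X) (H_obj T p Y) (H_mor T p g)"
  using sh_mor_Mor[OF assms, of p] cmp_Mor cmp_madd_right cmp_assoc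
  by (auto simp: smodule_hom_def H_obj_def H_mor_def mor_group_def hom_def)

definition H_gt0 :: "('o, 'm, 'z) triang_cat_scheme \<Rightarrow> 'o set \<Rightarrow> 'o set"
  where "H_gt0 T S = {X \<in> obj T. \<forall>p \<le> 0. smodule_zero S (H_obj T p X)}"

definition H_le0 :: "('o, 'm, 'z) triang_cat_scheme \<Rightarrow> 'o set \<Rightarrow> 'o set"
  where "H_le0 T S = {X \<in> obj T. \<forall>p > 0. smodule_zero S (H_obj T p X)}"

end

theory Submission
  imports Defs
begin

text \<open>
  Semi-simplicity makes every \<open>H\<^sup>p X\<close> a direct sum
  of simple functors, and each of them is a direct summand of a representable functor.
  Idempotents split in \<open>T\<close>, so each simple functor is represented by an object of \<open>S\<close>, and
  \<open>H\<^sup>p X\<close> is \<open>H\<^sup>0 P\<close> for a coproduct \<open>P\<close> of objects of \<open>S\<close>, compactness turning the coproduct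
  into a direct sum.  By b), passing from \<open>X\<close> to the cone of the induced map \<open>\<Sigma>\<^sup>-\<^sup>p P \<rightarrow> X\<close>, with
  \<open>p > 0\<close>, kills \<open>H\<^sup>p X\<close> and leaves \<open>H\<^sup>q X\<close> unchanged for \<open>q \<le> 0\<close>; moreover every map from \<open>X\<close>
  to an object of \<open>H_le0 T S\<close> extends to the cone.  Iterating, the homotopy colimit is the
  truncation \<open>X \<rightarrow> V\<close>, through which all maps from \<open>X\<close> to \<open>H_le0 T S\<close> factor.  If \<open>X\<close> lies in
  \<open>H_gt0 T S\<close> then \<open>V\<close> has no cohomology, hence \<open>V = 0\<close>: this gives the orthogonality (w2).
\<close>

section \<open>Additive categories\<close>

text \<open>Killing a degree is weaker than it sounds. For the cone X' of \<Sigma>^{-p}P -> X the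
  map H^p X -> H^p X' is zero, but H^p X' also maps to H^1 P, about which b) says nothing, so X' may
  have new classes in degree p and above. Hence the sequence must return to every p > 0 infinitely
  often, and vanishing is reached only in the homotopy colimit: a map from a compact object comes
  from some stage and dies at a later one. In degrees q <= 0 the cone changes nothing because L has
  only zero maps to \<Sigma>^{q-p}P and \<Sigma>^{q-p+1}P. The exception is p = 1, q = 0, where the
  second exponent is 0. There injectivity of H^0 P -> H^1 X takes over, which is why P must realize
  H^p X exactly and not just surject onto it; this is where semi-simplicity enters. Homotopy
  colimits are weak colimits: induced maps exist but need not be unique. Existence is enough for
  extending maps to objects of \<open>H_le0 T S\<close>; the splitting of idempotents has to correct
  the induced map by an isomorphism. The coproduct P exists because the simple summands of a functor
  H^p X form a small set, by the smallness assumptions on S and on the groups of morphisms.\<close>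

context category
begin

lemma Mor_obj: "f \<in> Mor C X Y \<Longrightarrow> X \<in> obj C" "f \<in> Mor C X Y \<Longrightarrow> Y \<in> obj C"
  using src_obj tgt_obj by (auto simp: Mor_def)

lemma Mor_arr: "f \<in> Mor C X Y \<Longrightarrow> f \<in> arr C"
  by (simp add: Mor_def)

lemma coproduct_Mor:
  "is_coproduct C I X P \<iota> \<Longrightarrow> i \<in> I \<Longrightarrow> \<iota> i \<in> Mor C (X i) P"
  by (simp add: is_coproduct_def)

lemma coproduct_ex1:
  assumes "is_coproduct C I X P \<iota>" "Y \<in> obj C" "\<And>i. i \<in> I \<Longrightarrow> f i \<in> Mor C (X i) Y"
  shows "\<exists>!g. g \<in> Mor C P Y \<and> (\<forall>i\<in>I. g \<cdot> \<iota> i = f i)"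
  using assms by (simp add: is_coproduct_def)

lemma coproduct_ex:
  assumes "is_coproduct C I X P \<iota>" "Y \<in> obj C" "\<And>i. i \<in> I \<Longrightarrow> f i \<in> Mor C (X i) Y"
  obtains g where "g \<in> Mor C P Y" "\<And>i. i \<in> I \<Longrightarrow> g \<cdot> \<iota> i = f i"
  using coproduct_ex1[OF assms] that by blast

lemma coproduct_eq:
  assumes P: "is_coproduct C I X P \<iota>" and g: "g \<in> Mor C P Y" and h: "h \<in> Mor C P Y"
    and eq: "\<And>i. i \<in> I \<Longrightarrow> g \<cdot> \<iota> i = h \<cdot> \<iota> i"
  shows "g = h"
proof -
  have "\<exists>!k. k \<in> Mor C P Y \<and> (\<forall>i\<in>I. k \<cdot> \<iota> i = g \<cdot> \<iota> i)"
    by (rule coproduct_ex1[OF P Mor_obj(2)[OF g] cmp_Mor[OF coproduct_Mor[OF P] g]])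
  then show ?thesis using g h eq by (metis (no_types, lifting))
qed

text \<open>Smallness is tested on subsets of the universe type, while the coproducts that occur are
  indexed by naturals and by sets of subfunctors. The universal property is carried along
  \<open>h\<close>, with \<open>k\<close> as its inverse.\<close>

lemma coproduct_reindex:
  assumes h: "bij_betw h J I" and P: "is_coproduct C J X P \<iota>"
    and k: "\<And>j. j \<in> J \<Longrightarrow> k (h j) = j"
  shows "is_coproduct C I (\<lambda>i. X (k i)) P (\<lambda>i. \<iota> (k i))"
  unfolding is_coproduct_def
proof (intro conjI ballI allI impI)
  show "P \<in> obj C" using P by (simp add: is_coproduct_def)
  have kJ: "k i \<in> J" "h (k i) = i" if "i \<in> I" for i
    using that h k unfolding bij_betw_def by auto
  then show "\<iota> (k i) \<in> Mor C (X (k i)) P" if "i \<in> I" for i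
    using coproduct_Mor[OF P] that by blast
  fix Y f assume Y: "Y \<in> obj C" and f: "\<forall>i\<in>I. f i \<in> Mor C (X (k i)) Y"
  have hI: "h j \<in> I" if "j \<in> J" for j using h that by (auto simp: bij_betw_def)
  have "f (h j) \<in> Mor C (X j) Y" if "j \<in> J" for j
    using f hI[OF that] k[OF that] by force
  then have "\<exists>!g. g \<in> Mor C P Y \<and> (\<forall>j\<in>J. g \<cdot> \<iota> j = f (h j))"
    by (rule coproduct_ex1[OF P Y])
  moreover have "(\<forall>i\<in>I. g \<cdot> \<iota> (k i) = f i) \<longleftrightarrow> (\<forall>j\<in>J. g \<cdot> \<iota> j = f (h j))" for g
  proof
    show "\<forall>j\<in>J. g \<cdot> \<iota> j = f (h j)" if "\<forall>i\<in>I. g \<cdot> \<iota> (k i) = f i"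
      using that hI k by force
    show "\<forall>i\<in>I. g \<cdot> \<iota> (k i) = f i" if "\<forall>j\<in>J. g \<cdot> \<iota> j = f (h j)"
      using that kJ by force
  qed
  ultimately show "\<exists>!g. g \<in> Mor C P Y \<and> (\<forall>i\<in>I. g \<cdot> \<iota> (k i) = f i)" by simp
qed

end

context additive_category
begin

text \<open>Groups of morphisms are multiplicative in HOL-Algebra, so a sum of morphisms is a
  \<open>finprod\<close>. The \<open>gfinprod\<close> of the definitions is such a product over the
  support, when that is finite.\<close>

abbreviation msum :: "'o \<Rightarrow> 'o \<Rightarrow> ('i \<Rightarrow> 'm) \<Rightarrow> 'i set \<Rightarrow> 'm"
  where "msum X Y \<equiv> finprod (mor_group A X Y)"

lemma mor_group_simps [simp]:
  "carrier (mor_group A X Y) = Mor A X Y"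
  "f \<otimes>\<^bsub>mor_group A X Y\<^esub> g = madd A f g"
  "\<one>\<^bsub>mor_group A X Y\<^esub> = mzero A X Y"
  by (simp_all add: mor_group_def)

lemma mzero_Mor: "X \<in> obj A \<Longrightarrow> Y \<in> obj A \<Longrightarrow> mzero A X Y \<in> Mor A X Y"
  using monoid.one_closed[of "mor_group A X Y"] mor_comm_group[of X Y]
  by (simp add: comm_group_def comm_monoid_def)

lemma mor_group_Mor: "f \<in> Mor A X Y \<Longrightarrow> comm_group (mor_group A X Y)"
  using mor_comm_group Mor_obj by blast

lemma madd_Mor: "f \<in> Mor A X Y \<Longrightarrow> g \<in> Mor A X Y \<Longrightarrow> madd A f g \<in> Mor A X Y"
  using monoid.m_closed[of "mor_group A X Y" f g] mor_group_Mor[of f X Y]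
  by (simp add: comm_group_def comm_monoid_def)

lemma madd_mzero:
  assumes "f \<in> Mor A X Y"
  shows "madd A f (mzero A X Y) = f" "madd A (mzero A X Y) f = f"
proof -
  interpret G: comm_group "mor_group A X Y" using mor_group_Mor[OF assms] .
  show "madd A f (mzero A X Y) = f" "madd A (mzero A X Y) f = f"
    using G.r_one[of f] G.l_one[of f] assms by simp_all
qed

lemma mneg_Mor:
  assumes "f \<in> Mor A X Y"
  shows "mneg A f \<in> Mor A X Y"
proof -
  interpret G: comm_group "mor_group A X Y" using mor_group_Mor[OF assms] .
  show ?thesis using G.inv_closed[of f] assms by (simp add: mneg_def Mor_def)
qed

lemma madd_mneg:
  assumes "f \<in> Mor A X Y"
  shows "madd A f (mneg A f) = mzero A X Y" "madd A (mneg A f) f = mzero A X Y"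
proof -
  interpret G: comm_group "mor_group A X Y" using mor_group_Mor[OF assms] .
  have "mneg A f = inv\<^bsub>mor_group A X Y\<^esub> f" using assms by (simp add: mneg_def Mor_def)
  then show "madd A f (mneg A f) = mzero A X Y" "madd A (mneg A f) f = mzero A X Y"
    using G.r_inv[of f] G.l_inv[of f] assms by simp_all
qed

lemma madd_assoc:
  assumes "f \<in> Mor A X Y" "g \<in> Mor A X Y" "h \<in> Mor A X Y"
  shows "madd A (madd A f g) h = madd A f (madd A g h)"
proof -
  interpret G: comm_group "mor_group A X Y" using mor_group_Mor[OF assms(1)] .
  show ?thesis using G.m_assoc[of f g h] assms by simp
qed

lemma madd_commute:
  assumes "f \<in> Mor A X Y" "g \<in> Mor A X Y"
  shows "madd A f g = madd A g f"
proof -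
  interpret G: comm_group "mor_group A X Y" using mor_group_Mor[OF assms(1)] .
  show ?thesis using G.m_comm[of f g] assms by simp
qed

text \<open>There is no subtraction in the language. This is how a trivial kernel yields
  injectivity, and how fixed points of \<sigma> are recognized through 1 - \<sigma>.\<close>

lemma madd_mneg_eq_mzero_iff:
  assumes "f \<in> Mor A X Y" "g \<in> Mor A X Y"
  shows "madd A f (mneg A g) = mzero A X Y \<longleftrightarrow> f = g"
proof -
  interpret G: comm_group "mor_group A X Y" using mor_group_Mor[OF assms(1)] .
  have "mneg A g = inv\<^bsub>mor_group A X Y\<^esub> g" using assms by (simp add: mneg_def Mor_def)
  then have "madd A f (mneg A g) = mzero A X Y \<longleftrightarrow> mzero A X Y = madd A f (mneg A g)"
    by auto
  also have "\<dots> \<longleftrightarrow> mzero A X Y \<otimes>\<^bsub>mor_group A X Y\<^esub> g = f"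
    using G.inv_solve_right[of "mzero A X Y" f g] assms mzero_Mor[OF Mor_obj[OF assms(1)]]
      \<open>mneg A g = inv\<^bsub>mor_group A X Y\<^esub> g\<close> by auto
  finally show ?thesis using madd_mzero[OF assms(2)] by auto
qed

text \<open>Applied with \<open>g = f\<close>: a morphism with f + f = f vanishes, which is why
  composition and shift preserve zero morphisms.\<close>

lemma madd_cancel:
  assumes "f \<in> Mor A X Y" "g \<in> Mor A X Y" "madd A f g = f"
  shows "g = mzero A X Y"
proof -
  interpret G: comm_group "mor_group A X Y" using mor_group_Mor[OF assms(1)] .
  show ?thesis using G.r_cancel_one'[of f g] G.l_cancel_one'[of f g] assms by auto
qed

lemma cmp_mzero:
  assumes "g \<in> Mor A Y Z" "X \<in> obj A"
  shows "g \<cdot> mzero A X Y = mzero A X Z"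
proof -
  have z: "mzero A X Y \<in> Mor A X Y" using assms mzero_Mor Mor_obj by blast
  have "madd A (g \<cdot> mzero A X Y) (g \<cdot> mzero A X Y) = g \<cdot> mzero A X Y"
    using cmp_madd_right[OF z z assms(1)] madd_mzero[OF z] by simp
  then show ?thesis using madd_cancel cmp_Mor z assms(1) by blast
qed

lemma mzero_cmp:
  assumes "f \<in> Mor A X Y" "Z \<in> obj A"
  shows "mzero A Y Z \<cdot> f = mzero A X Z"
proof -
  have z: "mzero A Y Z \<in> Mor A Y Z" using assms mzero_Mor Mor_obj by blast
  have "madd A (mzero A Y Z \<cdot> f) (mzero A Y Z \<cdot> f) = mzero A Y Z \<cdot> f"
    using cmp_madd_left[OF assms(1) z z] madd_mzero[OF z] by simp
  then show ?thesis using madd_cancel cmp_Mor z assms(1) by blast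
qed

lemma mneg_unique:
  assumes "f \<in> Mor A X Y" "g \<in> Mor A X Y" "madd A f g = mzero A X Y"
  shows "g = mneg A f"
proof -
  interpret G: comm_group "mor_group A X Y" using mor_group_Mor[OF assms(1)] .
  have "mneg A f = inv\<^bsub>mor_group A X Y\<^esub> f" using assms by (simp add: mneg_def Mor_def)
  then show ?thesis using G.inv_equality[of g f] assms madd_commute by simp
qed

lemma mneg_mneg: "f \<in> Mor A X Y \<Longrightarrow> mneg A (mneg A f) = f"
  using mneg_unique[of "mneg A f" X Y f] mneg_Mor[of f X Y] madd_mneg(2)[of f X Y] by simp

lemma mneg_mzero: "X \<in> obj A \<Longrightarrow> Y \<in> obj A \<Longrightarrow> mneg A (mzero A X Y) = mzero A X Y"
  using mneg_unique[of "mzero A X Y" X Y "mzero A X Y"] mzero_Mor[of X Y] madd_mzero[OF mzero_Mor[of X Y]]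
  by simp

lemma mneg_eq_mzero_iff:
  "f \<in> Mor A X Y \<Longrightarrow> mneg A f = mzero A X Y \<longleftrightarrow> f = mzero A X Y"
  using mneg_mneg[of f X Y] mneg_mzero[of X Y] Mor_obj[of f X Y] by auto

lemma cmp_mneg:
  assumes "f \<in> Mor A X Y" "g \<in> Mor A Y Z"
  shows "g \<cdot> mneg A f = mneg A (g \<cdot> f)"
proof (rule mneg_unique)
  show "madd A (g \<cdot> f) (g \<cdot> mneg A f) = mzero A X Z"
    using cmp_madd_right[OF assms(1) mneg_Mor[OF assms(1)] assms(2)] madd_mneg(1)[OF assms(1)]
      cmp_mzero[OF assms(2) Mor_obj(1)[OF assms(1)]] by simp
qed (use assms mneg_Mor cmp_Mor in blast)+

lemma mneg_cmp:
  assumes "f \<in> Mor A X Y" "g \<in> Mor A Y Z"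
  shows "mneg A g \<cdot> f = mneg A (g \<cdot> f)"
proof (rule mneg_unique)
  show "madd A (g \<cdot> f) (mneg A g \<cdot> f) = mzero A X Z"
    using cmp_madd_left[OF assms(1,2) mneg_Mor[OF assms(2)]] madd_mneg(1)[OF assms(2)]
      mzero_cmp[OF assms(1) Mor_obj(2)[OF assms(2)]] by simp
qed (use assms mneg_Mor cmp_Mor in blast)+

lemma zero_object_Mor:
  assumes "zero_object A Z"
  shows "f \<in> Mor A X Z \<Longrightarrow> f = mzero A X Z" "f \<in> Mor A Z X \<Longrightarrow> f = mzero A Z X"
proof -
  have Z: "Z \<in> obj A" using assms by (simp add: zero_object_def)
  show "f = mzero A X Z" if f: "f \<in> Mor A X Z"
    using assms f mzero_Mor[OF Mor_obj(1)[OF f] Z] Mor_obj(1)[OF f]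
    unfolding zero_object_def by blast
  show "f = mzero A Z X" if f: "f \<in> Mor A Z X"
    using assms f mzero_Mor[OF Z Mor_obj(2)[OF f]] Mor_obj(2)[OF f]
    unfolding zero_object_def by blast
qed

lemma cmp_eq_mzero:
  "f \<in> Mor A X Y \<Longrightarrow> g \<in> Mor A Y Z \<Longrightarrow> f = mzero A X Y \<Longrightarrow> g \<cdot> f = mzero A X Z"
  using cmp_mzero[OF _ Mor_obj(1)] by simp

lemma msum_Mor:
  assumes "X \<in> obj A" "Y \<in> obj A" "\<And>i. i \<in> F \<Longrightarrow> \<phi> i \<in> Mor A X Y"
  shows "msum X Y \<phi> F \<in> Mor A X Y"
proof -
  interpret G: comm_group "mor_group A X Y" using mor_comm_group assms by blast
  show ?thesis using G.finprod_closed[of \<phi> F] assms(3) by auto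
qed

lemma msum_empty: "X \<in> obj A \<Longrightarrow> Y \<in> obj A \<Longrightarrow> msum X Y \<phi> {} = mzero A X Y"
  using comm_monoid.finprod_empty[of "mor_group A X Y" \<phi>] mor_comm_group
  by (simp add: comm_group_def)

lemma msum_insert:
  assumes "finite F" "i \<notin> F" "\<And>j. j \<in> insert i F \<Longrightarrow> \<phi> j \<in> Mor A X Y"
  shows "msum X Y \<phi> (insert i F) = madd A (\<phi> i) (msum X Y \<phi> F)"
proof -
  interpret G: comm_group "mor_group A X Y" using mor_group_Mor assms(3) by blast
  show ?thesis using G.finprod_insert[of F i \<phi>] assms by auto
qed

lemma msum_cong:
  assumes "X \<in> obj A" "Y \<in> obj A" "\<And>i. i \<in> F \<Longrightarrow> \<phi> i \<in> Mor A X Y" "\<And>i. i \<in> F \<Longrightarrow> \<phi> i = \<psi> i"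
  shows "msum X Y \<phi> F = msum X Y \<psi> F"
proof -
  interpret G: comm_group "mor_group A X Y" using mor_comm_group assms by blast
  show ?thesis using G.finprod_cong'[of F F \<psi> \<phi>] assms by auto
qed

lemma cmp_msum:
  assumes "finite F" "X \<in> obj A" "g \<in> Mor A Y Z" "\<And>i. i \<in> F \<Longrightarrow> \<phi> i \<in> Mor A X Y"
  shows "g \<cdot> msum X Y \<phi> F = msum X Z (\<lambda>i. g \<cdot> \<phi> i) F"
  using assms
proof (induction F)
  case empty
  then show ?case using msum_empty cmp_mzero Mor_obj by metis
next
  case (insert i F)
  have "msum X Y \<phi> F \<in> Mor A X Y"
    using msum_Mor[of X Y F \<phi>] insert.prems Mor_obj by blast
  moreover have "\<phi> i \<in> Mor A X Y" "\<And>j. j \<in> insert i F \<Longrightarrow> g \<cdot> \<phi> j \<in> Mor A X Z"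
    using insert.prems cmp_Mor by blast+
  ultimately show ?case
    using insert msum_insert[of F i \<phi> X Y] msum_insert[of F i "\<lambda>i. g \<cdot> \<phi> i" X Z]
      cmp_madd_right[of "\<phi> i" X Y "msum X Y \<phi> F" g Z] by auto
qed

lemma msum_cmp:
  assumes "finite F" "f \<in> Mor A X Y" "Z \<in> obj A" "\<And>i. i \<in> F \<Longrightarrow> \<phi> i \<in> Mor A Y Z"
  shows "msum Y Z \<phi> F \<cdot> f = msum X Z (\<lambda>i. \<phi> i \<cdot> f) F"
  using assms
proof (induction F)
  case empty
  then show ?case using msum_empty mzero_cmp Mor_obj by metis
next
  case (insert i F)
  have "msum Y Z \<phi> F \<in> Mor A Y Z"
    using msum_Mor[of Y Z F \<phi>] insert.prems Mor_obj by blast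
  moreover have "\<phi> i \<in> Mor A Y Z" "\<And>j. j \<in> insert i F \<Longrightarrow> \<phi> j \<cdot> f \<in> Mor A X Z"
    using insert.prems cmp_Mor by blast+
  ultimately show ?case
    using insert msum_insert[of F i \<phi> Y Z] msum_insert[of F i "\<lambda>i. \<phi> i \<cdot> f" X Z]
      cmp_madd_left[of f X Y "\<phi> i" Z "msum Y Z \<phi> F"] by auto
qed

lemma msum_zero:
  assumes "X \<in> obj A" "Y \<in> obj A" "\<And>i. i \<in> F \<Longrightarrow> \<phi> i = mzero A X Y"
  shows "msum X Y \<phi> F = mzero A X Y"
proof -
  interpret G: comm_group "mor_group A X Y" using mor_comm_group assms by blast
  show ?thesis using G.finprod_one_eqI[of F \<phi>] assms by auto
qed

section \<open>Coordinates of finite sums in a coproduct\<close>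

text \<open>A coproduct has no given projections, but zero morphisms turn the identity of one
  summand into a compatible family of maps out of all summands.\<close>

lemma coproduct_projection:
  assumes P: "is_coproduct A I X P \<iota>" and X: "\<And>i. i \<in> I \<Longrightarrow> X i \<in> obj A" and j: "j \<in> I"
  obtains \<pi> where "\<pi> \<in> Mor A P (X j)" "\<pi> \<cdot> \<iota> j = idn A (X j)"
    "\<And>i. i \<in> I \<Longrightarrow> i \<noteq> j \<Longrightarrow> \<pi> \<cdot> \<iota> i = mzero A (X i) (X j)"
proof -
  have "(if i = j then idn A (X j) else mzero A (X i) (X j)) \<in> Mor A (X i) (X j)" if "i \<in> I" for i
    using that X j idn_Mor mzero_Mor by simp
  from coproduct_ex[OF P X[OF j] this] obtain \<pi> where "\<pi> \<in> Mor A P (X j)"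
    "\<And>i. i \<in> I \<Longrightarrow> \<pi> \<cdot> \<iota> i = (if i = j then idn A (X j) else mzero A (X i) (X j))" by blast
  with that j show ?thesis by force
qed

text \<open>All terms with i different from j die under the projection. Reading off coefficients in
  this way makes finite expansions unique.\<close>

lemma coproduct_msum_projection:
  assumes P: "is_coproduct A I X P \<iota>" and X: "\<And>i. i \<in> I \<Longrightarrow> X i \<in> obj A" and K: "K \<in> obj A"
    and F: "finite F" "F \<subseteq> I" "\<And>i. i \<in> F \<Longrightarrow> \<phi> i \<in> Mor A K (X i)" and j: "j \<in> F"
    and \<pi>: "\<pi> \<in> Mor A P (X j)" "\<pi> \<cdot> \<iota> j = idn A (X j)"
    "\<And>i. i \<in> I \<Longrightarrow> i \<noteq> j \<Longrightarrow> \<pi> \<cdot> \<iota> i = mzero A (X i) (X j)"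
  shows "\<pi> \<cdot> msum K P (\<lambda>i. \<iota> i \<cdot> \<phi> i) F = \<phi> j"
proof -
  have \<iota>: "\<iota> i \<in> Mor A (X i) P" if "i \<in> F" for i using coproduct_Mor[OF P] F that by blast
  have Xj: "X j \<in> obj A" using X F j by blast
  have c: "\<pi> \<cdot> (\<iota> i \<cdot> \<phi> i) = (if i = j then \<phi> j else mzero A K (X j))" if "i \<in> F" for i
    using cmp_assoc[OF F(3)[OF that] \<iota>[OF that] \<pi>(1)] \<pi>(2,3) idn_cmp[OF F(3)[OF j]]
      mzero_cmp[OF F(3)[OF that] Xj] F that by auto
  interpret G: comm_group "mor_group A K (X j)" using mor_comm_group K Xj .
  have "\<pi> \<cdot> msum K P (\<lambda>i. \<iota> i \<cdot> \<phi> i) F = msum K (X j) (\<lambda>i. \<pi> \<cdot> (\<iota> i \<cdot> \<phi> i)) F"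
    by (rule cmp_msum[OF F(1) K \<pi>(1)]) (rule cmp_Mor[OF F(3) \<iota>])
  also have "\<dots> = msum K (X j) (\<lambda>i. if i = j then \<phi> j else mzero A K (X j)) F"
    by (rule msum_cong[OF K Xj]) (use c F(3)[OF j] mzero_Mor[OF K Xj] in auto)
  also have "\<dots> = \<phi> j"
    using G.finprod_singleton_swap[OF j F(1), of "\<lambda>_. \<phi> j"] F(3)[OF j] by (simp cong: if_cong)
  finally show ?thesis .
qed

lemma coproduct_msum_other:
  assumes P: "is_coproduct A I X P \<iota>" and X: "\<And>i. i \<in> I \<Longrightarrow> X i \<in> obj A" and K: "K \<in> obj A"
    and F: "finite F" "F \<subseteq> I" "\<And>i. i \<in> F \<Longrightarrow> \<phi> i \<in> Mor A K (X i)" and j: "j \<in> I - F"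
    and \<pi>: "\<pi> \<in> Mor A P (X j)"
    "\<And>i. i \<in> I \<Longrightarrow> i \<noteq> j \<Longrightarrow> \<pi> \<cdot> \<iota> i = mzero A (X i) (X j)"
  shows "\<pi> \<cdot> msum K P (\<lambda>i. \<iota> i \<cdot> \<phi> i) F = mzero A K (X j)"
proof -
  have \<iota>: "\<iota> i \<in> Mor A (X i) P" if "i \<in> F" for i using coproduct_Mor[OF P] F that by blast
  have Xj: "X j \<in> obj A" using X j by blast
  have c: "\<pi> \<cdot> (\<iota> i \<cdot> \<phi> i) = mzero A K (X j)" if "i \<in> F" for i
  proof -
    have "i \<in> I" "i \<noteq> j" using F j that by auto
    then show ?thesis
      using cmp_assoc[OF F(3)[OF that] \<iota>[OF that] \<pi>(1)] \<pi>(2) mzero_cmp[OF F(3)[OF that] Xj] by simp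
  qed
  have "\<pi> \<cdot> msum K P (\<lambda>i. \<iota> i \<cdot> \<phi> i) F = msum K (X j) (\<lambda>i. \<pi> \<cdot> (\<iota> i \<cdot> \<phi> i)) F"
    by (rule cmp_msum[OF F(1) K \<pi>(1)]) (rule cmp_Mor[OF F(3) \<iota>])
  also have "\<dots> = mzero A K (X j)" by (rule msum_zero[OF K Xj c])
  finally show ?thesis .
qed

end

section \<open>Compactness and finite sums\<close>

text \<open>Only the surjectivity half of compactness, with the finite support made explicit. Its
  injectivity half is recovered where needed from the projections of the coproduct.\<close>

definition (in additive_category) finitary :: "'u itself \<Rightarrow> 'o \<Rightarrow> bool"
  where "finitary U K \<longleftrightarrow> K \<in> obj A \<and>
    (\<forall>(I :: 'u set) X P \<iota> y. small U I \<longrightarrow> (\<forall>i\<in>I. X i \<in> obj A) \<longrightarrow> is_coproduct A I X P \<iota> \<longrightarrow>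
      y \<in> Mor A K P \<longrightarrow>
      (\<exists>F \<phi>. finite F \<and> F \<subseteq> I \<and> (\<forall>i\<in>F. \<phi> i \<in> Mor A K (X i)) \<and>
         y = msum K P (\<lambda>i. \<iota> i \<cdot> \<phi> i) F))"

context additive_category
begin

lemma compact_finitary:
  fixes U :: "'u itself"
  assumes "compact_object U A K"
  shows "finitary U K"
  unfolding finitary_def
proof (intro conjI allI impI)
  show K: "K \<in> obj A" using assms by (simp add: compact_object_def)
  fix I :: "'u set" and X P \<iota> y
  assume I: "small U I" and X: "\<forall>i\<in>I. X i \<in> obj A" and P: "is_coproduct A I X P \<iota>"
    and y: "y \<in> Mor A K P"
  let ?G = "sum_group I (\<lambda>i. mor_group A K (X i))"
  have "(\<lambda>\<phi>. gfinprod (mor_group A K P) (\<lambda>i. \<iota> i \<cdot> \<phi> i) I) \<in> iso ?G (mor_group A K P)"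
    using assms I X P unfolding compact_object_def by blast
  then have "y \<in> (\<lambda>\<phi>. gfinprod (mor_group A K P) (\<lambda>i. \<iota> i \<cdot> \<phi> i) I) ` carrier ?G"
    using y by (simp add: iso_def bij_betw_def)
  then obtain \<phi> where \<phi>: "\<phi> \<in> carrier ?G"
    and y: "y = gfinprod (mor_group A K P) (\<lambda>i. \<iota> i \<cdot> \<phi> i) I"
    by blast
  have "group (mor_group A K (X i))" if "i \<in> I" for i
    using mor_comm_group[OF K] X that by (simp add: comm_group_def)
  then have \<phi>_Mor: "\<And>i. i \<in> I \<Longrightarrow> \<phi> i \<in> Mor A K (X i)"
    and fin: "finite {i \<in> I. \<phi> i \<noteq> mzero A K (X i)}"
    using \<phi> by (auto simp: carrier_sum_group)
  \<comment> \<open>\<open>gfinprod\<close> looks at the support of the composites. It may be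
    smaller than that of \<open>\<phi>\<close>, and it is finite because composing with zero gives
    zero.\<close>
  let ?F = "{i \<in> I. \<iota> i \<cdot> \<phi> i \<noteq> mzero A K P}"
  have "?F \<subseteq> {i \<in> I. \<phi> i \<noteq> mzero A K (X i)}"
    using cmp_mzero[OF coproduct_Mor[OF P] K] by auto
  then have F: "finite ?F" using fin finite_subset by blast
  show "\<exists>F \<phi>. finite F \<and> F \<subseteq> I \<and> (\<forall>i\<in>F. \<phi> i \<in> Mor A K (X i)) \<and>
      y = msum K P (\<lambda>i. \<iota> i \<cdot> \<phi> i) F"
    by (rule exI[of _ ?F], rule exI[of _ \<phi>]) (use F \<phi>_Mor y in \<open>auto simp: gfinprod_def\<close>)
qed

text \<open>\<open>finitary\<close> speaks of index sets in the universe type only. The set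
  \<open>J\<close> is carried into it by an injection, and the finite sum is brought back by
  reindexing.\<close>

lemma finitaryE:
  fixes U :: "'u itself" and J :: "'j set"
  assumes K: "finitary U K" and J: "small U J" and X: "\<And>j. j \<in> J \<Longrightarrow> X j \<in> obj A"
    and P: "is_coproduct A J X P \<iota>" and y: "y \<in> Mor A K P"
  obtains F \<phi> where "finite F" "F \<subseteq> J" "\<And>j. j \<in> F \<Longrightarrow> \<phi> j \<in> Mor A K (X j)"
    "y = msum K P (\<lambda>j. \<iota> j \<cdot> \<phi> j) F"
proof -
  obtain h :: "'j \<Rightarrow> 'u" where h: "inj_on h J"
    using lesspoll_imp_lepoll J unfolding small_def lepoll_def by blast
  define k where "k = inv_into J h"
  have kh: "k (h j) = j" if "j \<in> J" for j using h that by (simp add: k_def)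
  have "h ` J \<approx> J" using h inj_on_image_eqpoll_self by blast
  then have I: "small U (h ` J)"
    using J unfolding small_def by (meson eqpoll_imp_lepoll lesspoll_trans1)
  have P': "is_coproduct A (h ` J) (\<lambda>i. X (k i)) P (\<lambda>i. \<iota> (k i))"
    by (rule coproduct_reindex[where h = h and J = J])
      (use h P kh in \<open>simp_all add: bij_betw_def\<close>)
  have X': "\<forall>i\<in>h ` J. X (k i) \<in> obj A" using X kh by auto
  obtain F \<phi> where F: "finite F" "F \<subseteq> h ` J" and \<phi>: "\<forall>i\<in>F. \<phi> i \<in> Mor A K (X (k i))"
    and y_eq: "y = msum K P (\<lambda>i. \<iota> (k i) \<cdot> \<phi> i) F"
    using K[unfolded finitary_def, THEN conjunct2, rule_format, OF I _ P' y] X' by blast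
  have FJ: "k ` F \<subseteq> J" and hk: "\<And>i. i \<in> F \<Longrightarrow> h (k i) = i" using F kh by auto
  have hF: "h ` (k ` F) = F" using hk by force
  interpret G: comm_group "mor_group A K P" using mor_group_Mor[OF y] .
  have Mor: "\<iota> (k i) \<cdot> \<phi> i \<in> Mor A K P" if "i \<in> F" for i
    by (rule cmp_Mor[OF \<phi>[rule_format, OF that] coproduct_Mor[OF P]]) (use FJ that in auto)
  have "y = msum K P (\<lambda>j. \<iota> (k (h j)) \<cdot> \<phi> (h j)) (k ` F)"
    using G.finprod_reindex[of "\<lambda>i. \<iota> (k i) \<cdot> \<phi> i" h "k ` F"] inj_on_subset[OF h FJ] hF y_eq Mor
    by auto
  also have "\<dots> = msum K P (\<lambda>j. \<iota> j \<cdot> \<phi> (h j)) (k ` F)"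
    by (rule msum_cong[OF Mor_obj[OF y]]) (use hk Mor in auto)
  finally show thesis using that[of "k ` F" "\<lambda>j. \<phi> (h j)", OF _ FJ] F(1) \<phi> hk by force
qed

lemma finitary_eq_mzero:
  fixes U :: "'u itself" and J :: "'j set"
  assumes K: "finitary U K" and J: "small U J" and X: "\<And>j. j \<in> J \<Longrightarrow> X j \<in> obj A"
    and P: "is_coproduct A J X P \<iota>" and y: "y \<in> Mor A K P"
    and zero: "\<And>j \<phi>. j \<in> J \<Longrightarrow> \<phi> \<in> Mor A K (X j) \<Longrightarrow> \<phi> = mzero A K (X j)"
  shows "y = mzero A K P"
proof -
  obtain F \<phi> where F: "finite F" "F \<subseteq> J" and \<phi>: "\<And>j. j \<in> F \<Longrightarrow> \<phi> j \<in> Mor A K (X j)"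
    and y_eq: "y = msum K P (\<lambda>j. \<iota> j \<cdot> \<phi> j) F"
    using finitaryE[OF K J X P y] by blast
  have "\<iota> j \<cdot> \<phi> j = mzero A K P" if "j \<in> F" for j
    by (rule cmp_eq_mzero[OF \<phi>[OF that] coproduct_Mor[OF P] zero]) (use F \<phi> that in auto)
  then show ?thesis unfolding y_eq by (rule msum_zero[OF Mor_obj[OF y]])
qed

lemma zero_objectI:
  assumes Z: "Z \<in> obj A" and "idn A Z = mzero A Z Z"
  shows "zero_object A Z"
  unfolding zero_object_def
proof (intro conjI ballI Z)
  fix X assume X: "X \<in> obj A"
  have "f = mzero A X Z" if "f \<in> Mor A X Z" for f
    using idn_cmp[OF that] mzero_cmp[OF that Z] assms by simp
  then show "\<exists>!f. f \<in> Mor A X Z" using mzero_Mor[OF X Z] by blast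
  have "f = mzero A Z X" if "f \<in> Mor A Z X" for f
    using cmp_idn[OF that] cmp_mzero[OF that Z] assms by simp
  then show "\<exists>!f. f \<in> Mor A Z X" using mzero_Mor[OF Z X] by blast
qed

end


section \<open>Triangulated categories\<close>

context triangulated_category
begin

section \<open>Calculus of the shift\<close>

lemma sh_obj_sh_obj: "X \<in> obj T \<Longrightarrow> sh_obj T p (sh_obj T q X) = sh_obj T (p + q) X"
  by (simp add: sh_obj_add)

lemma sh_mor_sh_mor: "f \<in> Mor T X Y \<Longrightarrow> sh_mor T p (sh_mor T q f) = sh_mor T (p + q) f"
  using sh_mor_add[OF Mor_arr] by simp

lemma sh_mor_inverse:
  "f \<in> Mor T X Y \<Longrightarrow> sh_mor T p (sh_mor T (- p) f) = f"
  "f \<in> Mor T X Y \<Longrightarrow> sh_mor T (- p) (sh_mor T p f) = f"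
  using sh_mor_sh_mor[of f X Y p "- p"] sh_mor_sh_mor[of f X Y "- p" p] sh_mor_0[OF Mor_arr, of f X Y]
  by simp_all

lemma sh_mor_inject:
  assumes "f \<in> Mor T X Y" "g \<in> Mor T X' Y'" "sh_mor T p f = sh_mor T p g"
  shows "f = g"
  using sh_mor_inverse(2)[OF assms(1), of p] sh_mor_inverse(2)[OF assms(2), of p] assms(3) by metis

lemma sh_mor_mzero:
  assumes "X \<in> obj T" "Y \<in> obj T"
  shows "sh_mor T p (mzero T X Y) = mzero T (sh_obj T p X) (sh_obj T p Y)"
proof -
  have z: "mzero T X Y \<in> Mor T X Y" using mzero_Mor assms .
  have "madd T (sh_mor T p (mzero T X Y)) (sh_mor T p (mzero T X Y)) = sh_mor T p (mzero T X Y)"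
    using sh_mor_madd[OF z z, of p] madd_mzero[OF z] by simp
  then show ?thesis using madd_cancel[OF sh_mor_Mor[OF z] sh_mor_Mor[OF z]] by blast
qed

lemma sh_mor_eq_mzero_iff:
  assumes f: "f \<in> Mor T X Y"
  shows "sh_mor T p f = mzero T (sh_obj T p X) (sh_obj T p Y) \<longleftrightarrow> f = mzero T X Y"
  using sh_mor_mzero[OF Mor_obj[OF f], of p] sh_mor_inject[OF f mzero_Mor[OF Mor_obj[OF f]], of p]
  by auto

lemma sh_mor_mneg:
  assumes f: "f \<in> Mor T X Y"
  shows "sh_mor T p (mneg T f) = mneg T (sh_mor T p f)"
proof (rule mneg_unique)
  show "madd T (sh_mor T p f) (sh_mor T p (mneg T f)) = mzero T (sh_obj T p X) (sh_obj T p Y)"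
    using sh_mor_madd[OF f mneg_Mor[OF f], of p] madd_mneg(1)[OF f] sh_mor_mzero[OF Mor_obj[OF f]]
    by simp
qed (use sh_mor_Mor mneg_Mor f in blast)+

lemma sh_mor_msum:
  assumes "finite F" "X \<in> obj T" "Y \<in> obj T" "\<And>i. i \<in> F \<Longrightarrow> \<phi> i \<in> Mor T X Y"
  shows "sh_mor T p (msum X Y \<phi> F) = msum (sh_obj T p X) (sh_obj T p Y) (\<lambda>i. sh_mor T p (\<phi> i)) F"
  using assms
proof (induction F)
  case empty
  then show ?case by (simp add: msum_empty sh_obj_closed sh_mor_mzero)
next
  case (insert i F)
  have s: "msum X Y \<phi> F \<in> Mor T X Y" "\<phi> i \<in> Mor T X Y"
    using msum_Mor[of X Y F \<phi>] insert.prems by auto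
  have "\<And>j. j \<in> insert i F \<Longrightarrow> sh_mor T p (\<phi> j) \<in> Mor T (sh_obj T p X) (sh_obj T p Y)"
    using insert.prems sh_mor_Mor by blast
  then show ?case
    using insert msum_insert[of F i \<phi> X Y] sh_mor_madd[OF s(2,1), of p]
      msum_insert[of F i "\<lambda>i. sh_mor T p (\<phi> i)" "sh_obj T p X" "sh_obj T p Y"] by auto
qed

text \<open>The adjunction between \<Sigma>^p and \<Sigma>^{-p}. As the shift is a strict
  automorphism, transposing a morphism is just shifting it by -p.\<close>

lemma sh_mor_transpose:
  "f \<in> Mor T (sh_obj T p X) Y \<Longrightarrow> X \<in> obj T \<Longrightarrow> sh_mor T (- p) f \<in> Mor T X (sh_obj T (- p) Y)"
  "f \<in> Mor T X (sh_obj T p Y) \<Longrightarrow> Y \<in> obj T \<Longrightarrow> sh_mor T (- p) f \<in> Mor T (sh_obj T (- p) X) Y"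
  using sh_mor_Mor[of f "sh_obj T p X" Y "- p"] sh_mor_Mor[of f X "sh_obj T p Y" "- p"]
    sh_obj_sh_obj[of X "- p" p] sh_obj_sh_obj[of Y "- p" p] sh_obj_0[of X] sh_obj_0[of Y]
  by simp_all

text \<open>Transposition matches families of maps out of the shifted summands with families out of
  the summands themselves, so the universal property is carried over.\<close>

lemma sh_coproduct:
  assumes P: "is_coproduct T I X P \<iota>" and X: "\<And>i. i \<in> I \<Longrightarrow> X i \<in> obj T"
  shows "is_coproduct T I (\<lambda>i. sh_obj T p (X i)) (sh_obj T p P) (\<lambda>i. sh_mor T p (\<iota> i))"
  unfolding is_coproduct_def
proof (intro conjI ballI allI impI)
  have P_obj: "P \<in> obj T" using P by (simp add: is_coproduct_def)
  then show "sh_obj T p P \<in> obj T" by (rule sh_obj_closed)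
  show "sh_mor T p (\<iota> i) \<in> Mor T (sh_obj T p (X i)) (sh_obj T p P)" if "i \<in> I" for i
    using sh_mor_Mor coproduct_Mor[OF P that] .
  fix Y f assume Y: "Y \<in> obj T" and f: "\<forall>i\<in>I. f i \<in> Mor T (sh_obj T p (X i)) Y"
  have f': "sh_mor T (- p) (f i) \<in> Mor T (X i) (sh_obj T (- p) Y)" if "i \<in> I" for i
    using sh_mor_transpose(1) f X that by blast
  obtain g where g: "g \<in> Mor T P (sh_obj T (- p) Y)"
    and g_\<iota>: "\<And>i. i \<in> I \<Longrightarrow> g \<cdot> \<iota> i = sh_mor T (- p) (f i)"
    using coproduct_ex[OF P sh_obj_closed[OF Y] f'] by blast
  show "\<exists>!g. g \<in> Mor T (sh_obj T p P) Y \<and> (\<forall>i\<in>I. g \<cdot> sh_mor T p (\<iota> i) = f i)"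
  proof (rule ex1I)
    have "sh_mor T p g \<in> Mor T (sh_obj T p P) Y"
      using sh_mor_transpose(2)[of g P "- p" Y] g Y by simp
    moreover have "sh_mor T p g \<cdot> sh_mor T p (\<iota> i) = f i" if "i \<in> I" for i
      using sh_mor_cmp[OF coproduct_Mor[OF P that] g, of p] g_\<iota>[OF that]
        sh_mor_inverse(1) f that by metis
    ultimately show "sh_mor T p g \<in> Mor T (sh_obj T p P) Y \<and>
      (\<forall>i\<in>I. sh_mor T p g \<cdot> sh_mor T p (\<iota> i) = f i)" by blast
    fix k assume k: "k \<in> Mor T (sh_obj T p P) Y \<and> (\<forall>i\<in>I. k \<cdot> sh_mor T p (\<iota> i) = f i)"
    have k': "sh_mor T (- p) k \<in> Mor T P (sh_obj T (- p) Y)"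
      using sh_mor_transpose(1) k P_obj by blast
    have "sh_mor T (- p) k = g"
    proof (rule coproduct_eq[OF P k' g])
      fix i assume i: "i \<in> I"
      have "sh_mor T (- p) (k \<cdot> sh_mor T p (\<iota> i)) = sh_mor T (- p) k \<cdot> \<iota> i"
        using sh_mor_cmp[OF sh_mor_Mor[OF coproduct_Mor[OF P i]]] k
          sh_mor_inverse(2)[OF coproduct_Mor[OF P i]] by metis
      then show "sh_mor T (- p) k \<cdot> \<iota> i = g \<cdot> \<iota> i" using k g_\<iota> i by simp
    qed
    then show "k = sh_mor T p g" using sh_mor_inverse(1) k by metis
  qed
qed

text \<open>A map \<Sigma>^p K -> P transposes to K -> \<Sigma>^{-p}P, whose target is again a
  coproduct. Its finite expansion is shifted back.\<close>

lemma finitary_shift: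
  fixes U :: "'u itself"
  assumes K: "finitary U K"
  shows "finitary U (sh_obj T p K)"
  unfolding finitary_def
proof (intro conjI allI impI)
  have K_obj: "K \<in> obj T" using K by (simp add: finitary_def)
  then show "sh_obj T p K \<in> obj T" by (rule sh_obj_closed)
  fix I :: "'u set" and X P \<iota> y
  assume I: "small U I" and X: "\<forall>i\<in>I. X i \<in> obj T" and P: "is_coproduct T I X P \<iota>"
    and y: "y \<in> Mor T (sh_obj T p K) P"
  let ?y = "sh_mor T (- p) y" and ?S = "sh_obj T (- p)"
  have P': "is_coproduct T I (\<lambda>i. ?S (X i)) (?S P) (\<lambda>i. sh_mor T (- p) (\<iota> i))"
    using sh_coproduct P X by blast
  have y': "?y \<in> Mor T K (?S P)" using sh_mor_transpose(1) y K_obj by blast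
  obtain F \<phi> where F: "finite F" "F \<subseteq> I" and \<phi>: "\<And>i. i \<in> F \<Longrightarrow> \<phi> i \<in> Mor T K (?S (X i))"
    and y_eq: "?y = msum K (?S P) (\<lambda>i. sh_mor T (- p) (\<iota> i) \<cdot> \<phi> i) F"
    using finitaryE[OF K I _ P' y'] sh_obj_closed X by blast
  have \<phi>': "sh_mor T p (\<phi> i) \<in> Mor T (sh_obj T p K) (X i)" if "i \<in> F" for i
    using sh_mor_transpose(2)[of "\<phi> i" K "- p"] \<phi> that X F by auto
  have \<iota>: "sh_mor T (- p) (\<iota> i) \<in> Mor T (?S (X i)) (?S P)" if "i \<in> F" for i
    using coproduct_Mor[OF P'] F that by blast
  have c: "sh_mor T p (sh_mor T (- p) (\<iota> i) \<cdot> \<phi> i) = \<iota> i \<cdot> sh_mor T p (\<phi> i)" if "i \<in> F" for i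
  proof -
    have "i \<in> I" using F that by blast
    then show ?thesis
      using sh_mor_cmp[OF \<phi> \<iota>, of i p, OF that that] sh_mor_inverse(1)[OF coproduct_Mor[OF P]] by simp
  qed
  have P_obj: "P \<in> obj T" using P by (simp add: is_coproduct_def)
  have PP: "sh_obj T p (?S P) = P" using sh_obj_sh_obj[OF P_obj, of p "- p"] sh_obj_0[OF P_obj] by simp
  have "y = sh_mor T p ?y" using sh_mor_inverse(1)[OF y] by simp
  also have "\<dots> = msum (sh_obj T p K) (sh_obj T p (?S P))
      (\<lambda>i. sh_mor T p (sh_mor T (- p) (\<iota> i) \<cdot> \<phi> i)) F"
    unfolding y_eq
    by (rule sh_mor_msum[OF F(1) K_obj sh_obj_closed[OF P_obj] cmp_Mor[OF \<phi> \<iota>]])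
  also have "\<dots> = msum (sh_obj T p K) P (\<lambda>i. \<iota> i \<cdot> sh_mor T p (\<phi> i)) F"
    unfolding PP
    by (rule msum_cong[OF sh_obj_closed[OF K_obj] P_obj])
      (use c cmp_Mor[OF \<phi>' coproduct_Mor[OF P]] F in auto)
  finally show "\<exists>F \<phi>. finite F \<and> F \<subseteq> I \<and> (\<forall>i\<in>F. \<phi> i \<in> Mor T (sh_obj T p K) (X i)) \<and>
      y = msum (sh_obj T p K) P (\<lambda>i. \<iota> i \<cdot> \<phi> i) F"
    using F \<phi>' by (intro exI[of _ F] exI[of _ "\<lambda>i. sh_mor T p (\<phi> i)"]) auto
qed

section \<open>Exact sequences of a triangle\<close>

lemma triangle_Mor:
  assumes "triangle T X Y Z f g h"
  shows "f \<in> Mor T X Y" "g \<in> Mor T Y Z" "h \<in> Mor T Z (sh_obj T 1 X)"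
  using assms by (simp_all add: triangle_def)

lemma triangle_obj:
  assumes "triangle T X Y Z f g h"
  shows "X \<in> obj T" "Y \<in> obj T" "Z \<in> obj T"
  using Mor_obj[OF triangle_Mor(1)[OF assms]] Mor_obj[OF triangle_Mor(2)[OF assms]] by blast+

lemma triangle_rotate:
  assumes "triangle T X Y Z f g h"
  shows "triangle T Y Z (sh_obj T 1 X) g h (mneg T (sh_mor T 1 f))"
  using TR2[OF triangle_Mor[OF assms]] assms by blast

text \<open>Mapping the triangle of the identity of X to the given one makes the composite factor
  through a zero object.\<close>

lemma triangle_cmp:
  assumes tri: "triangle T X Y Z f g h"
  shows "g \<cdot> f = mzero T X Z"
proof -
  obtain Z0 where Z0: "zero_object T Z0" using ex_zero_object by blast
  note Mor = triangle_Mor[OF tri] and obj = triangle_obj[OF tri]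
  have "f \<cdot> idn T X = f \<cdot> idn T X" ..
  then obtain w where w: "w \<in> Mor T Z0 Z" "w \<cdot> mzero T X Z0 = g \<cdot> f"
    using TR3[OF TR1_idn[OF obj(1) Z0] tri idn_Mor[OF obj(1)] Mor(1)] by blast
  then show ?thesis using cmp_mzero[OF w(1) obj(1)] by simp
qed

lemma triangle_cmp':
  assumes tri: "triangle T X Y Z f g h"
  shows "h \<cdot> g = mzero T Y (sh_obj T 1 X)"
  using triangle_cmp[OF triangle_rotate[OF tri]] .

text \<open>TR3 constructs only the third map of a morphism of triangles. Both the triangle of the
  identity of K and the given one are therefore rotated, which puts the shift of the required map in
  third place. The two rotations introduce the same sign, and it cancels.\<close>

lemma triangle_exact:
  assumes tri: "triangle T X Y Z f g h" and y: "y \<in> Mor T K Y" and 0: "g \<cdot> y = mzero T K Z"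
  obtains x where "x \<in> Mor T K X" "f \<cdot> x = y"
proof -
  obtain Z0 where Z0: "zero_object T Z0" using ex_zero_object by blast
  then have Z0_obj: "Z0 \<in> obj T" by (simp add: zero_object_def)
  note Mor = triangle_Mor[OF tri] and obj = triangle_obj[OF tri]
  have K: "K \<in> obj T" using Mor_obj y by blast
  have v: "mzero T Z0 Z \<in> Mor T Z0 Z" using mzero_Mor[OF Z0_obj obj(3)] .
  have eq: "mzero T Z0 Z \<cdot> mzero T K Z0 = g \<cdot> y"
    using 0 cmp_mzero[OF v K] by simp
  obtain w where w: "w \<in> Mor T (sh_obj T 1 K) (sh_obj T 1 X)"
    and eq: "sh_mor T 1 y \<cdot> mneg T (sh_mor T 1 (idn T K)) = mneg T (sh_mor T 1 f) \<cdot> w"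
    using TR3[OF triangle_rotate[OF TR1_idn[OF K Z0]] triangle_rotate[OF tri] y v eq] by blast
  have y1: "sh_mor T 1 y \<in> Mor T (sh_obj T 1 K) (sh_obj T 1 Y)" using sh_mor_Mor y .
  have f1: "sh_mor T 1 f \<in> Mor T (sh_obj T 1 X) (sh_obj T 1 Y)" using sh_mor_Mor Mor(1) .
  have "mneg T (sh_mor T 1 y) = mneg T (sh_mor T 1 f \<cdot> w)"
    using eq sh_mor_idn[OF K, of 1] cmp_mneg[OF idn_Mor[OF sh_obj_closed[OF K]] y1] cmp_idn[OF y1]
      mneg_cmp[OF w f1] by simp
  then have y_eq: "sh_mor T 1 y = sh_mor T 1 f \<cdot> w"
    using mneg_mneg[OF y1] mneg_mneg[OF cmp_Mor[OF w f1]] by metis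
  let ?x = "sh_mor T (- 1) w"
  have x: "?x \<in> Mor T K X"
    using sh_mor_transpose(2)[OF w obj(1)] sh_obj_sh_obj[OF K, of "- 1" 1] sh_obj_0[OF K] by simp
  have "sh_mor T 1 (f \<cdot> ?x) = sh_mor T 1 y"
    using sh_mor_cmp[OF x Mor(1), of 1] sh_mor_inverse(1)[OF w, of 1] y_eq by simp
  then have "f \<cdot> ?x = y" using sh_mor_inject[OF cmp_Mor[OF x Mor(1)] y] by blast
  then show thesis using that x by blast
qed

lemma triangle_exact':
  assumes tri: "triangle T X Y Z f g h" and z: "z \<in> Mor T K Z"
    and 0: "h \<cdot> z = mzero T K (sh_obj T 1 X)"
  obtains y where "y \<in> Mor T K Y" "g \<cdot> y = z"
  using triangle_exact[OF triangle_rotate[OF tri] z 0] that by blast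

text \<open>The rotated triangle contains -\<Sigma>f, and the sign does not change which maps are
  killed. The lift starts at \<Sigma>K because \<open>h\<close> ends in \<Sigma>X.\<close>

lemma triangle_exact_shift:
  assumes tri: "triangle T X Y Z f g h" and x: "x \<in> Mor T K X" and 0: "f \<cdot> x = mzero T K Y"
  obtains z where "z \<in> Mor T (sh_obj T 1 K) Z" "h \<cdot> z = sh_mor T 1 x"
proof -
  note Mor = triangle_Mor[OF tri]
  have x1: "sh_mor T 1 x \<in> Mor T (sh_obj T 1 K) (sh_obj T 1 X)" using sh_mor_Mor x .
  have "sh_mor T 1 f \<cdot> sh_mor T 1 x = mzero T (sh_obj T 1 K) (sh_obj T 1 Y)"
    using sh_mor_cmp[OF x Mor(1), of 1] sh_mor_mzero[OF Mor_obj(1)[OF x] Mor_obj(2)[OF Mor(1)]] 0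
    by simp
  then have "mneg T (sh_mor T 1 f) \<cdot> sh_mor T 1 x = mzero T (sh_obj T 1 K) (sh_obj T 1 Y)"
    using mneg_cmp[OF x1 sh_mor_Mor[OF Mor(1)]] mneg_mzero[OF sh_obj_closed sh_obj_closed]
      Mor_obj(1)[OF x] Mor_obj(2)[OF Mor(1)] by simp
  then show thesis using that triangle_exact'[OF triangle_rotate[OF tri] x1] by blast
qed

lemma triangle_cmp_shift:
  assumes tri: "triangle T X Y Z f g h"
  shows "sh_mor T 1 f \<cdot> h = mzero T Z (sh_obj T 1 Y)"
proof -
  note Mor = triangle_Mor[OF tri]
  have f1: "sh_mor T 1 f \<in> Mor T (sh_obj T 1 X) (sh_obj T 1 Y)" using sh_mor_Mor Mor(1) .
  have "mneg T (sh_mor T 1 f \<cdot> h) = mzero T Z (sh_obj T 1 Y)"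
    using triangle_cmp'[OF triangle_rotate[OF tri]] mneg_cmp[OF Mor(3) f1] by simp
  then show ?thesis using mneg_eq_mzero_iff[OF cmp_Mor[OF Mor(3) f1]] by simp
qed

text \<open>The given triangle is mapped to that of the identity of W, rotated backwards so that
  this identity is its second map. The third map supplied by TR3 is then the extension.\<close>

lemma triangle_coexact:
  assumes tri: "triangle T X Y Z f g h" and v: "v \<in> Mor T Y W" and 0: "v \<cdot> f = mzero T X W"
  obtains w where "w \<in> Mor T Z W" "w \<cdot> g = v"
proof -
  note Mor = triangle_Mor[OF tri] and obj = triangle_obj[OF tri]
  have W: "W \<in> obj T" using Mor_obj v by blast
  obtain Z0 where Z0: "zero_object T Z0" using ex_zero_object by blast
  then have Z0_obj: "Z0 \<in> obj T" by (simp add: zero_object_def)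
  \<comment> \<open>A zero object in first place: it is desuspended so that its shift is literally
    the third vertex of the identity triangle of W.\<close>
  let ?Z = "sh_obj T (- 1) Z0"
  have Z1: "?Z \<in> obj T" using sh_obj_closed[OF Z0_obj] .
  have ZZ: "sh_obj T 1 ?Z = Z0" using sh_obj_sh_obj[OF Z0_obj, of 1 "- 1"] sh_obj_0[OF Z0_obj] by simp
  have "mneg T (sh_mor T 1 (mzero T ?Z W)) = mzero T Z0 (sh_obj T 1 W)"
    using sh_mor_mzero[OF Z1 W, of 1] mneg_mzero[OF Z0_obj sh_obj_closed[OF W]] ZZ by simp
  then have "triangle T ?Z W W (mzero T ?Z W) (idn T W) (mzero T W Z0)"
    using TR2[of "mzero T ?Z W" ?Z W "idn T W" W "mzero T W Z0"] mzero_Mor idn_Mor Z1 W Z0_obj ZZ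
      TR1_idn[OF W Z0] by simp
  moreover have "v \<cdot> f = mzero T ?Z W \<cdot> mzero T X ?Z"
    using 0 cmp_mzero[OF mzero_Mor[OF Z1 W] obj(1)] by simp
  ultimately obtain w where w: "w \<in> Mor T Z W" "w \<cdot> g = idn T W \<cdot> v"
    using TR3[OF tri _ mzero_Mor[OF obj(1) Z1] v] by blast
  then show thesis using that idn_cmp[OF v] by simp
qed

lemma cocone:
  assumes g: "g \<in> Mor T X V"
  obtains U f h where "triangle T U X V f g h"
proof -
  obtain W a b where tri: "triangle T X V W g a b" using TR1_cone[OF g] by blast
  note Mor = triangle_Mor[OF tri] and obj = triangle_obj[OF tri]
  \<comment> \<open>The sign anticipates the one introduced by rotation, so that rotating this
    triangle gives the cone back.\<close>
  let ?U = "sh_obj T (- 1) W" and ?f = "mneg T (sh_mor T (- 1) b)"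
  have UW: "sh_obj T 1 ?U = W" using sh_obj_sh_obj[OF obj(3), of 1 "- 1"] sh_obj_0[OF obj(3)] by simp
  have b': "sh_mor T (- 1) b \<in> Mor T ?U X" using sh_mor_transpose(2)[OF Mor(3) obj(1)] .
  have "mneg T (sh_mor T 1 ?f) = b"
    using sh_mor_mneg[OF b', of 1] sh_mor_inverse(1)[OF Mor(3), of 1] mneg_mneg[OF Mor(3)] by simp
  then have "triangle T ?U X V ?f g a"
    using TR2[of ?f ?U X g V a] mneg_Mor[OF b'] g Mor(2) tri UW by simp
  then show thesis using that by blast
qed

end

section \<open>Sequential homotopy colimits\<close>

text \<open>\<open>has_small_coproducts\<close> offers only index sets in the universe type; this
  frees the index type.\<close>

lemma (in category) small_coproduct:
  fixes U :: "'u itself" and J :: "'j set"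
  assumes U: "has_small_coproducts U C" and J: "small U J" and X: "\<And>j. j \<in> J \<Longrightarrow> X j \<in> obj C"
  obtains P \<iota> where "is_coproduct C J X P \<iota>"
proof -
  obtain h :: "'j \<Rightarrow> 'u" where h: "inj_on h J"
    using lesspoll_imp_lepoll J unfolding small_def lepoll_def by blast
  define k where "k = inv_into J h"
  have kh: "k (h j) = j" if "j \<in> J" for j using h that by (simp add: k_def)
  have "h ` J \<approx> J" using h inj_on_image_eqpoll_self by blast
  then have I: "small U (h ` J)"
    using J unfolding small_def by (meson eqpoll_imp_lepoll lesspoll_trans1)
  have "\<forall>i\<in>h ` J. X (k i) \<in> obj C" using X kh by auto
  then obtain P \<iota> where P: "is_coproduct C (h ` J) (\<lambda>i. X (k i)) P \<iota>"
    using U[unfolded has_small_coproducts_def, rule_format, of "h ` J" "\<lambda>i. X (k i)"] I by blast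
  have "is_coproduct C J (\<lambda>j. X (k (h j))) P (\<lambda>j. \<iota> (h j))"
    by (rule coproduct_reindex[where k = h and h = k and J = "h ` J", OF _ P]) (use kh in \<open>auto simp: bij_betw_def inj_on_def image_image\<close>)
  then have "is_coproduct C J X P (\<lambda>j. \<iota> (h j))"
    using kh by (simp add: is_coproduct_def cong: ball_cong)
  then show thesis using that by blast
qed

context triangulated_category
begin

text \<open>The homotopy colimit of the sequence is the cone of \<open>1 - \<sigma>\<close> on the coproduct, where \<open>\<sigma>\<close> is
  the map induced by the transition maps.\<close>

lemma hocolim:
  fixes U :: "'u itself" and X :: "nat \<Rightarrow> 'o"
  assumes cop: "has_small_coproducts U T" and nat: "small U (UNIV :: nat set)"
    and s: "\<And>n. s n \<in> Mor T (X n) (X (Suc n))"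
  obtains V g where "\<And>n. g n \<in> Mor T (X n) V" "\<And>n. g (Suc n) \<cdot> s n = g n"
    "\<And>Y u. \<forall>n. u n \<in> Mor T (X n) Y \<Longrightarrow> \<forall>n. u (Suc n) \<cdot> s n = u n \<Longrightarrow>
      \<exists>w\<in>Mor T V Y. \<forall>n. w \<cdot> g n = u n"
    "\<And>K z. finitary U K \<Longrightarrow> z \<in> Mor T K V \<Longrightarrow> \<exists>n. \<exists>x\<in>Mor T K (X n). z = g n \<cdot> x"
    "\<And>K \<phi>. finitary U K \<Longrightarrow> \<forall>n. \<phi> n \<in> Mor T K (X n) \<Longrightarrow> \<forall>n. \<phi> (Suc n) = s n \<cdot> \<phi> n \<Longrightarrow>
      g 0 \<cdot> \<phi> 0 = mzero T K V \<Longrightarrow> \<exists>n. \<phi> n = mzero T K (X n)"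
proof -
  have X: "X n \<in> obj T" for n using Mor_obj(1)[OF s] .
  obtain P \<iota> where P: "is_coproduct T UNIV X P \<iota>"
    using small_coproduct[OF cop nat, of X] X by blast
  then have P_obj: "P \<in> obj T" by (simp add: is_coproduct_def)
  have \<iota>: "\<iota> n \<in> Mor T (X n) P" for n using coproduct_Mor[OF P] by blast
  obtain \<sigma> where \<sigma>: "\<sigma> \<in> Mor T P P" and \<sigma>\<iota>: "\<And>n. \<sigma> \<cdot> \<iota> n = \<iota> (Suc n) \<cdot> s n"
    using coproduct_ex[OF P P_obj, of "\<lambda>n. \<iota> (Suc n) \<cdot> s n"] cmp_Mor[OF s \<iota>] by auto
  define d where "d = madd T (idn T P) (mneg T \<sigma>)"
  have idP: "idn T P \<in> Mor T P P" using idn_Mor P_obj .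
  have d: "d \<in> Mor T P P" using madd_Mor[OF idP mneg_Mor[OF \<sigma>]] by (simp add: d_def)
  have dw: "d \<cdot> w = madd T w (mneg T (\<sigma> \<cdot> w))" if w: "w \<in> Mor T K P" for w K
    using cmp_madd_left[OF w idP mneg_Mor[OF \<sigma>]] idn_cmp[OF w] mneg_cmp[OF w \<sigma>] by (simp add: d_def)
  have wd: "w \<cdot> d = madd T w (mneg T (w \<cdot> \<sigma>))" if w: "w \<in> Mor T P Y" for w Y
    using cmp_madd_right[OF idP mneg_Mor[OF \<sigma>] w] cmp_idn[OF w] cmp_mneg[OF \<sigma> w] by (simp add: d_def)
  obtain V q h where tri: "triangle T P P V d q h" using TR1_cone[OF d] by blast
  note q = triangle_Mor(2)[OF tri] and h = triangle_Mor(3)[OF tri]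
  have V: "V \<in> obj T" using triangle_obj(3)[OF tri] .
  define g where "g n = q \<cdot> \<iota> n" for n
  have g: "g n \<in> Mor T (X n) V" for n using cmp_Mor[OF \<iota> q] by (simp add: g_def)
  have q\<sigma>: "q \<cdot> \<sigma> = q"
    using triangle_cmp[OF tri] wd[OF q] madd_mneg_eq_mzero_iff[OF q cmp_Mor[OF \<sigma> q]] by simp
  have gs: "g (Suc n) \<cdot> s n = g n" for n
  proof -
    have "g (Suc n) \<cdot> s n = q \<cdot> (\<sigma> \<cdot> \<iota> n)"
      using cmp_assoc[OF s \<iota> q] by (simp add: g_def \<sigma>\<iota>)
    also have "\<dots> = g n" using cmp_assoc[OF \<iota> \<sigma> q] by (simp add: g_def q\<sigma>)
    finally show ?thesis .
  qed
  have colim: "\<exists>w\<in>Mor T V Y. \<forall>n. w \<cdot> g n = u n"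
    if u': "\<forall>n. u n \<in> Mor T (X n) Y" and us': "\<forall>n. u (Suc n) \<cdot> s n = u n" for Y u
  proof -
    note u = u'[rule_format] and us = us'[rule_format]
    have Y: "Y \<in> obj T" using Mor_obj(2)[OF u] .
    obtain v where v: "v \<in> Mor T P Y" and v\<iota>: "\<And>n. v \<cdot> \<iota> n = u n"
      using coproduct_ex[OF P Y, of u] u by auto
    have "v \<cdot> \<sigma> = v"
    proof (rule coproduct_eq[OF P cmp_Mor[OF \<sigma> v] v])
      fix n
      have "(v \<cdot> \<sigma>) \<cdot> \<iota> n = (v \<cdot> \<iota> (Suc n)) \<cdot> s n"
        by (simp add: cmp_assoc[OF \<iota> \<sigma> v] \<sigma>\<iota> cmp_assoc[OF s \<iota> v])
      then show "(v \<cdot> \<sigma>) \<cdot> \<iota> n = v \<cdot> \<iota> n" by (simp add: v\<iota> us)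
    qed
    then have "v \<cdot> d = mzero T P Y" using wd[OF v] madd_mneg(1)[OF v] by simp
    then obtain w where w: "w \<in> Mor T V Y" "w \<cdot> q = v" using triangle_coexact[OF tri v] by blast
    have "w \<cdot> g n = u n" for n using cmp_assoc[OF \<iota> q w(1)] w(2) v\<iota> by (simp add: g_def)
    then show ?thesis using w(1) by blast
  qed
  have "\<exists>p. p \<in> Mor T P (X n) \<and> p \<cdot> \<iota> n = idn T (X n) \<and>
      (\<forall>m. m \<noteq> n \<longrightarrow> p \<cdot> \<iota> m = mzero T (X m) (X n))" for n
    by (rule coproduct_projection[OF P X, of n]) auto
  then obtain \<pi> where \<pi>: "\<And>n. \<pi> n \<in> Mor T P (X n)" and \<pi>\<iota>: "\<And>n. \<pi> n \<cdot> \<iota> n = idn T (X n)"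
    and \<pi>\<iota>0: "\<And>n m. m \<noteq> n \<Longrightarrow> \<pi> n \<cdot> \<iota> m = mzero T (X m) (X n)"
    by metis
  \<comment> \<open>\<sigma> moves each summand into the next one. On coordinates: nothing arrives
    in coordinate 0, and coordinate m + 1 of \<sigma> is \<open>s m\<close> after coordinate
    m.\<close>
  have \<pi>\<sigma>\<iota>: "(\<pi> m \<cdot> \<sigma>) \<cdot> \<iota> n = (\<pi> m \<cdot> \<iota> (Suc n)) \<cdot> s n" for m n
    by (simp add: cmp_assoc[OF \<iota> \<sigma> \<pi>] \<sigma>\<iota> cmp_assoc[OF s \<iota> \<pi>])
  have \<pi>\<sigma>_0: "\<pi> 0 \<cdot> \<sigma> = mzero T P (X 0)"
  proof (rule coproduct_eq[OF P cmp_Mor[OF \<sigma> \<pi>] mzero_Mor[OF P_obj X]])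
    fix n
    show "(\<pi> 0 \<cdot> \<sigma>) \<cdot> \<iota> n = mzero T P (X 0) \<cdot> \<iota> n"
      by (simp add: \<pi>\<sigma>\<iota> \<pi>\<iota>0 mzero_cmp[OF s X] mzero_cmp[OF \<iota> X])
  qed
  have \<pi>\<sigma>_Suc: "\<pi> (Suc m) \<cdot> \<sigma> = s m \<cdot> \<pi> m" for m
  proof (rule coproduct_eq[OF P cmp_Mor[OF \<sigma> \<pi>] cmp_Mor[OF \<pi> s]])
    fix n
    show "(\<pi> (Suc m) \<cdot> \<sigma>) \<cdot> \<iota> n = (s m \<cdot> \<pi> m) \<cdot> \<iota> n"
    proof (cases "n = m")
      case True
      then show ?thesis
        by (simp add: \<pi>\<sigma>\<iota> \<pi>\<iota> idn_cmp[OF s] cmp_assoc[OF \<iota> \<pi> s] cmp_idn[OF s])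
    next
      case False
      then show ?thesis
        by (simp add: \<pi>\<sigma>\<iota> \<pi>\<iota>0 mzero_cmp[OF s X] cmp_assoc[OF \<iota> \<pi> s] cmp_mzero[OF s X])
    qed
  qed
  \<comment> \<open>If w = \<sigma>w, all coordinates of w vanish by induction, starting with
    coordinate 0. Coordinates do not determine a general map into a coproduct; it is the finite
    expansion of w that makes them suffice.\<close>
  have inj: "w = mzero T K P" if K: "finitary U K" and w: "w \<in> Mor T K P" and 0: "d \<cdot> w = mzero T K P"
    for K w
  proof -
    have K_obj: "K \<in> obj T" using Mor_obj(1)[OF w] .
    have w\<sigma>: "w = \<sigma> \<cdot> w"
      using 0 dw[OF w] madd_mneg_eq_mzero_iff[OF w cmp_Mor[OF w \<sigma>]] by simp
    have \<pi>w: "\<pi> n \<cdot> w = mzero T K (X n)" for n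
    proof (induction n)
      case 0
      have "\<pi> 0 \<cdot> w = \<pi> 0 \<cdot> (\<sigma> \<cdot> w)" using w\<sigma> by simp
      also have "\<dots> = mzero T K (X 0)"
        using cmp_assoc[OF w \<sigma> \<pi>[of 0]] by (simp add: \<pi>\<sigma>_0 mzero_cmp[OF w X])
      finally show ?case .
    next
      case (Suc n)
      have "\<pi> (Suc n) \<cdot> w = \<pi> (Suc n) \<cdot> (\<sigma> \<cdot> w)" using w\<sigma> by simp
      also have "\<dots> = s n \<cdot> (\<pi> n \<cdot> w)"
        using cmp_assoc[OF w \<sigma> \<pi>[of "Suc n"]] by (simp add: \<pi>\<sigma>_Suc cmp_assoc[OF w \<pi> s])
      finally show ?case using Suc by (simp add: cmp_mzero[OF s K_obj])
    qed
    obtain F \<phi> where F: "finite F" "F \<subseteq> UNIV" and \<phi>: "\<And>i. i \<in> F \<Longrightarrow> \<phi> i \<in> Mor T K (X i)"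
      and w_eq: "w = msum K P (\<lambda>i. \<iota> i \<cdot> \<phi> i) F"
      by (rule finitaryE[OF K nat X P w]) (rule that)
    have "\<phi> j = mzero T K (X j)" if "j \<in> F" for j
      using coproduct_msum_projection[OF P X K_obj F \<phi> that \<pi> \<pi>\<iota> \<pi>\<iota>0] \<pi>w w_eq by simp
    then have "\<iota> j \<cdot> \<phi> j = mzero T K P" if "j \<in> F" for j
      using cmp_mzero[OF \<iota> K_obj] that by simp
    then show ?thesis unfolding w_eq by (rule msum_zero[OF K_obj P_obj])
  qed
  have later: "\<exists>x'\<in>Mor T K (X m). g n \<cdot> x = g m \<cdot> x'" if "n \<le> m" "x \<in> Mor T K (X n)" for n m K x
    using that(1)
  proof (induction rule: dec_induct)
    case base
    then show ?case using that(2) by blast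
  next
    case (step m)
    then obtain x' where x': "x' \<in> Mor T K (X m)" "g n \<cdot> x = g m \<cdot> x'" by blast
    have "g m \<cdot> x' = g (Suc m) \<cdot> (s m \<cdot> x')"
      using cmp_assoc[OF x'(1) s g] gs by simp
    then show ?case using x' cmp_Mor[OF x'(1) s] by auto
  qed
  \<comment> \<open>The connecting map sends z to a class killed by the shift of d. Injectivity of d
    on maps out of \<Sigma>^{-1}K, which is finitary as well, makes this class zero, so z lifts to
    P.\<close>
  have surj: "\<exists>n. \<exists>x\<in>Mor T K (X n). z = g n \<cdot> x" if K: "finitary U K" and z: "z \<in> Mor T K V" for K z
  proof -
    have K_obj: "K \<in> obj T" using Mor_obj(1)[OF z] .
    let ?y = "sh_mor T (- 1) (h \<cdot> z)"
    have hz: "h \<cdot> z \<in> Mor T K (sh_obj T 1 P)" using cmp_Mor[OF z h] .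
    have y: "?y \<in> Mor T (sh_obj T (- 1) K) P" using sh_mor_transpose(2)[OF hz P_obj] .
    have "sh_mor T 1 (d \<cdot> ?y) = sh_mor T 1 d \<cdot> (h \<cdot> z)"
      using sh_mor_cmp[OF y d, of 1] sh_mor_inverse(1)[OF hz, of 1] by simp
    also have "\<dots> = mzero T K (sh_obj T 1 P)"
      using cmp_assoc[OF z h sh_mor_Mor[OF d, of 1]] triangle_cmp_shift[OF tri]
        mzero_cmp[OF z sh_obj_closed[OF P_obj]] by simp
    finally have "sh_mor T 1 (d \<cdot> ?y) = mzero T (sh_obj T 1 (sh_obj T (- 1) K)) (sh_obj T 1 P)"
      using sh_obj_sh_obj[OF K_obj, of 1 "- 1"] sh_obj_0[OF K_obj] by simp
    then have "d \<cdot> ?y = mzero T (sh_obj T (- 1) K) P"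
      using sh_mor_eq_mzero_iff[OF cmp_Mor[OF y d], of 1] by simp
    then have "?y = mzero T (sh_obj T (- 1) K) P"
      using inj[OF finitary_shift[OF K] y] by simp
    then have "sh_mor T 1 ?y = mzero T K (sh_obj T 1 P)"
      using sh_mor_mzero[OF sh_obj_closed[OF K_obj] P_obj, of 1 "- 1"]
        sh_obj_sh_obj[OF K_obj, of 1 "- 1"] sh_obj_0[OF K_obj] by simp
    then have "h \<cdot> z = mzero T K (sh_obj T 1 P)" using sh_mor_inverse(1)[OF hz, of 1] by simp
    then obtain v where v: "v \<in> Mor T K P" "q \<cdot> v = z" using triangle_exact'[OF tri z] by blast
    obtain F \<phi> where F: "finite F" "F \<subseteq> UNIV" and \<phi>: "\<And>i. i \<in> F \<Longrightarrow> \<phi> i \<in> Mor T K (X i)"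
      and v_eq: "v = msum K P (\<lambda>i. \<iota> i \<cdot> \<phi> i) F"
      by (rule finitaryE[OF K nat X P v(1)]) (rule that)
    have q\<iota>\<phi>: "q \<cdot> (\<iota> i \<cdot> \<phi> i) = g i \<cdot> \<phi> i" if "i \<in> F" for i
      using cmp_assoc[OF \<phi>[OF that] \<iota> q] by (simp add: g_def)
    have "z = msum K V (\<lambda>i. q \<cdot> (\<iota> i \<cdot> \<phi> i)) F"
      using cmp_msum[OF F(1) K_obj q cmp_Mor[OF \<phi> \<iota>]] v v_eq by simp
    also have "\<dots> = msum K V (\<lambda>i. g i \<cdot> \<phi> i) F"
      by (rule msum_cong[OF K_obj V]) (use q\<iota>\<phi> cmp_Mor[OF \<phi> g] in auto)
    finally have z_eq: "z = msum K V (\<lambda>i. g i \<cdot> \<phi> i) F" .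
    \<comment> \<open>The finitely many terms live at different stages; they are pushed to a common
      one and added there.\<close>
    have "\<exists>n. \<exists>x\<in>Mor T K (X n). msum K V (\<lambda>i. g i \<cdot> \<phi> i) F = g n \<cdot> x"
      using F(1) \<phi>
    proof (induction F)
      case empty
      have "msum K V (\<lambda>i. g i \<cdot> \<phi> i) {} = g 0 \<cdot> mzero T K (X 0)"
        using msum_empty[OF K_obj V] cmp_mzero[OF g K_obj] by simp
      then show ?case using mzero_Mor[OF K_obj X] by blast
    next
      case (insert i F)
      obtain n x where x: "x \<in> Mor T K (X n)" "msum K V (\<lambda>i. g i \<cdot> \<phi> i) F = g n \<cdot> x"
        using insert by auto
      have \<phi>i: "\<phi> i \<in> Mor T K (X i)" using insert by simp
      obtain x1 where x1: "x1 \<in> Mor T K (X (max i n))" "g n \<cdot> x = g (max i n) \<cdot> x1"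
        using later[OF _ x(1), of "max i n"] by auto
      obtain x2 where x2: "x2 \<in> Mor T K (X (max i n))" "g i \<cdot> \<phi> i = g (max i n) \<cdot> x2"
        using later[OF _ \<phi>i, of "max i n"] by auto
      have "msum K V (\<lambda>i. g i \<cdot> \<phi> i) (insert i F) = madd T (g i \<cdot> \<phi> i) (g n \<cdot> x)"
        using msum_insert[OF insert(1,2), of "\<lambda>i. g i \<cdot> \<phi> i" K V] cmp_Mor[OF insert(4) g] x(2) by simp
      also have "\<dots> = g (max i n) \<cdot> madd T x2 x1"
        using cmp_madd_right[OF x2(1) x1(1) g] x1(2) x2(2) by simp
      finally show ?case using madd_Mor[OF x2(1) x1(1)] by blast
    qed
    then show ?thesis using z_eq by simp
  qed
  have eventually: "\<exists>n. \<phi> n = mzero T K (X n)"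
    if K: "finitary U K" and \<phi>': "\<forall>n. \<phi> n \<in> Mor T K (X n)"
      and \<phi>s': "\<forall>n. \<phi> (Suc n) = s n \<cdot> \<phi> n" and 0: "g 0 \<cdot> \<phi> 0 = mzero T K V" for K \<phi>
  proof -
    note \<phi> = \<phi>'[rule_format] and \<phi>s = \<phi>s'[rule_format]
    have K_obj: "K \<in> obj T" using Mor_obj(1)[OF \<phi>] .
    have \<iota>\<phi>: "\<iota> 0 \<cdot> \<phi> 0 \<in> Mor T K P" using cmp_Mor[OF \<phi> \<iota>] .
    have "q \<cdot> (\<iota> 0 \<cdot> \<phi> 0) = mzero T K V" using cmp_assoc[OF \<phi>[of 0] \<iota> q] 0 by (simp add: g_def)
    then obtain w where w: "w \<in> Mor T K P" and dw_eq: "d \<cdot> w = \<iota> 0 \<cdot> \<phi> 0"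
      using triangle_exact[OF tri \<iota>\<phi>] by blast
    have \<pi>d: "madd T (\<pi> n \<cdot> w) (mneg T ((\<pi> n \<cdot> \<sigma>) \<cdot> w)) = (\<pi> n \<cdot> \<iota> 0) \<cdot> \<phi> 0" for n
    proof -
      have "(\<pi> n \<cdot> \<iota> 0) \<cdot> \<phi> 0 = \<pi> n \<cdot> (d \<cdot> w)" using cmp_assoc[OF \<phi> \<iota> \<pi>] dw_eq by simp
      also have "\<dots> = madd T (\<pi> n \<cdot> w) (mneg T ((\<pi> n \<cdot> \<sigma>) \<cdot> w))"
        using dw[OF w] cmp_madd_right[OF w mneg_Mor[OF cmp_Mor[OF w \<sigma>]] \<pi>]
          cmp_mneg[OF cmp_Mor[OF w \<sigma>] \<pi>] cmp_assoc[OF w \<sigma> \<pi>] by simp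
      finally show ?thesis by simp
    qed
    \<comment> \<open>The equation (1 - \<sigma>)w = \<open>\<iota> 0 \<cdot> \<phi> 0\<close>, read
      in coordinates, is the recursion defining \<open>\<phi>\<close>. Since w has finite support,
      some \<open>\<phi> n\<close> must vanish.\<close>
    have \<pi>w: "\<pi> n \<cdot> w = \<phi> n" for n
    proof (induction n)
      case 0
      have "madd T (\<pi> 0 \<cdot> w) (mzero T K (X 0)) = \<phi> 0"
        using \<pi>d[of 0] by (simp add: \<pi>\<sigma>_0 mzero_cmp[OF w X] mneg_mzero[OF K_obj X] \<pi>\<iota> idn_cmp[OF \<phi>])
      then show ?case using madd_mzero(1)[OF cmp_Mor[OF w \<pi>]] by simp
    next
      case (Suc n)
      have "madd T (\<pi> (Suc n) \<cdot> w) (mneg T ((s n \<cdot> \<pi> n) \<cdot> w)) = mzero T K (X (Suc n))"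
        using \<pi>d[of "Suc n"] by (simp add: \<pi>\<sigma>_Suc \<pi>\<iota>0 mzero_cmp[OF \<phi> X])
      then have "\<pi> (Suc n) \<cdot> w = (s n \<cdot> \<pi> n) \<cdot> w"
        using madd_mneg_eq_mzero_iff[OF cmp_Mor[OF w \<pi>] cmp_Mor[OF w cmp_Mor[OF \<pi> s]]] by simp
      then show ?case using cmp_assoc[OF w \<pi> s] Suc \<phi>s by simp
    qed
    obtain F \<psi> where F: "finite F" "F \<subseteq> UNIV" and \<psi>: "\<And>i. i \<in> F \<Longrightarrow> \<psi> i \<in> Mor T K (X i)"
      and w_eq: "w = msum K P (\<lambda>i. \<iota> i \<cdot> \<psi> i) F"
      by (rule finitaryE[OF K nat X P w]) (rule that)
    obtain m where m: "m \<in> UNIV - F" using F(1) ex_new_if_finite[OF infinite_UNIV_nat] by auto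
    have "\<pi> m \<cdot> w = mzero T K (X m)"
      unfolding w_eq by (rule coproduct_msum_other[OF P X K_obj F \<psi> m \<pi> \<pi>\<iota>0])
    then show ?thesis using \<pi>w by auto
  qed
  show thesis using that[OF g gs colim surj eventually] .
qed

end


section \<open>Compact generation\<close>

locale compactly_generated = triangulated_category T
  for T :: "('o, 'm, 'z) triang_cat_scheme" (structure) +
  fixes U :: "'u itself" and S :: "'o set"
  assumes univ: "universe U"
    and coproducts: "has_small_coproducts U T"
    and S_obj: "S \<subseteq> obj T"
    and generates: "compactly_generates U T S"
begin

lemma small_nat: "small U (UNIV :: nat set)"
  using univ by (simp add: universe_def)

lemma finitary_generator: "L \<in> S \<Longrightarrow> finitary U (sh_obj T k L)"
  using generates compact_finitary[of U L] finitary_shift[of U L k]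
  unfolding compactly_generates_def by blast

lemma generator_obj: "L \<in> S \<Longrightarrow> sh_obj T k L \<in> obj T"
  using S_obj sh_obj_closed by blast

lemma generated_zero_object:
  assumes M: "M \<in> obj T"
    and 0: "\<And>k L x. L \<in> S \<Longrightarrow> x \<in> Mor T (sh_obj T k L) M \<Longrightarrow> x = mzero T (sh_obj T k L) M"
  shows "zero_object T M"
proof -
  have "Mor T (sh_obj T k L) M = {mzero T (sh_obj T k L) M}" if "L \<in> S" for k L
    using 0[OF that] mzero_Mor[OF generator_obj[OF that] M] by blast
  then show ?thesis using generates M unfolding compactly_generates_def by blast
qed

text \<open>The cone of f receives only zero maps from shifted generators and is therefore zero.
  Exactness then gives a right inverse r of f. It is also a left inverse, since f kills r f - 1,
  whose shift thus factors through the zero cone.\<close>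

lemma generated_isom:
  assumes f: "f \<in> Mor T X Y"
    and inj: "\<And>k L x. L \<in> S \<Longrightarrow> x \<in> Mor T (sh_obj T k L) X \<Longrightarrow> f \<cdot> x = mzero T (sh_obj T k L) Y \<Longrightarrow>
      x = mzero T (sh_obj T k L) X"
    and surj: "\<And>k L y. L \<in> S \<Longrightarrow> y \<in> Mor T (sh_obj T k L) Y \<Longrightarrow> \<exists>x\<in>Mor T (sh_obj T k L) X. f \<cdot> x = y"
  shows "is_isom T X Y f"
proof -
  obtain Z g h where tri: "triangle T X Y Z f g h" using TR1_cone[OF f] by blast
  note Mor = triangle_Mor[OF tri] and obj = triangle_obj[OF tri]
  have Z: "zero_object T Z"
  proof (rule generated_zero_object[OF obj(3)])
    fix k L z assume L: "L \<in> S" and z: "z \<in> Mor T (sh_obj T k L) Z"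
    let ?K = "sh_obj T k L"
    have K: "?K \<in> obj T" and L_obj: "L \<in> obj T" using L generator_obj S_obj by auto
    have hz: "h \<cdot> z \<in> Mor T ?K (sh_obj T 1 X)" using cmp_Mor[OF z Mor(3)] .
    \<comment> \<open>Undoing the shift lowers the degree of the generator from k to k - 1:
      injectivity in one degree allows the lift in the next.\<close>
    let ?x = "sh_mor T (- 1) (h \<cdot> z)"
    have K': "sh_obj T (- 1) ?K = sh_obj T (k - 1) L" using sh_obj_sh_obj[OF L_obj] by simp
    have x: "?x \<in> Mor T (sh_obj T (- 1) ?K) X" using sh_mor_transpose(2)[OF hz obj(1)] .
    have fx: "f \<cdot> ?x \<in> Mor T (sh_obj T (- 1) ?K) Y" using cmp_Mor[OF x f] .
    have KK: "sh_obj T 1 (sh_obj T (- 1) ?K) = ?K" using sh_obj_sh_obj[OF K] sh_obj_0[OF K] by simp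
    have "sh_mor T 1 (f \<cdot> ?x) = sh_mor T 1 f \<cdot> (h \<cdot> z)"
      using sh_mor_cmp[OF x f, of 1] sh_mor_inverse(1)[OF hz, of 1] by simp
    also have "\<dots> = mzero T ?K (sh_obj T 1 Y)"
      using cmp_assoc[OF z Mor(3) sh_mor_Mor[OF f, of 1]] triangle_cmp_shift[OF tri]
        mzero_cmp[OF z sh_obj_closed[OF obj(2)]] by simp
    finally have "f \<cdot> ?x = mzero T (sh_obj T (- 1) ?K) Y"
      using sh_mor_eq_mzero_iff[OF fx, of 1] KK by simp
    then have "?x = mzero T (sh_obj T (- 1) ?K) X"
      using inj[OF L, of ?x "k - 1"] x K' by simp
    then have "sh_mor T 1 ?x = mzero T ?K (sh_obj T 1 X)"
      using sh_mor_mzero[OF sh_obj_closed[OF K] obj(1), of 1 "- 1"] KK by simp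
    then have "h \<cdot> z = mzero T ?K (sh_obj T 1 X)"
      using sh_mor_inverse(1)[OF hz, of 1] by simp
    then obtain y where y: "y \<in> Mor T ?K Y" "g \<cdot> y = z" using triangle_exact'[OF tri z] by blast
    obtain x' where x': "x' \<in> Mor T ?K X" "f \<cdot> x' = y" using surj[OF L y(1)] by blast
    have "z = (g \<cdot> f) \<cdot> x'" using cmp_assoc[OF x'(1) f Mor(2)] x'(2) y(2) by simp
    then show "z = mzero T ?K Z" using triangle_cmp[OF tri] mzero_cmp[OF x'(1) obj(3)] by simp
  qed
  have "g \<cdot> idn T Y = mzero T Y Z"
    using zero_object_Mor(1)[OF Z cmp_Mor[OF idn_Mor[OF obj(2)] Mor(2)]] .
  then obtain r where r: "r \<in> Mor T Y X" "f \<cdot> r = idn T Y"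
    using triangle_exact[OF tri idn_Mor[OF obj(2)]] by blast
  have id: "idn T X \<in> Mor T X X" using idn_Mor[OF obj(1)] .
  have rf: "r \<cdot> f \<in> Mor T X X" using cmp_Mor[OF f r(1)] .
  let ?x = "madd T (r \<cdot> f) (mneg T (idn T X))"
  have x: "?x \<in> Mor T X X" using madd_Mor[OF rf mneg_Mor[OF id]] .
  have "f \<cdot> ?x = madd T (f \<cdot> (r \<cdot> f)) (mneg T f)"
    using cmp_madd_right[OF rf mneg_Mor[OF id] f] cmp_mneg[OF id f] cmp_idn[OF f] by simp
  also have "\<dots> = mzero T X Y"
    using cmp_assoc[OF f r(1) f] r(2) idn_cmp[OF f] madd_mneg(1)[OF f] by simp
  finally obtain z where z: "z \<in> Mor T (sh_obj T 1 X) Z" "h \<cdot> z = sh_mor T 1 ?x"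
    using triangle_exact_shift[OF tri x] by blast
  have "z = mzero T (sh_obj T 1 X) Z" using zero_object_Mor(1)[OF Z z(1)] .
  then have "sh_mor T 1 ?x = mzero T (sh_obj T 1 X) (sh_obj T 1 X)"
    using z cmp_mzero[OF Mor(3) sh_obj_closed[OF obj(1)]] by simp
  then have "?x = mzero T X X" using sh_mor_eq_mzero_iff[OF x] by simp
  then have "r \<cdot> f = idn T X" using madd_mneg_eq_mzero_iff[OF rf id] by simp
  then show ?thesis using f r unfolding is_isom_def by blast
qed

text \<open>The image of an idempotent \<open>e\<close> is the homotopy colimit of the constant sequence with
  transition maps \<open>e\<close>.\<close>

lemma idempotent_split:
  assumes e: "e \<in> Mor T L L" and ee: "e \<cdot> e = e"
  obtains Y p i where "p \<in> Mor T L Y" "i \<in> Mor T Y L" "p \<cdot> i = idn T Y" "i \<cdot> p = e"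
proof -
  have L: "L \<in> obj T" using Mor_obj(1)[OF e] .
  obtain Y g where g: "\<And>n::nat. g n \<in> Mor T L Y" and ge: "\<And>n. g (Suc n) \<cdot> e = g n"
    and colim: "\<And>W u. \<forall>n. u n \<in> Mor T L W \<Longrightarrow> \<forall>n. u (Suc n) \<cdot> e = u n \<Longrightarrow>
      \<exists>w\<in>Mor T Y W. \<forall>n. w \<cdot> g n = u n"
    and surj: "\<And>K z. finitary U K \<Longrightarrow> z \<in> Mor T K Y \<Longrightarrow> \<exists>n. \<exists>x\<in>Mor T K L. z = g n \<cdot> x"
    by (rule hocolim[where s = "\<lambda>_. e" and X = "\<lambda>_. L", OF coproducts small_nat e]) (rule that)
  have ge': "g n \<cdot> e = g n" for n
    using ge[of n] cmp_assoc[OF e e g, of "Suc n"] ee by simp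
  \<comment> \<open>From \<open>g (Suc n) \<cdot> e = g n\<close> and idempotence every
    \<open>g n\<close> absorbs e, so all of them coincide.\<close>
  have g0: "g n = g 0" for n
    by (induction n) (use ge ge' in auto)
  obtain r where r: "r \<in> Mor T Y L" and rg: "\<And>n. r \<cdot> g n = e"
    using colim[of "\<lambda>_. e" L] e ee by auto
  \<comment> \<open>The weak universal property does not force this endomorphism to be the identity.
    It does fix every map out of a generator, hence is an isomorphism, and its inverse
    \<open>\<psi>\<close> corrects r to \<open>r \<cdot> \<psi>\<close>.\<close>
  let ?\<phi> = "g 0 \<cdot> r"
  have \<phi>: "?\<phi> \<in> Mor T Y Y" using cmp_Mor[OF r g] .
  have \<phi>z: "?\<phi> \<cdot> z = z" if K: "finitary U K" and z: "z \<in> Mor T K Y" for K z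
  proof -
    obtain n x where x: "x \<in> Mor T K L" "z = g n \<cdot> x" using surj[OF K z] by blast
    then have "?\<phi> \<cdot> z = g 0 \<cdot> (r \<cdot> (g 0 \<cdot> x))" using cmp_assoc[OF z r g] g0[of n] by simp
    also have "\<dots> = g 0 \<cdot> (e \<cdot> x)" using cmp_assoc[OF x(1) g r] rg by simp
    also have "\<dots> = z" using cmp_assoc[OF x(1) e g] ge' g0[of n] x(2) by simp
    finally show ?thesis .
  qed
  have "is_isom T Y Y ?\<phi>"
    by (rule generated_isom[OF \<phi>]) (use \<phi>z[OF finitary_generator] in auto)
  then obtain \<psi> where \<psi>: "\<psi> \<in> Mor T Y Y" "\<psi> \<cdot> ?\<phi> = idn T Y" "?\<phi> \<cdot> \<psi> = idn T Y"
    by (auto simp: is_isom_def)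
  have "?\<phi> \<cdot> g 0 = g 0" using cmp_assoc[OF g r g] rg ge' by simp
  then have \<psi>g: "\<psi> \<cdot> g 0 = g 0"
    using cmp_assoc[OF g[of 0] \<phi> \<psi>(1)] \<psi>(2) idn_cmp[OF g[of 0]] by simp
  have "(r \<cdot> \<psi>) \<cdot> g 0 = e" using cmp_assoc[OF g[of 0] \<psi>(1) r] \<psi>g rg by simp
  moreover have "g 0 \<cdot> (r \<cdot> \<psi>) = idn T Y" using cmp_assoc[OF \<psi>(1) r g] \<psi>(3) by simp
  ultimately show thesis using that g cmp_Mor[OF \<psi>(1) r] by blast
qed

text \<open>A summand needs a complement: it is the image of the complementary idempotent 1 - ip,
  which splits as well.\<close>

lemma idempotent_direct_summand:
  assumes p: "p \<in> Mor T L Y" and i: "i \<in> Mor T Y L" and pi: "p \<cdot> i = idn T Y"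
  shows "direct_summand T Y L"
proof -
  let ?e = "i \<cdot> p"
  have L: "L \<in> obj T" using Mor_obj(1)[OF p] .
  have id: "idn T L \<in> Mor T L L" using idn_Mor[OF L] .
  have e: "?e \<in> Mor T L L" using cmp_Mor[OF p i] .
  have pe: "p \<cdot> ?e = p" using cmp_assoc[OF p i p] pi idn_cmp[OF p] by simp
  have ei: "?e \<cdot> i = i" using cmp_assoc[OF i p i] pi cmp_idn[OF i] by simp
  have ee: "?e \<cdot> ?e = ?e" using cmp_assoc[OF p i e] ei by simp
  let ?e' = "madd T (idn T L) (mneg T ?e)"
  have e': "?e' \<in> Mor T L L" using madd_Mor[OF id mneg_Mor[OF e]] .
  have ee': "?e \<cdot> ?e' = mzero T L L"
    using cmp_madd_right[OF id mneg_Mor[OF e] e] cmp_mneg[OF e e] cmp_idn[OF e] ee madd_mneg(1)[OF e]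
    by simp
  have e'e: "?e' \<cdot> ?e = mzero T L L"
    using cmp_madd_left[OF e id mneg_Mor[OF e]] mneg_cmp[OF e e] idn_cmp[OF e] ee madd_mneg(1)[OF e]
    by simp
  have "?e' \<cdot> ?e' = madd T ?e' (mneg T (?e \<cdot> ?e'))"
    using cmp_madd_left[OF e' id mneg_Mor[OF e]] mneg_cmp[OF e' e] idn_cmp[OF e'] by simp
  then have e'e': "?e' \<cdot> ?e' = ?e'" using ee' mneg_mzero[OF L L] madd_mzero(1)[OF e'] by simp
  obtain Z q j where q: "q \<in> Mor T L Z" and j: "j \<in> Mor T Z L" and qj: "q \<cdot> j = idn T Z"
    and jq: "j \<cdot> q = ?e'"
    using idempotent_split[OF e' e'e'] by blast
  have qe': "q \<cdot> ?e' = q" using cmp_assoc[OF q j q] jq qj idn_cmp[OF q] by simp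
  have e'j: "?e' \<cdot> j = j" using cmp_assoc[OF j q j] jq qj cmp_idn[OF j] by simp
  \<comment> \<open>Inserting the two orthogonal idempotents between p and j makes the composite
    vanish.\<close>
  have "p \<cdot> j = (p \<cdot> ?e) \<cdot> (?e' \<cdot> j)" using pe e'j by simp
  also have "\<dots> = p \<cdot> ((?e \<cdot> ?e') \<cdot> j)"
    using cmp_assoc[OF cmp_Mor[OF j e'] e p] cmp_assoc[OF j e' e] by simp
  also have "\<dots> = mzero T Z Y" using ee' mzero_cmp[OF j L] cmp_mzero[OF p Mor_obj(1)[OF j]] by simp
  finally have pj: "p \<cdot> j = mzero T Z Y" .
  have "q \<cdot> i = (q \<cdot> ?e') \<cdot> (?e \<cdot> i)" using qe' ei by simp
  also have "\<dots> = q \<cdot> ((?e' \<cdot> ?e) \<cdot> i)"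
    using cmp_assoc[OF cmp_Mor[OF i e] e' q] cmp_assoc[OF i e e'] by simp
  also have "\<dots> = mzero T Y Z" using e'e mzero_cmp[OF i L] cmp_mzero[OF q Mor_obj(1)[OF i]] by simp
  finally have qi: "q \<cdot> i = mzero T Y Z" .
  have "madd T ?e ?e' = madd T (madd T ?e (mneg T ?e)) (idn T L)"
    using madd_commute[OF id mneg_Mor[OF e]] madd_assoc[OF e mneg_Mor[OF e] id] by simp
  then have "madd T ?e (j \<cdot> q) = idn T L" using madd_mneg(1)[OF e] madd_mzero(2)[OF id] jq by simp
  then have "is_biproduct T Y Z L i j p q"
    using p i q j pi qj pj qi by (simp add: is_biproduct_def)
  then show ?thesis using Mor_obj(1)[OF j] unfolding direct_summand_def by blast
qed

end

section \<open>Small sets\<close>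

lemma small_lepoll: "small U B \<Longrightarrow> A \<lesssim> B \<Longrightarrow> small U A"
  unfolding small_def by (rule lesspoll_trans1)

text \<open>\<open>universe\<close> covers only families of subsets of \<open>'u\<close> indexed by
  subsets of \<open>'u\<close>. An element of a general union is coded by the pair of an index and
  its place in that member, and pairs embed into \<open>'u\<close> because \<open>'u\<close> is
  infinite.\<close>

lemma small_UN:
  fixes U :: "'u itself" and I :: "'i set" and A :: "'i \<Rightarrow> 'a set"
  assumes U: "universe U" and I: "small U I" and A: "\<And>i. i \<in> I \<Longrightarrow> small U (A i)"
  shows "small U (\<Union>i\<in>I. A i)"
proof -
  have "(UNIV :: nat set) \<lesssim> (UNIV :: 'u set)"
    using U lesspoll_imp_lepoll unfolding universe_def small_def by blast
  then have "infinite (UNIV :: 'u set)" by (simp add: infinite_le_lepoll)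
  then have "|(UNIV :: 'u set) \<times> (UNIV :: 'u set)| =o |UNIV :: 'u set|"
    by (rule card_of_Times_same_infinite)
  then obtain c :: "'u \<times> 'u \<Rightarrow> 'u" where "bij_betw c (UNIV \<times> UNIV) UNIV"
    using card_of_ordIso by blast
  then have c: "inj c" by (simp add: bij_betw_def)
  obtain h :: "'i \<Rightarrow> 'u" where h: "inj_on h I"
    using lesspoll_imp_lepoll I unfolding small_def lepoll_def by blast
  have "\<exists>g :: 'a \<Rightarrow> 'u. inj_on g (A i)" if "i \<in> I" for i
    using lesspoll_imp_lepoll A[OF that] unfolding small_def lepoll_def by blast
  then obtain g :: "'i \<Rightarrow> 'a \<Rightarrow> 'u" where g: "\<And>i. i \<in> I \<Longrightarrow> inj_on (g i) (A i)"
    by metis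
  define k where "k = inv_into I h"
  have kh: "k (h i) = i" if "i \<in> I" for i using h that by (simp add: k_def)
  define B where "B u = (\<lambda>x. c (u, g (k u) x)) ` A (k u)" for u
  have "small U (B u)" if "u \<in> h ` I" for u
    using small_lepoll[OF A image_lepoll] that kh unfolding B_def by force
  moreover have "small U (h ` I)" using small_lepoll[OF I image_lepoll] .
  ultimately have "small U (\<Union>u\<in>h ` I. B u)" using U unfolding universe_def by blast
  moreover have "(\<Union>i\<in>I. A i) \<lesssim> (\<Union>u\<in>h ` I. B u)"
  proof -
    \<comment> \<open>An element may belong to several members; one index is fixed for each so that
      its code is well defined.\<close>
    have "\<forall>x\<in>\<Union>i\<in>I. A i. \<exists>i. i \<in> I \<and> x \<in> A i" by blast
    then obtain j where j: "\<And>x. x \<in> (\<Union>i\<in>I. A i) \<Longrightarrow> j x \<in> I \<and> x \<in> A (j x)"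
      by metis
    define f where "f x = c (h (j x), g (j x) x)" for x
    have "inj_on f (\<Union>i\<in>I. A i)"
    proof (rule inj_onI)
      fix x y assume x: "x \<in> (\<Union>i\<in>I. A i)" and y: "y \<in> (\<Union>i\<in>I. A i)" and eq: "f x = f y"
      have e: "h (j x) = h (j y)" "g (j x) x = g (j y) y"
        using eq c unfolding f_def by (auto dest: injD)
      have jj: "j x = j y" using e(1) h j[OF x] j[OF y] by (auto dest: inj_onD)
      show "x = y" using inj_onD[OF g[of "j y"], of x y] e(2) j[OF x] j[OF y] jj by simp
    qed
    moreover have "f ` (\<Union>i\<in>I. A i) \<subseteq> (\<Union>u\<in>h ` I. B u)"
    proof
      fix y assume "y \<in> f ` (\<Union>i\<in>I. A i)"
      then obtain x where x: "x \<in> (\<Union>i\<in>I. A i)" "y = f x" by blast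
      then have "y \<in> B (h (j x))" using j[OF x(1)] kh[of "j x"] by (simp add: B_def f_def)
      then show "y \<in> (\<Union>u\<in>h ` I. B u)" using j[OF x(1)] by blast
    qed
    ultimately show ?thesis unfolding lepoll_def by blast
  qed
  ultimately show ?thesis by (rule small_lepoll)
qed


section \<open>Semi-simplicity\<close>

locale semisimple_generated = compactly_generated T U S
  for T :: "('o, 'm, 'z) triang_cat_scheme" (structure) and U :: "'u itself" and S :: "'o set" +
  assumes homs_small: "locally_small U T"
    and ess_small: "essentially_small U T S"
    and summands: "stable_under_summands T S"
    and negative: "\<And>L M p. L \<in> S \<Longrightarrow> M \<in> S \<Longrightarrow> p < 0 \<Longrightarrow>
      Mor T L (sh_obj T p M) = {mzero T L (sh_obj T p M)}"
    and semisimple: "semisimple_Mod U TYPE('m) T S"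
begin

section \<open>Subfunctors of Hom(-, Y), expressed by morphisms\<close>

text \<open>The same notion as \<open>is_subfunctor\<close> for \<open>H_obj T 0 Y\<close>, freed
  from the records, from HOL-Algebra subgroups and from \<Sigma>^0.\<close>

definition hom_subfunctor :: "'o \<Rightarrow> ('o \<Rightarrow> 'm set) \<Rightarrow> bool"
  where "hom_subfunctor Y N \<longleftrightarrow>
    (\<forall>L\<in>S. N L \<subseteq> Mor T L Y \<and> mzero T L Y \<in> N L \<and>
      (\<forall>x\<in>N L. mneg T x \<in> N L \<and> (\<forall>y\<in>N L. madd T x y \<in> N L))) \<and>
    (\<forall>L\<in>S. \<forall>L'\<in>S. \<forall>f\<in>Mor T L L'. \<forall>x\<in>N L'. x \<cdot> f \<in> N L)"

lemma is_subfunctor_iff: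
  assumes Y: "Y \<in> obj T"
  shows "is_subfunctor T S (H_obj T 0 Y) N \<longleftrightarrow> hom_subfunctor Y N"
proof -
  have "subgroup (N L) (mor_group T L Y) \<longleftrightarrow> N L \<subseteq> Mor T L Y \<and> mzero T L Y \<in> N L \<and>
      (\<forall>x\<in>N L. mneg T x \<in> N L \<and> (\<forall>y\<in>N L. madd T x y \<in> N L))" if L: "L \<in> S" for L
  proof -
    have inv: "inv\<^bsub>mor_group T L Y\<^esub> x = mneg T x" if "x \<in> Mor T L Y" for x
      using that by (simp add: mneg_def Mor_def)
    show ?thesis unfolding subgroup_def by (auto simp: inv subset_iff)
  qed
  then show ?thesis
    using Y by (simp add: is_subfunctor_def hom_subfunctor_def H_obj_def sh_obj_0)
qed

definition simple_hom_subfunctor :: "'o \<Rightarrow> ('o \<Rightarrow> 'm set) \<Rightarrow> bool"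
  where "simple_hom_subfunctor Y N \<longleftrightarrow> hom_subfunctor Y N \<and>
    (\<exists>L\<in>S. \<exists>x\<in>N L. x \<noteq> mzero T L Y) \<and>
    (\<forall>N'. hom_subfunctor Y N' \<longrightarrow> (\<forall>L\<in>S. N' L \<subseteq> N L) \<longrightarrow>
       (\<forall>L\<in>S. \<forall>x\<in>N' L. x = mzero T L Y) \<or> (\<forall>L\<in>S. N' L = N L))"

text \<open>A subfunctor of Hom(-, Y) contained in N is a subfunctor of N, so simplicity of N,
  stated intrinsically, applies to it.\<close>

lemma simple_smodule_imp:
  assumes Y: "Y \<in> obj T" and N: "is_subfunctor T S (H_obj T 0 Y) N"
    and simple: "simple_smodule T S (subfunctor (H_obj T 0 Y) N)"
  shows "simple_hom_subfunctor Y N"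
  unfolding simple_hom_subfunctor_def
proof (intro conjI allI impI)
  let ?M = "H_obj T 0 Y"
  show hN: "hom_subfunctor Y N" using N is_subfunctor_iff[OF Y] by blast
  have zero: "smodule_zero S (subfunctor ?M N') \<longleftrightarrow> (\<forall>L\<in>S. \<forall>x\<in>N' L. x = mzero T L Y)"
    if "hom_subfunctor Y N'" for N'
    using that Y by (auto simp: smodule_zero_def subfunctor_def H_obj_def sh_obj_0 hom_subfunctor_def)
  show "\<exists>L\<in>S. \<exists>x\<in>N L. x \<noteq> mzero T L Y"
    using simple zero[OF hN] by (auto simp: simple_smodule_def)
  fix N' assume N': "hom_subfunctor Y N'" and sub: "\<forall>L\<in>S. N' L \<subseteq> N L"
  have "is_subfunctor T S (subfunctor ?M N) N'"
    unfolding is_subfunctor_def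
  proof (intro conjI ballI)
    fix L assume L: "L \<in> S"
    have "group (val ?M L)"
      using mor_comm_group[of L Y] L S_obj Y by (auto simp: H_obj_def sh_obj_0 comm_group_def)
    then show "subgroup (N' L) (val (subfunctor ?M N) L)"
      using group.subgroup_incl[of "val ?M L" "N' L" "N L"] N N' is_subfunctor_iff[OF Y] sub L
      by (auto simp: subfunctor_def is_subfunctor_def)
  qed (use N' in \<open>auto simp: subfunctor_def H_obj_def hom_subfunctor_def\<close>)
  then have "smodule_zero S (subfunctor (subfunctor ?M N) N') \<or> (\<forall>L\<in>S. N' L = N L)"
    using simple by (simp add: simple_smodule_def subfunctor_def)
  moreover have "subfunctor (subfunctor ?M N) N' = subfunctor ?M N'" by (simp add: subfunctor_def)
  ultimately show "(\<forall>L\<in>S. \<forall>x\<in>N' L. x = mzero T L Y) \<or> (\<forall>L\<in>S. N' L = N L)"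
    using zero[OF N'] by simp
qed

text \<open>The isomorphism from \<open>sum_group\<close> is separated into its two halves:
  surjectivity becomes finite expansions, injectivity becomes independence of finite
  families.\<close>

lemma semisimple_decomposition:
  assumes Y: "Y \<in> obj T"
  obtains J where "\<And>N. N \<in> J \<Longrightarrow> simple_hom_subfunctor Y N"
    "\<And>L x. L \<in> S \<Longrightarrow> x \<in> Mor T L Y \<Longrightarrow>
      \<exists>F \<phi>. finite F \<and> F \<subseteq> J \<and> (\<forall>N\<in>F. \<phi> N \<in> N L) \<and> x = msum L Y \<phi> F"
    "\<And>L F \<phi>. L \<in> S \<Longrightarrow> finite F \<Longrightarrow> F \<subseteq> J \<Longrightarrow> \<forall>N\<in>F. \<phi> N \<in> N L \<Longrightarrow>
      msum L Y \<phi> F = mzero T L Y \<Longrightarrow> \<forall>N\<in>F. \<phi> N = mzero T L Y"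
proof -
  let ?M = "H_obj T 0 Y"
  have "semisimple_smodule T S ?M"
    using semisimple H_obj_is_smodule[OF homs_small S_obj Y] unfolding semisimple_Mod_def by blast
  then obtain J where J: "\<And>N. N \<in> J \<Longrightarrow> is_subfunctor T S ?M N \<and> simple_smodule T S (subfunctor ?M N)"
    and iso: "\<And>L. L \<in> S \<Longrightarrow> (\<lambda>x. gfinprod (val ?M L) x J)
          \<in> iso (sum_group J (\<lambda>N. val (subfunctor ?M N) L)) (val ?M L)"
    unfolding semisimple_smodule_def by blast
  have val: "val ?M L = mor_group T L Y" for L using Y by (simp add: H_obj_def sh_obj_0)
  have simple: "simple_hom_subfunctor Y N" if "N \<in> J" for N
    using simple_smodule_imp[OF Y] J[OF that] by blast
  have car: "carrier (sum_group J (\<lambda>N. val (subfunctor ?M N) L)) =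
      {\<psi> \<in> \<Pi>\<^sub>E N\<in>J. N L. finite {N \<in> J. \<psi> N \<noteq> mzero T L Y}}" if L: "L \<in> S" for L
  proof -
    have G: "group (mor_group T L Y)" using mor_comm_group[of L Y] L S_obj Y by (auto simp: comm_group_def)
    have "group (val (subfunctor ?M N) L)" if "N \<in> J" for N
      using group.subgroup_imp_group[OF G, of "N L"] J[OF that] L
      by (simp add: subfunctor_def is_subfunctor_def val)
    then have "carrier (sum_group J (\<lambda>N. val (subfunctor ?M N) L)) =
      {\<psi> \<in> \<Pi>\<^sub>E N\<in>J. carrier (val (subfunctor ?M N) L).
        finite {N \<in> J. \<psi> N \<noteq> \<one>\<^bsub>val (subfunctor ?M N) L\<^esub>}}"
      by (rule carrier_sum_group)
    then show ?thesis by (simp add: subfunctor_def val)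
  qed
  have surj: "\<exists>F \<phi>. finite F \<and> F \<subseteq> J \<and> (\<forall>N\<in>F. \<phi> N \<in> N L) \<and> x = msum L Y \<phi> F"
    if L: "L \<in> S" and x: "x \<in> Mor T L Y" for L x
  proof -
    have "x \<in> (\<lambda>\<psi>. gfinprod (mor_group T L Y) \<psi> J) ` carrier (sum_group J (\<lambda>N. val (subfunctor ?M N) L))"
      using iso[OF L] x by (simp add: iso_def bij_betw_def val)
    then obtain \<psi> where "\<psi> \<in> (\<Pi>\<^sub>E N\<in>J. N L)" "finite {N \<in> J. \<psi> N \<noteq> mzero T L Y}"
      "x = gfinprod (mor_group T L Y) \<psi> J"
      unfolding car[OF L] by blast
    then show ?thesis
      by (intro exI[of _ "{N \<in> J. \<psi> N \<noteq> mzero T L Y}"] exI[of _ \<psi>]) (auto simp: gfinprod_def)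
  qed
  have inj: "\<forall>N\<in>F. \<phi> N = mzero T L Y"
    if L: "L \<in> S" and F: "finite F" "F \<subseteq> J" and \<phi>: "\<forall>N\<in>F. \<phi> N \<in> N L"
      and 0: "msum L Y \<phi> F = mzero T L Y" for L F \<phi>
  proof -
    have NL: "N L \<subseteq> Mor T L Y" "mzero T L Y \<in> N L" if "N \<in> J" for N
      using simple[OF that] L by (auto simp: simple_hom_subfunctor_def hom_subfunctor_def)
    interpret G: comm_group "mor_group T L Y" using mor_comm_group L S_obj Y by blast
    \<comment> \<open>Elements of \<open>sum_group\<close> are functions extensional on
      \<open>J\<close>. The finite family is extended by zero within \<open>J\<close> before
      injectivity compares it with the zero family.\<close>
    define \<psi> where "\<psi> = (\<lambda>N\<in>J. if N \<in> F then \<phi> N else mzero T L Y)"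
    define \<psi>0 where "\<psi>0 = (\<lambda>N\<in>J. mzero T L Y)"
    have supp: "{N \<in> J. \<psi> N \<noteq> mzero T L Y} \<subseteq> F" by (auto simp: \<psi>_def)
    then have fin: "finite {N \<in> J. \<psi> N \<noteq> mzero T L Y}" using F finite_subset by blast
    have \<psi>: "\<psi> \<in> carrier (sum_group J (\<lambda>N. val (subfunctor ?M N) L))"
      unfolding car[OF L] using fin \<phi> NL F by (auto simp: \<psi>_def)
    have \<psi>0: "\<psi>0 \<in> carrier (sum_group J (\<lambda>N. val (subfunctor ?M N) L))"
      unfolding car[OF L] using NL by (auto simp: \<psi>0_def)
    have "gfinprod (mor_group T L Y) \<psi> J = msum L Y \<psi> {N \<in> J. \<psi> N \<noteq> mzero T L Y}"
      using fin by (simp add: gfinprod_def)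
    also have "\<dots> = msum L Y \<phi> F"
      by (rule G.finprod_mono_neutral_cong_left[OF F(1) supp]) (use F \<phi> NL in \<open>auto simp: \<psi>_def\<close>)
    also have "\<dots> = gfinprod (mor_group T L Y) \<psi>0 J"
      using 0 by (simp add: gfinprod_def \<psi>0_def cong: conj_cong)
    finally have "\<psi> = \<psi>0"
      using iso[OF L] \<psi> \<psi>0 by (auto simp: iso_def bij_betw_def val dest: inj_onD)
    show ?thesis
    proof
      fix N assume "N \<in> F"
      then show "\<phi> N = mzero T L Y"
        using fun_cong[OF \<open>\<psi> = \<psi>0\<close>, of N] F by (auto simp: \<psi>_def \<psi>0_def)
    qed
  qed
  show thesis using that[OF simple surj inj] .
qed

lemma hom_subfunctorD:
  assumes "hom_subfunctor Y N" "L \<in> S"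
  shows "x \<in> N L \<Longrightarrow> x \<in> Mor T L Y" "mzero T L Y \<in> N L" "x \<in> N L \<Longrightarrow> mneg T x \<in> N L"
    "x \<in> N L \<Longrightarrow> y \<in> N L \<Longrightarrow> madd T x y \<in> N L"
    "x \<in> N L \<Longrightarrow> L' \<in> S \<Longrightarrow> f \<in> Mor T L' L \<Longrightarrow> x \<cdot> f \<in> N L'"
  using assms unfolding hom_subfunctor_def by blast+

lemma simple_hom_subfunctorD:
  assumes "simple_hom_subfunctor Y N"
  shows "hom_subfunctor Y N" "\<exists>L\<in>S. \<exists>x\<in>N L. x \<noteq> mzero T L Y"
  using assms unfolding simple_hom_subfunctor_def by blast+

lemma simple_hom_subfunctor_eq:
  assumes "simple_hom_subfunctor Y N" "hom_subfunctor Y N'" "\<And>L. L \<in> S \<Longrightarrow> N' L \<subseteq> N L"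
    and "L \<in> S" "x \<in> N' L" "x \<noteq> mzero T L Y" and "L' \<in> S"
  shows "N' L' = N L'"
  using assms unfolding simple_hom_subfunctor_def by blast

text \<open>The component \<open>e\<close> of the identity of \<open>L\<close> in a simple summand of \<open>Hom(-, L)\<close> is the idempotent
  projecting onto this summand, so that its image represents the summand.\<close>

lemma simple_representable:
  assumes N: "simple_hom_subfunctor Y N"
  obtains L f where "L \<in> S" "f \<in> N L"
    "\<And>L' y. L' \<in> S \<Longrightarrow> y \<in> Mor T L' L \<Longrightarrow> f \<cdot> y = mzero T L' Y \<Longrightarrow> y = mzero T L' L"
    "\<And>L' x. L' \<in> S \<Longrightarrow> x \<in> N L' \<Longrightarrow> \<exists>y\<in>Mor T L' L. f \<cdot> y = x"
proof -
  note hN = simple_hom_subfunctorD(1)[OF N]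
  obtain L x where L: "L \<in> S" and xN: "x \<in> N L" and x0: "x \<noteq> mzero T L Y"
    using simple_hom_subfunctorD(2)[OF N] by blast
  have x: "x \<in> Mor T L Y" using hom_subfunctorD(1)[OF hN L xN] .
  have Y: "Y \<in> obj T" and L_obj: "L \<in> obj T" using Mor_obj[OF x] by auto
  have id: "idn T L \<in> Mor T L L" using idn_Mor[OF L_obj] .
  obtain J where J: "\<And>M. M \<in> J \<Longrightarrow> simple_hom_subfunctor L M"
    and span: "\<And>L' y. L' \<in> S \<Longrightarrow> y \<in> Mor T L' L \<Longrightarrow>
      \<exists>F \<phi>. finite F \<and> F \<subseteq> J \<and> (\<forall>M\<in>F. \<phi> M \<in> M L') \<and> y = msum L' L \<phi> F"
    and indep: "\<And>L' F \<phi>. L' \<in> S \<Longrightarrow> finite F \<Longrightarrow> F \<subseteq> J \<Longrightarrow> \<forall>M\<in>F. \<phi> M \<in> M L' \<Longrightarrow>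
      msum L' L \<phi> F = mzero T L' L \<Longrightarrow> \<forall>M\<in>F. \<phi> M = mzero T L' L"
    by (rule semisimple_decomposition[OF L_obj]) (rule that)
  obtain F \<phi> where F: "finite F" "F \<subseteq> J" and \<phi>: "\<And>M. M \<in> F \<Longrightarrow> \<phi> M \<in> M L"
    and id_eq: "idn T L = msum L L \<phi> F"
    using span[OF L id] by blast
  have \<phi>_Mor: "\<phi> M \<in> Mor T L L" if M: "M \<in> F" for M
  proof -
    have "hom_subfunctor L M" using J F M simple_hom_subfunctorD(1) by blast
    from hom_subfunctorD(1)[OF this L \<phi>[OF M]] show ?thesis .
  qed
  \<comment> \<open>By Yoneda, x is a map Hom(-, L) -> N. As the identity of L is the sum of its
    components, x does not kill all of them; this selects a simple summand M on which x is
    non-zero.\<close>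
  have "\<exists>M\<in>F. x \<cdot> \<phi> M \<noteq> mzero T L Y"
  proof (rule ccontr)
    assume "\<not> ?thesis"
    then have "msum L Y (\<lambda>M. x \<cdot> \<phi> M) F = mzero T L Y" by (intro msum_zero[OF L_obj Y]) blast
    then have "x = mzero T L Y"
      using cmp_msum[OF F(1) L_obj x \<phi>_Mor] cmp_idn[OF x] id_eq by simp
    then show False using x0 by blast
  qed
  then obtain M where M: "M \<in> F" and x\<phi>: "x \<cdot> \<phi> M \<noteq> mzero T L Y" by blast
  have MJ: "simple_hom_subfunctor L M" using J M F by blast
  note hM = simple_hom_subfunctorD(1)[OF MJ]
  let ?e = "\<phi> M"
  have e: "?e \<in> Mor T L L" and eM: "?e \<in> M L" using \<phi>_Mor \<phi> M by auto
  have proj: "?e \<cdot> y = y" if L': "L' \<in> S" and y: "y \<in> M L'" for L' y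
  proof -
    have y_Mor: "y \<in> Mor T L' L" using hom_subfunctorD(1)[OF hM L' y] .
    have L'_obj: "L' \<in> obj T" using Mor_obj(1)[OF y_Mor] .
    \<comment> \<open>An element y of M has two expansions, y itself in M and the sum of all
      \<open>\<phi> i \<cdot> y\<close>. This family is their difference; its sum is zero, and
      independence gives e y = y.\<close>
    define \<psi> where "\<psi> i = (if i = M then madd T (?e \<cdot> y) (mneg T y) else \<phi> i \<cdot> y)" for i
    define R where "R = msum L' L (\<lambda>i. \<phi> i \<cdot> y) (F - {M})"
    have \<phi>y: "\<phi> i \<cdot> y \<in> Mor T L' L" if "i \<in> F" for i using cmp_Mor[OF y_Mor \<phi>_Mor[OF that]] .
    have ey: "?e \<cdot> y \<in> Mor T L' L" using \<phi>y[OF M] .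
    have ny: "mneg T y \<in> Mor T L' L" using mneg_Mor[OF y_Mor] .
    have R: "R \<in> Mor T L' L" unfolding R_def by (rule msum_Mor[OF L'_obj L_obj]) (use \<phi>y in auto)
    have FM: "insert M (F - {M}) = F" using M by blast
    have "y = msum L' L (\<lambda>i. \<phi> i \<cdot> y) F"
      using msum_cmp[OF F(1) y_Mor L_obj \<phi>_Mor] id_eq idn_cmp[OF y_Mor] by simp
    also have "\<dots> = madd T (?e \<cdot> y) R"
      using msum_insert[of "F - {M}" M "\<lambda>i. \<phi> i \<cdot> y" L' L] F(1) \<phi>y FM R_def by auto
    finally have y_eq: "y = madd T (?e \<cdot> y) R" .
    have \<psi>_Mor: "\<psi> i \<in> Mor T L' L" if "i \<in> F" for i
      using that \<phi>y madd_Mor[OF ey ny] by (simp add: \<psi>_def)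
    have "msum L' L \<psi> (F - {M}) = R"
      unfolding R_def by (rule msum_cong[OF L'_obj L_obj]) (use \<phi>y in \<open>auto simp: \<psi>_def\<close>)
    then have "msum L' L \<psi> F = madd T (\<psi> M) R"
      using msum_insert[of "F - {M}" M \<psi> L' L] F(1) \<psi>_Mor M FM by auto
    also have "\<dots> = madd T (madd T (?e \<cdot> y) (mneg T y)) R" by (simp add: \<psi>_def)
    also have "\<dots> = madd T (mneg T y) (madd T (?e \<cdot> y) R)"
      using madd_commute[OF ey ny] madd_assoc[OF ny ey R] by simp
    also have "\<dots> = mzero T L' L" using y_eq[symmetric] madd_mneg(2)[OF y_Mor] by simp
    finally have "msum L' L \<psi> F = mzero T L' L" .
    moreover have "\<psi> i \<in> i L'" if i: "i \<in> F" for i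
    proof -
      have hi: "hom_subfunctor L i" using simple_hom_subfunctorD(1)[OF J] F i by blast
      have *: "\<phi> i \<cdot> y \<in> i L'" using hom_subfunctorD(5)[OF hi L \<phi>[OF i] L' y_Mor] .
      show ?thesis
      proof (cases "i = M")
        case True
        then show ?thesis
          using hom_subfunctorD(4)[OF hM L' _ hom_subfunctorD(3)[OF hM L' y]] * by (simp add: \<psi>_def)
      qed (use * in \<open>simp add: \<psi>_def\<close>)
    qed
    ultimately have "\<psi> M = mzero T L' L" using indep[OF L' F] M by blast
    then show ?thesis using madd_mneg_eq_mzero_iff[OF ey y_Mor] by (simp add: \<psi>_def)
  qed
  \<comment> \<open>Idempotence of e is \<open>proj\<close> applied to e itself, an element of
    M.\<close>
  obtain L1 p i where p: "p \<in> Mor T L L1" and i: "i \<in> Mor T L1 L" and pi: "p \<cdot> i = idn T L1"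
    and ip: "i \<cdot> p = ?e"
    using idempotent_split[OF e proj[OF L eM]] by blast
  have L1: "L1 \<in> S"
    using summands L idempotent_direct_summand[OF p i pi] Mor_obj(1)[OF i]
    unfolding stable_under_summands_def by blast
  have "i = ?e \<cdot> i" using cmp_assoc[OF i p i] pi ip cmp_idn[OF i] by simp
  then have iM: "i \<in> M L1" using hom_subfunctorD(5)[OF hM L eM L1 i] by simp
  \<comment> \<open>Since i identifies Hom(-, L1) with M, this is x restricted to M. What remains is
    Schur's lemma: a non-zero map between the simple functors M and N is bijective.\<close>
  let ?f = "x \<cdot> i"
  have fN: "?f \<in> N L1" using hom_subfunctorD(5)[OF hN L xN L1 i] .
  have f: "?f \<in> Mor T L1 Y" using cmp_Mor[OF i x] .
  \<comment> \<open>The kernel of x on M. It omits e because \<open>x \<cdot> \<phi> M\<close> is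
    non-zero, so simplicity of M makes it trivial.\<close>
  define K where "K L' = {z \<in> M L'. x \<cdot> z = mzero T L' Y}" for L'
  have K: "hom_subfunctor L K"
    unfolding hom_subfunctor_def
  proof (intro conjI ballI)
    fix L' assume L': "L' \<in> S"
    then have L'_obj: "L' \<in> obj T" using S_obj by blast
    show "K L' \<subseteq> Mor T L' L" using hom_subfunctorD(1)[OF hM L'] by (auto simp: K_def)
    show "mzero T L' L \<in> K L'"
      using hom_subfunctorD(2)[OF hM L'] cmp_mzero[OF x L'_obj] by (simp add: K_def)
    fix z assume z: "z \<in> K L'"
    then have zM: "z \<in> M L'" and xz: "x \<cdot> z = mzero T L' Y" by (auto simp: K_def)
    have z_Mor: "z \<in> Mor T L' L" using hom_subfunctorD(1)[OF hM L' zM] .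
    show "mneg T z \<in> K L'"
      using hom_subfunctorD(3)[OF hM L' zM] cmp_mneg[OF z_Mor x] xz mneg_mzero[OF L'_obj Y]
      by (simp add: K_def)
    fix z' assume z': "z' \<in> K L'"
    then have zM': "z' \<in> M L'" and xz': "x \<cdot> z' = mzero T L' Y" by (auto simp: K_def)
    show "madd T z z' \<in> K L'"
      using hom_subfunctorD(4)[OF hM L' zM zM'] cmp_madd_right[OF z_Mor _ x, of z'] xz xz'
        hom_subfunctorD(1)[OF hM L' zM'] madd_mzero(1)[OF mzero_Mor[OF L'_obj Y]] by (simp add: K_def)
  next
    fix L' L'' h z assume L': "L' \<in> S" and L'': "L'' \<in> S" and h: "h \<in> Mor T L' L''" and z: "z \<in> K L''"
    then have zM: "z \<in> M L''" and xz: "x \<cdot> z = mzero T L'' Y" by (auto simp: K_def)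
    have "x \<cdot> (z \<cdot> h) = mzero T L' Y"
      using cmp_assoc[OF h hom_subfunctorD(1)[OF hM L'' zM] x] xz mzero_cmp[OF h Y] by simp
    then show "z \<cdot> h \<in> K L'" using hom_subfunctorD(5)[OF hM L'' zM L' h] by (simp add: K_def)
  qed
  have K0: "z = mzero T L' L" if L': "L' \<in> S" and z: "z \<in> K L'" for L' z
  proof (rule ccontr)
    assume z0: "z \<noteq> mzero T L' L"
    have "K L = M L"
      by (rule simple_hom_subfunctor_eq[OF MJ K _ L' z z0 L]) (auto simp: K_def)
    then show False using eM x\<phi> by (auto simp: K_def)
  qed
  have inj: "y = mzero T L' L1"
    if L': "L' \<in> S" and y: "y \<in> Mor T L' L1" and 0: "?f \<cdot> y = mzero T L' Y" for L' y
  proof -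
    have "i \<cdot> y \<in> M L'" using hom_subfunctorD(5)[OF hM L1 iM L' y] .
    moreover have "x \<cdot> (i \<cdot> y) = mzero T L' Y" using cmp_assoc[OF y i x] 0 by simp
    ultimately have "i \<cdot> y = mzero T L' L" using K0[OF L'] by (simp add: K_def)
    then have "p \<cdot> (i \<cdot> y) = mzero T L' L1" using cmp_mzero[OF p Mor_obj(1)[OF y]] by simp
    then show ?thesis using cmp_assoc[OF y i p] pi idn_cmp[OF y] by simp
  qed
  \<comment> \<open>The image of f. It contains x e, which equals f p and is non-zero, so simplicity
    of N makes it all of N.\<close>
  define I where "I L' = (\<lambda>y. ?f \<cdot> y) ` Mor T L' L1" for L'
  have I: "hom_subfunctor Y I"
    unfolding hom_subfunctor_def
  proof (intro conjI ballI)
    fix L' assume L': "L' \<in> S"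
    then have L'_obj: "L' \<in> obj T" using S_obj by blast
    show "I L' \<subseteq> Mor T L' Y" using cmp_Mor[OF _ f] by (auto simp: I_def)
    show "mzero T L' Y \<in> I L'"
      unfolding I_def using cmp_mzero[OF f L'_obj] mzero_Mor[OF L'_obj Mor_obj(1)[OF f]]
      by (metis imageI)
    fix z assume "z \<in> I L'"
    then obtain y where y: "y \<in> Mor T L' L1" "z = ?f \<cdot> y" by (auto simp: I_def)
    then show "mneg T z \<in> I L'"
      unfolding I_def using cmp_mneg[OF y(1) f] mneg_Mor[OF y(1)] by (metis imageI)
    fix z' assume "z' \<in> I L'"
    then obtain y' where y': "y' \<in> Mor T L' L1" "z' = ?f \<cdot> y'" by (auto simp: I_def)
    show "madd T z z' \<in> I L'"
      unfolding I_def using cmp_madd_right[OF y(1) y'(1) f] madd_Mor[OF y(1) y'(1)] y(2) y'(2)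
      by (metis imageI)
  next
    fix L' L'' h z assume L': "L' \<in> S" and L'': "L'' \<in> S" and h: "h \<in> Mor T L' L''" and z: "z \<in> I L''"
    then obtain y where y: "y \<in> Mor T L'' L1" "z = ?f \<cdot> y" by (auto simp: I_def)
    then show "z \<cdot> h \<in> I L'"
      unfolding I_def using cmp_assoc[OF h y(1) f] cmp_Mor[OF h y(1)] by (metis imageI)
  qed
  have fp: "?f \<cdot> p = x \<cdot> ?e" using cmp_assoc[OF p i x] ip by simp
  have "x \<cdot> ?e \<in> I L" unfolding I_def using fp p by (metis imageI)
  moreover have "I L' \<subseteq> N L'" if "L' \<in> S" for L'
    using hom_subfunctorD(5)[OF hN L1 fN that] by (auto simp: I_def)
  ultimately have I_eq: "I L' = N L'" if "L' \<in> S" for L'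
    using simple_hom_subfunctor_eq[OF N I _ L _ x\<phi> that] by blast
  have surj: "\<exists>y\<in>Mor T L' L1. ?f \<cdot> y = z" if "L' \<in> S" "z \<in> N L'" for L' z
  proof -
    have "z \<in> I L'" using I_eq that by simp
    then show ?thesis by (auto simp: I_def)
  qed
  show thesis using that[OF L1 fN inj surj] .
qed

text \<open>Every summand has a non-zero element over some object of the small skeleton of S.
  Independence lets no two summands share such an element, so J embeds into a small union of small
  sets of morphisms.\<close>

lemma simple_summands_small:
  assumes J: "\<And>N. N \<in> J \<Longrightarrow> simple_hom_subfunctor Y N"
    and indep: "\<And>L F \<phi>. L \<in> S \<Longrightarrow> finite F \<Longrightarrow> F \<subseteq> J \<Longrightarrow> \<forall>N\<in>F. \<phi> N \<in> N L \<Longrightarrow>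
      msum L Y \<phi> F = mzero T L Y \<Longrightarrow> \<forall>N\<in>F. \<phi> N = mzero T L Y"
    and Y: "Y \<in> obj T"
  shows "small U J"
proof -
  obtain S0 where S0: "S0 \<subseteq> S" "small U S0" "\<And>X. X \<in> S \<Longrightarrow> \<exists>Y\<in>S0. isomorphic T X Y"
    using ess_small unfolding essentially_small_def by blast
  have "\<exists>x. \<exists>L\<in>S0. x \<in> N L \<and> x \<noteq> mzero T L Y" if N: "N \<in> J" for N
  proof -
    note hN = simple_hom_subfunctorD(1)[OF J[OF N]]
    obtain L x where L: "L \<in> S" and xN: "x \<in> N L" and x0: "x \<noteq> mzero T L Y"
      using simple_hom_subfunctorD(2)[OF J[OF N]] by blast
    obtain L0 f where L0: "L0 \<in> S0" and "is_isom T L L0 f"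
      using S0(3)[OF L] unfolding isomorphic_def by blast
    then obtain g where f: "f \<in> Mor T L L0" and g: "g \<in> Mor T L0 L" and gf: "g \<cdot> f = idn T L"
      unfolding is_isom_def by blast
    have x: "x \<in> Mor T L Y" using hom_subfunctorD(1)[OF hN L xN] .
    have "x \<cdot> g \<in> N L0" using hom_subfunctorD(5)[OF hN L xN _ g] L0 S0(1) by blast
    moreover have "x \<cdot> g \<noteq> mzero T L0 Y"
      using cmp_assoc[OF f g x] gf cmp_idn[OF x] mzero_cmp[OF f Y] x0 by auto
    ultimately show ?thesis using L0 by blast
  qed
  then obtain t where t: "\<And>N. N \<in> J \<Longrightarrow> \<exists>L\<in>S0. t N \<in> N L \<and> t N \<noteq> mzero T L Y" by metis
  have Mor: "t N \<in> Mor T L Y" if "N \<in> J" "L \<in> S0" "t N \<in> N L" for N L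
    using hom_subfunctorD(1)[OF simple_hom_subfunctorD(1)[OF J[OF that(1)]] _ that(3)] that(2) S0(1)
    by blast
  have "inj_on t J"
  proof (rule inj_onI, rule ccontr)
    fix N N' assume N: "N \<in> J" and N': "N' \<in> J" and eq: "t N = t N'" and ne: "N \<noteq> N'"
    obtain L where L: "L \<in> S0" "t N \<in> N L" "t N \<noteq> mzero T L Y" using t[OF N] by blast
    obtain L' where L': "L' \<in> S0" "t N' \<in> N' L'" using t[OF N'] by blast
    have tN: "t N \<in> Mor T L Y" using Mor[OF N L(1,2)] .
    \<comment> \<open>Morphisms determine their source, so equal elements live over the same
      object.\<close>
    have "L' = L" using tN Mor[OF N' L'] eq by (simp add: Mor_def)
    then have tN': "t N \<in> N' L" using L' eq by simp
    have LS: "L \<in> S" using L S0(1) by blast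
    \<comment> \<open>A shared element would give the non-trivial relation t + (-t) = 0 between two
      summands.\<close>
    define \<phi> where "\<phi> i = (if i = N then t N else mneg T (t N))" for i
    have "msum L Y \<phi> {N, N'} = madd T (\<phi> N) (msum L Y \<phi> {N'})"
      by (rule msum_insert) (use tN mneg_Mor[OF tN] ne in \<open>auto simp: \<phi>_def\<close>)
    also have "msum L Y \<phi> {N'} = madd T (\<phi> N') (msum L Y \<phi> {})"
      by (rule msum_insert) (use mneg_Mor[OF tN] ne in \<open>auto simp: \<phi>_def\<close>)
    also have "madd T (\<phi> N) \<dots> = mzero T L Y"
      using msum_empty[OF Mor_obj[OF tN], of \<phi>] madd_mzero(1)[OF mneg_Mor[OF tN]]
        madd_mneg(1)[OF tN] ne by (simp add: \<phi>_def)
    finally have "msum L Y \<phi> {N, N'} = mzero T L Y" .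
    moreover have "\<phi> i \<in> i L" if "i \<in> {N, N'}" for i
      using that L(2) hom_subfunctorD(3)[OF simple_hom_subfunctorD(1)[OF J[OF N']] LS tN']
      by (auto simp: \<phi>_def)
    ultimately have "\<phi> N = mzero T L Y" using indep[OF LS, of "{N, N'}" \<phi>] N N' by blast
    then show False using L(3) by (simp add: \<phi>_def)
  qed
  moreover have "t ` J \<subseteq> (\<Union>L\<in>S0. Mor T L Y)" using t Mor by blast
  ultimately have "J \<lesssim> (\<Union>L\<in>S0. Mor T L Y)" unfolding lepoll_def by blast
  moreover have "small U (\<Union>L\<in>S0. Mor T L Y)"
  proof (rule small_UN[OF univ S0(2)])
    fix L assume "L \<in> S0"
    then show "small U (Mor T L Y)"
      using homs_small S0(1) S_obj Y unfolding locally_small_def by blast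
  qed
  ultimately show ?thesis using small_lepoll by blast
qed

text \<open>\<open>P\<close> is a coproduct of objects of \<open>S\<close> representing the simple summands of \<open>H\<^sup>0 Y\<close>.\<close>

lemma realization:
  assumes Y: "Y \<in> obj T"
  obtains P f where "f \<in> Mor T P Y"
    "\<And>L x. L \<in> S \<Longrightarrow> x \<in> Mor T L Y \<Longrightarrow> \<exists>y\<in>Mor T L P. f \<cdot> y = x"
    "\<And>L y. L \<in> S \<Longrightarrow> y \<in> Mor T L P \<Longrightarrow> f \<cdot> y = mzero T L Y \<Longrightarrow> y = mzero T L P"
    "\<And>L k y. L \<in> S \<Longrightarrow> k < 0 \<Longrightarrow> y \<in> Mor T L (sh_obj T k P) \<Longrightarrow> y = mzero T L (sh_obj T k P)"
    "\<And>W u. u \<in> Mor T P W \<Longrightarrow> \<forall>L\<in>S. \<forall>v\<in>Mor T L W. v = mzero T L W \<Longrightarrow>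
      u = mzero T P W"
proof -
  obtain J where J: "\<And>N. N \<in> J \<Longrightarrow> simple_hom_subfunctor Y N"
    and span: "\<And>L x. L \<in> S \<Longrightarrow> x \<in> Mor T L Y \<Longrightarrow>
      \<exists>F \<phi>. finite F \<and> F \<subseteq> J \<and> (\<forall>N\<in>F. \<phi> N \<in> N L) \<and> x = msum L Y \<phi> F"
    and indep: "\<And>L F \<phi>. L \<in> S \<Longrightarrow> finite F \<Longrightarrow> F \<subseteq> J \<Longrightarrow> \<forall>N\<in>F. \<phi> N \<in> N L \<Longrightarrow>
      msum L Y \<phi> F = mzero T L Y \<Longrightarrow> \<forall>N\<in>F. \<phi> N = mzero T L Y"
    by (rule semisimple_decomposition[OF Y]) (rule that)
  have J_small: "small U J" by (rule simple_summands_small[OF J indep Y])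
  \<comment> \<open>The pair \<open>r\<close> consists of an object of S and an element of N over
    it, composition with which identifies the representable functor with N.\<close>
  define Q where "Q N r \<longleftrightarrow> fst r \<in> S \<and> snd r \<in> N (fst r) \<and>
    (\<forall>L\<in>S. \<forall>y\<in>Mor T L (fst r). snd r \<cdot> y = mzero T L Y \<longrightarrow> y = mzero T L (fst r)) \<and>
    (\<forall>L\<in>S. \<forall>x\<in>N L. \<exists>y\<in>Mor T L (fst r). snd r \<cdot> y = x)" for N r
  have "\<exists>r. Q N r" if "N \<in> J" for N
  proof (rule simple_representable[OF J[OF that]])
    fix L f assume *: "L \<in> S" "f \<in> N L"
      "\<And>L' y. L' \<in> S \<Longrightarrow> y \<in> Mor T L' L \<Longrightarrow> f \<cdot> y = mzero T L' Y \<Longrightarrow> y = mzero T L' L"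
      "\<And>L' x. L' \<in> S \<Longrightarrow> x \<in> N L' \<Longrightarrow> \<exists>y\<in>Mor T L' L. f \<cdot> y = x"
    have "Q N (L, f)" unfolding Q_def fst_conv snd_conv using * by blast
    then show ?thesis ..
  qed
  then obtain r where r: "\<And>N. N \<in> J \<Longrightarrow> Q N (r N)" using bchoice[of J Q] by blast
  define R f where "R N = fst (r N)" and "f N = snd (r N)" for N
  have R: "\<And>N. N \<in> J \<Longrightarrow> R N \<in> S" and fN: "\<And>N. N \<in> J \<Longrightarrow> f N \<in> N (R N)"
    and f_inj: "\<And>N L y. N \<in> J \<Longrightarrow> L \<in> S \<Longrightarrow> y \<in> Mor T L (R N) \<Longrightarrow> f N \<cdot> y = mzero T L Y \<Longrightarrow>
      y = mzero T L (R N)"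
    and f_surj: "\<And>N L x. N \<in> J \<Longrightarrow> L \<in> S \<Longrightarrow> x \<in> N L \<Longrightarrow> \<exists>y\<in>Mor T L (R N). f N \<cdot> y = x"
    using r unfolding Q_def R_def f_def by blast+
  note hN = simple_hom_subfunctorD(1)[OF J]
  have R_obj: "R N \<in> obj T" if "N \<in> J" for N using R[OF that] S_obj by blast
  have f_Mor: "f N \<in> Mor T (R N) Y" if N: "N \<in> J" for N
    using hom_subfunctorD(1)[OF hN[OF N] R[OF N] fN[OF N]] .
  obtain P \<iota> where P: "is_coproduct T J R P \<iota>"
    using small_coproduct[OF coproducts J_small, of R] R_obj by blast
  then have P_obj: "P \<in> obj T" by (simp add: is_coproduct_def)
  have \<iota>: "\<iota> N \<in> Mor T (R N) P" if "N \<in> J" for N using coproduct_Mor[OF P that] .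
  obtain q where q: "q \<in> Mor T P Y" and q\<iota>: "\<And>N. N \<in> J \<Longrightarrow> q \<cdot> \<iota> N = f N"
    using coproduct_ex[OF P Y, of f] f_Mor by blast
  have q\<iota>y: "q \<cdot> (\<iota> N \<cdot> y) = f N \<cdot> y" if "N \<in> J" "y \<in> Mor T L (R N)" for N L y
    using cmp_assoc[OF that(2) \<iota> q] q\<iota> that(1) by simp
  have finL: "finitary U L" if "L \<in> S" for L
    using finitary_generator[OF that, of 0] sh_obj_0 S_obj that by auto
  have surj: "\<exists>y\<in>Mor T L P. q \<cdot> y = x" if L: "L \<in> S" and x: "x \<in> Mor T L Y" for L x
  proof -
    have L_obj: "L \<in> obj T" using L S_obj by blast
    obtain F \<phi> where F: "finite F" "F \<subseteq> J" and \<phi>: "\<And>N. N \<in> F \<Longrightarrow> \<phi> N \<in> N L"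
      and x_eq: "x = msum L Y \<phi> F"
      using span[OF L x] by blast
    have "\<exists>y. y \<in> Mor T L (R N) \<and> f N \<cdot> y = \<phi> N" if N: "N \<in> F" for N
    proof -
      have "N \<in> J" using F N by blast
      from f_surj[OF this L \<phi>[OF N]] show ?thesis by blast
    qed
    then obtain y where y: "\<And>N. N \<in> F \<Longrightarrow> y N \<in> Mor T L (R N)" "\<And>N. N \<in> F \<Longrightarrow> f N \<cdot> y N = \<phi> N"
      by metis
    have \<iota>y: "\<iota> N \<cdot> y N \<in> Mor T L P" if "N \<in> F" for N
      using cmp_Mor[OF y(1) \<iota>] F that by blast
    have q_eq: "q \<cdot> (\<iota> N \<cdot> y N) = \<phi> N" if "N \<in> F" for N
      using q\<iota>y[OF _ y(1)[OF that]] y(2)[OF that] F that by auto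
    have "q \<cdot> msum L P (\<lambda>N. \<iota> N \<cdot> y N) F = msum L Y (\<lambda>N. q \<cdot> (\<iota> N \<cdot> y N)) F"
      by (rule cmp_msum[OF F(1) L_obj q \<iota>y])
    also have "\<dots> = x" unfolding x_eq
      by (rule msum_cong[OF L_obj Y]) (use q_eq cmp_Mor[OF \<iota>y q] in auto)
    finally have "q \<cdot> msum L P (\<lambda>N. \<iota> N \<cdot> y N) F = x" .
    moreover have "msum L P (\<lambda>N. \<iota> N \<cdot> y N) F \<in> Mor T L P"
      by (rule msum_Mor[OF L_obj P_obj \<iota>y])
    ultimately show ?thesis by blast
  qed
  \<comment> \<open>Compactness expands y over finitely many summands. The images of the terms lie
    in distinct simple summands, so independence kills each of them, and injectivity of
    \<open>f N\<close> kills the coefficients.\<close>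
  have inj: "y = mzero T L P" if L: "L \<in> S" and y: "y \<in> Mor T L P" and 0: "q \<cdot> y = mzero T L Y" for L y
  proof -
    have L_obj: "L \<in> obj T" using L S_obj by blast
    obtain F \<phi> where F: "finite F" "F \<subseteq> J" and \<phi>: "\<And>N. N \<in> F \<Longrightarrow> \<phi> N \<in> Mor T L (R N)"
      and y_eq: "y = msum L P (\<lambda>N. \<iota> N \<cdot> \<phi> N) F"
      by (rule finitaryE[OF finL[OF L] J_small R_obj P y], assumption) (rule that)
    have FJ: "N \<in> J" if "N \<in> F" for N using F that by blast
    have \<iota>\<phi>: "\<iota> N \<cdot> \<phi> N \<in> Mor T L P" if "N \<in> F" for N
      using cmp_Mor[OF \<phi> \<iota>] FJ that by blast
    have "mzero T L Y = msum L Y (\<lambda>N. q \<cdot> (\<iota> N \<cdot> \<phi> N)) F"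
      using cmp_msum[OF F(1) L_obj q \<iota>\<phi>] y_eq 0 by simp
    also have "\<dots> = msum L Y (\<lambda>N. f N \<cdot> \<phi> N) F"
      by (rule msum_cong[OF L_obj Y cmp_Mor[OF \<iota>\<phi> q]]) (use q\<iota>y[OF FJ \<phi>] in auto)
    finally have 0: "msum L Y (\<lambda>N. f N \<cdot> \<phi> N) F = mzero T L Y" by simp
    have "f N \<cdot> \<phi> N \<in> N L" if N: "N \<in> F" for N
      using hom_subfunctorD(5)[OF hN[OF FJ[OF N]] R[OF FJ[OF N]] fN[OF FJ[OF N]] L \<phi>[OF N]] .
    then have "\<forall>N\<in>F. f N \<cdot> \<phi> N = mzero T L Y"
      using indep[OF L F, of "\<lambda>N. f N \<cdot> \<phi> N"] 0 by blast
    then have "\<phi> N = mzero T L (R N)" if "N \<in> F" for N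
      using f_inj[OF FJ L \<phi>] that by blast
    then have "\<iota> N \<cdot> \<phi> N = mzero T L P" if "N \<in> F" for N
      using cmp_mzero[OF \<iota>[OF FJ] L_obj] that by simp
    then show ?thesis unfolding y_eq by (rule msum_zero[OF L_obj P_obj])
  qed
  \<comment> \<open>The shift of P is the coproduct of the shifted summands; b) applies to each, and
    compactness of L passes from the summands to P.\<close>
  have neg: "y = mzero T L (sh_obj T k P)"
    if L: "L \<in> S" and k: "k < 0" and y: "y \<in> Mor T L (sh_obj T k P)" for L k y
  proof (rule finitary_eq_mzero[OF finL[OF L] J_small _ sh_coproduct[OF P R_obj] y])
    fix N assume N: "N \<in> J"
    show "sh_obj T k (R N) \<in> obj T" using sh_obj_closed[OF R_obj[OF N]] .
    show "\<phi> = mzero T L (sh_obj T k (R N))" if "\<phi> \<in> Mor T L (sh_obj T k (R N))" for \<phi>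
      using negative[OF L R[OF N] k] that by blast
  qed
  have maps: "u = mzero T P W"
    if u: "u \<in> Mor T P W" and W: "\<forall>L\<in>S. \<forall>v\<in>Mor T L W. v = mzero T L W" for u W
  proof (rule coproduct_eq[OF P u mzero_Mor[OF Mor_obj[OF u]]])
    fix N assume N: "N \<in> J"
    show "u \<cdot> \<iota> N = mzero T P W \<cdot> \<iota> N"
      using W[rule_format, OF R[OF N] cmp_Mor[OF \<iota>[OF N] u]] mzero_cmp[OF \<iota>[OF N] Mor_obj(2)[OF u]] by simp
  qed
  show thesis using that[OF q surj inj neg maps] .
qed

end

section \<open>Truncation\<close>

context triangulated_category
begin

section \<open>Cohomology as maps out of shifted generators\<close>

lemma transpose_eq_mzero:
  assumes c: "c \<in> Mor T (sh_obj T k L) W" and L: "L \<in> obj T"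
    and 0: "\<And>v. v \<in> Mor T L (sh_obj T (- k) W) \<Longrightarrow> v = mzero T L (sh_obj T (- k) W)"
  shows "c = mzero T (sh_obj T k L) W"
proof -
  have "sh_mor T (- k) c = mzero T L (sh_obj T (- k) W)"
    using 0 sh_mor_transpose(1)[OF c L] .
  then have "sh_mor T (- k) c = mzero T (sh_obj T (- k) (sh_obj T k L)) (sh_obj T (- k) W)"
    using sh_obj_sh_obj[OF L, of "- k" k] sh_obj_0[OF L] by simp
  then show ?thesis using sh_mor_eq_mzero_iff[OF c] by blast
qed

lemma transpose_eq_mzero':
  assumes c: "c \<in> Mor T L (sh_obj T k W)" and W: "W \<in> obj T"
    and 0: "\<And>v. v \<in> Mor T (sh_obj T (- k) L) W \<Longrightarrow> v = mzero T (sh_obj T (- k) L) W"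
  shows "c = mzero T L (sh_obj T k W)"
proof -
  have "sh_mor T (- k) c = mzero T (sh_obj T (- k) L) W"
    using 0 sh_mor_transpose(2)[OF c W] .
  then have "sh_mor T (- k) c = mzero T (sh_obj T (- k) L) (sh_obj T (- k) (sh_obj T k W))"
    using sh_obj_sh_obj[OF W, of "- k" k] sh_obj_0[OF W] by simp
  then show ?thesis using sh_mor_eq_mzero_iff[OF c] by blast
qed

text \<open>Generation and the exact sequences concern maps out of shifted generators, so degree p
  is rewritten as the shift k = -p of L. The positive degrees become the negative k.\<close>

lemma smodule_zero_iff:
  assumes S: "S \<subseteq> obj T" and X: "X \<in> obj T"
  shows "smodule_zero S (H_obj T p X) \<longleftrightarrow>
    (\<forall>L\<in>S. \<forall>v\<in>Mor T (sh_obj T (- p) L) X. v = mzero T (sh_obj T (- p) L) X)"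
proof -
  have "smodule_zero S (H_obj T p X) \<longleftrightarrow>
      (\<forall>L\<in>S. \<forall>v\<in>Mor T L (sh_obj T p X). v = mzero T L (sh_obj T p X))"
    using mzero_Mor[OF _ sh_obj_closed[OF X]] S by (auto simp: smodule_zero_def H_obj_def)
  moreover have "(\<forall>v\<in>Mor T L (sh_obj T p X). v = mzero T L (sh_obj T p X)) \<longleftrightarrow>
      (\<forall>v\<in>Mor T (sh_obj T (- p) L) X. v = mzero T (sh_obj T (- p) L) X)" if "L \<in> S" for L
    using transpose_eq_mzero[of _ "- p" L X] transpose_eq_mzero'[of _ L p X] X S that by auto
  ultimately show ?thesis by blast
qed

lemma H_le0_iff:
  assumes "S \<subseteq> obj T"
  shows "X \<in> H_le0 T S \<longleftrightarrow> X \<in> obj T \<and>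
    (\<forall>L\<in>S. \<forall>k<0. \<forall>v\<in>Mor T (sh_obj T k L) X. v = mzero T (sh_obj T k L) X)"
proof -
  have "(\<forall>p>0. Q (- p)) \<longleftrightarrow> (\<forall>k<0. Q k)" for Q :: "int \<Rightarrow> bool"
    by (metis minus_minus neg_0_less_iff_less)
  from this[of "\<lambda>k. \<forall>L\<in>S. \<forall>v\<in>Mor T (sh_obj T k L) X. v = mzero T (sh_obj T k L) X"]
  show ?thesis using smodule_zero_iff[OF assms, of X] by (auto simp: H_le0_def)
qed

lemma H_gt0_iff:
  assumes "S \<subseteq> obj T"
  shows "X \<in> H_gt0 T S \<longleftrightarrow> X \<in> obj T \<and>
    (\<forall>L\<in>S. \<forall>k\<ge>0. \<forall>v\<in>Mor T (sh_obj T k L) X. v = mzero T (sh_obj T k L) X)"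
proof -
  have "(\<forall>p\<le>0. Q (- p)) \<longleftrightarrow> (\<forall>k\<ge>0. Q k)" for Q :: "int \<Rightarrow> bool"
    by (metis minus_minus neg_0_le_iff_le)
  from this[of "\<lambda>k. \<forall>L\<in>S. \<forall>v\<in>Mor T (sh_obj T k L) X. v = mzero T (sh_obj T k L) X"]
  show ?thesis using smodule_zero_iff[OF assms, of X] by (auto simp: H_gt0_def)
qed

text \<open>Bijectivity is assumed on maps out of \<Sigma>^{-p}L, the form in which exact sequences
  deliver it. A pointwise inverse is automatically additive and natural because preimages are
  unique.\<close>

lemma H_mor_iso:
  assumes S: "S \<subseteq> obj T" and g: "g \<in> Mor T X Y"
    and inj: "\<And>L x. L \<in> S \<Longrightarrow> x \<in> Mor T (sh_obj T (- p) L) X \<Longrightarrow>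
      g \<cdot> x = mzero T (sh_obj T (- p) L) Y \<Longrightarrow> x = mzero T (sh_obj T (- p) L) X"
    and surj: "\<And>L y. L \<in> S \<Longrightarrow> y \<in> Mor T (sh_obj T (- p) L) Y \<Longrightarrow>
      \<exists>x\<in>Mor T (sh_obj T (- p) L) X. g \<cdot> x = y"
  shows "smodule_iso T S (H_obj T p X) (H_obj T p Y) (H_mor T p g)"
proof -
  let ?X = "sh_obj T p X" and ?Y = "sh_obj T p Y" and ?g = "sh_mor T p g"
  have X: "X \<in> obj T" and Y: "Y \<in> obj T" using Mor_obj[OF g] by auto
  have pg: "?g \<in> Mor T ?X ?Y" using sh_mor_Mor[OF g] .
  have S_obj: "L \<in> obj T" if "L \<in> S" for L using S that by blast
  have ker: "x = mzero T L ?X" if L: "L \<in> S" and x: "x \<in> Mor T L ?X" and 0: "?g \<cdot> x = mzero T L ?Y"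
    for L x
  proof -
    let ?x = "sh_mor T (- p) x"
    have x': "?x \<in> Mor T (sh_obj T (- p) L) X" using sh_mor_transpose(2)[OF x X] .
    have pL: "sh_obj T p (sh_obj T (- p) L) = L"
      using sh_obj_sh_obj[OF S_obj[OF L], of p "- p"] sh_obj_0[OF S_obj[OF L]] by simp
    have "sh_mor T p (g \<cdot> ?x) = mzero T L ?Y"
      using sh_mor_cmp[OF x' g, of p] sh_mor_inverse(1)[OF x, of p] 0 by simp
    then have "g \<cdot> ?x = mzero T (sh_obj T (- p) L) Y"
      using sh_mor_eq_mzero_iff[OF cmp_Mor[OF x' g], of p] pL by simp
    then have "?x = mzero T (sh_obj T (- p) L) X" using inj[OF L x'] by blast
    then have "sh_mor T p ?x = mzero T L ?X"
      using sh_mor_mzero[OF sh_obj_closed[OF S_obj[OF L]] X, of p "- p"] pL by simp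
    then show ?thesis using sh_mor_inverse(1)[OF x, of p] by simp
  qed
  have inj': "x = x'" if L: "L \<in> S" and x: "x \<in> Mor T L ?X" and x': "x' \<in> Mor T L ?X"
    and eq: "?g \<cdot> x = ?g \<cdot> x'" for L x x'
  proof -
    have "?g \<cdot> madd T x (mneg T x') = mzero T L ?Y"
      using cmp_madd_right[OF x mneg_Mor[OF x'] pg] cmp_mneg[OF x' pg] eq
        madd_mneg(1)[OF cmp_Mor[OF x' pg]] by simp
    then show ?thesis
      using ker[OF L madd_Mor[OF x mneg_Mor[OF x']]] madd_mneg_eq_mzero_iff[OF x x'] by blast
  qed
  have surj': "\<exists>x\<in>Mor T L ?X. ?g \<cdot> x = y" if L: "L \<in> S" and y: "y \<in> Mor T L ?Y" for L y
  proof -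
    obtain x where x: "x \<in> Mor T (sh_obj T (- p) L) X" and gx: "g \<cdot> x = sh_mor T (- p) y"
      using surj[OF L sh_mor_transpose(2)[OF y Y]] by blast
    have pL: "sh_obj T p (sh_obj T (- p) L) = L"
      using sh_obj_sh_obj[OF S_obj[OF L], of p "- p"] sh_obj_0[OF S_obj[OF L]] by simp
    have "?g \<cdot> sh_mor T p x = y"
      using sh_mor_cmp[OF x g, of p] gx sh_mor_inverse(1)[OF y, of p] by simp
    moreover have "sh_mor T p x \<in> Mor T L ?X" using sh_mor_Mor[OF x, of p] pL by simp
    ultimately show ?thesis by blast
  qed
  define \<theta> where "\<theta> L y = (SOME x. x \<in> Mor T L ?X \<and> ?g \<cdot> x = y)" for L y
  have \<theta>: "\<theta> L y \<in> Mor T L ?X" "?g \<cdot> \<theta> L y = y" if "L \<in> S" "y \<in> Mor T L ?Y" for L y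
  proof -
    have "\<exists>x. x \<in> Mor T L ?X \<and> ?g \<cdot> x = y" using surj'[OF that] by blast
    from someI_ex[OF this] show "\<theta> L y \<in> Mor T L ?X" "?g \<cdot> \<theta> L y = y" by (simp_all add: \<theta>_def)
  qed
  have \<theta>_eq: "\<theta> L y = x" if "L \<in> S" "x \<in> Mor T L ?X" "?g \<cdot> x = y" for L x y
    using inj'[OF that(1) \<theta>(1)[OF that(1), of y] that(2)] \<theta>(2)[OF that(1), of y]
      cmp_Mor[OF that(2) pg] that(3) by simp
  have \<theta>_madd: "\<theta> L (madd T y y') = madd T (\<theta> L y) (\<theta> L y')"
    if "L \<in> S" "y \<in> Mor T L ?Y" "y' \<in> Mor T L ?Y" for L y y'
    by (rule \<theta>_eq[OF that(1) madd_Mor])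
      (use \<theta> that cmp_madd_right[OF \<theta>(1)[OF that(1,2)] \<theta>(1)[OF that(1,3)] pg] in auto)
  have \<theta>_cmp: "\<theta> L (y \<cdot> f) = \<theta> L' y \<cdot> f"
    if "L \<in> S" "L' \<in> S" "f \<in> Mor T L L'" "y \<in> Mor T L' ?Y" for L L' f y
    by (rule \<theta>_eq[OF that(1) cmp_Mor[OF that(3)]])
      (use \<theta>[OF that(2,4)] cmp_assoc[OF that(3) \<theta>(1)[OF that(2,4)] pg] in auto)
  have "smodule_hom T S (H_obj T p Y) (H_obj T p X) \<theta>"
    using \<theta>(1) \<theta>_madd \<theta>_cmp by (auto simp: smodule_hom_def H_obj_def hom_def)
  moreover have "smodule_hom T S (H_obj T p X) (H_obj T p Y) (H_mor T p g)"
    using H_mor_hom[OF g] .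
  ultimately show ?thesis
    unfolding smodule_iso_def
    by (intro conjI exI[of _ \<theta>]) (auto simp: H_obj_def H_mor_def \<theta>_eq \<theta>)
qed

end

context semisimple_generated
begin

text \<open>The cone \<open>X'\<close> of the approximation \<open>\<Sigma>\<^sup>-\<^sup>p P \<rightarrow> X\<close>, where \<open>P \<rightarrow> \<Sigma>\<^sup>p X\<close> is a realization of
  \<open>H\<^sup>p X\<close>.  For \<open>p = 1\<close> the bijectivity on \<open>H\<^sup>0\<close> uses that \<open>H\<^sup>0 P \<rightarrow> H\<^sup>1 X\<close> is injective.\<close>

lemma kill_cohomology:
  assumes X: "X \<in> obj T" and p: "p > 0"
  obtains X' g where "g \<in> Mor T X X'"
    "\<And>L k x. L \<in> S \<Longrightarrow> k \<ge> 0 \<Longrightarrow> x \<in> Mor T (sh_obj T k L) X \<Longrightarrow>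
      g \<cdot> x = mzero T (sh_obj T k L) X' \<Longrightarrow> x = mzero T (sh_obj T k L) X"
    "\<And>L k z. L \<in> S \<Longrightarrow> k \<ge> 0 \<Longrightarrow> z \<in> Mor T (sh_obj T k L) X' \<Longrightarrow>
      \<exists>x\<in>Mor T (sh_obj T k L) X. g \<cdot> x = z"
    "\<And>L x. L \<in> S \<Longrightarrow> x \<in> Mor T (sh_obj T (- p) L) X \<Longrightarrow> g \<cdot> x = mzero T (sh_obj T (- p) L) X'"
    "\<And>Y u. Y \<in> H_le0 T S \<Longrightarrow> u \<in> Mor T X Y \<Longrightarrow> \<exists>w\<in>Mor T X' Y. w \<cdot> g = u"
proof -
  have pX: "sh_obj T p X \<in> obj T" using sh_obj_closed[OF X] .
  obtain P f where f: "f \<in> Mor T P (sh_obj T p X)"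
    and f_surj: "\<And>L x. L \<in> S \<Longrightarrow> x \<in> Mor T L (sh_obj T p X) \<Longrightarrow> \<exists>y\<in>Mor T L P. f \<cdot> y = x"
    and f_inj: "\<And>L y. L \<in> S \<Longrightarrow> y \<in> Mor T L P \<Longrightarrow> f \<cdot> y = mzero T L (sh_obj T p X) \<Longrightarrow> y = mzero T L P"
    and P_neg: "\<And>L k y. L \<in> S \<Longrightarrow> k < 0 \<Longrightarrow> y \<in> Mor T L (sh_obj T k P) \<Longrightarrow> y = mzero T L (sh_obj T k P)"
    and P_maps: "\<And>W u. u \<in> Mor T P W \<Longrightarrow> \<forall>L\<in>S. \<forall>v\<in>Mor T L W. v = mzero T L W \<Longrightarrow>
      u = mzero T P W"
    by (rule realization[OF pX]) (rule that)
  have P: "P \<in> obj T" using Mor_obj(1)[OF f] .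
  let ?C = "sh_obj T (- p) P" and ?f = "sh_mor T (- p) f"
  have f': "?f \<in> Mor T ?C X" using sh_mor_transpose(2)[OF f X] .
  obtain X' g h where tri: "triangle T ?C X X' ?f g h" using TR1_cone[OF f'] by blast
  note g = triangle_Mor(2)[OF tri] and h = triangle_Mor(3)[OF tri] and X' = triangle_obj(3)[OF tri]
  \<comment> \<open>Such a map transposes to one from L to \<Sigma>^{m-p-k}P. The value m = 0 serves
    injectivity of g, and m = 1 serves surjectivity.\<close>
  have C_zero: "c = mzero T (sh_obj T k L) (sh_obj T m ?C)"
    if L: "L \<in> S" and km: "m - p - k < 0" and c: "c \<in> Mor T (sh_obj T k L) (sh_obj T m ?C)" for L k m c
  proof (rule transpose_eq_mzero[OF c])
    show "L \<in> obj T" using L S_obj by blast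
    have "sh_obj T (- k) (sh_obj T m ?C) = sh_obj T (m - p - k) P"
      using sh_obj_sh_obj[OF sh_obj_closed[OF P], of "- k" m "- p"] sh_obj_sh_obj[OF P, of m "- p"]
        sh_obj_sh_obj[OF P, of "- k" "m - p"] by simp
    then show "v = mzero T L (sh_obj T (- k) (sh_obj T m ?C))"
      if "v \<in> Mor T L (sh_obj T (- k) (sh_obj T m ?C))" for v
      using P_neg[OF L km] that by simp
  qed
  have inj: "x = mzero T (sh_obj T k L) X" if L: "L \<in> S" and k: "k \<ge> 0"
    and x: "x \<in> Mor T (sh_obj T k L) X" and 0: "g \<cdot> x = mzero T (sh_obj T k L) X'" for L k x
  proof -
    obtain c where c: "c \<in> Mor T (sh_obj T k L) ?C" "?f \<cdot> c = x" using triangle_exact[OF tri x 0] by blast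
    have "c = mzero T (sh_obj T k L) ?C"
      using C_zero[OF L, of 0 k c] c(1) k p sh_obj_0[OF sh_obj_closed[OF P]] by simp
    then show ?thesis using c cmp_mzero[OF f' Mor_obj(1)[OF x]] by simp
  qed
  have surj: "\<exists>x\<in>Mor T (sh_obj T k L) X. g \<cdot> x = z"
    if L: "L \<in> S" and k: "k \<ge> 0" and z: "z \<in> Mor T (sh_obj T k L) X'" for L k z
  proof -
    have L_obj: "L \<in> obj T" using L S_obj by blast
    have hz: "h \<cdot> z \<in> Mor T (sh_obj T k L) (sh_obj T 1 ?C)" using cmp_Mor[OF z h] .
    have "h \<cdot> z = mzero T (sh_obj T k L) (sh_obj T 1 ?C)"
    \<comment> \<open>Here alone the exponent 1 - p - k is zero rather than negative. The class h z
      is then killed by f, as consecutive maps of the triangle compose to zero.\<close>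
    proof (cases "p = 1 \<and> k = 0")
      case True
      have L0: "sh_obj T k L = L" using True sh_obj_0[OF L_obj] by simp
      have CP: "sh_obj T 1 ?C = P" using True sh_obj_sh_obj[OF P, of 1 "- 1"] sh_obj_0[OF P] by simp
      have "sh_mor T 1 ?f = f" using True sh_mor_inverse(1)[OF f, of 1] by simp
      then have "f \<cdot> (h \<cdot> z) = mzero T L (sh_obj T p X)"
        using cmp_assoc[OF z h sh_mor_Mor[OF f', of 1]] triangle_cmp_shift[OF tri]
          mzero_cmp[OF z sh_obj_closed[OF X]] L0 True by simp
      then show ?thesis using f_inj[OF L] hz L0 CP by simp
    next
      case False
      then have "1 - p - k < 0" using k p by linarith
      then show ?thesis using C_zero[OF L _ hz] by blast
    qed
    then show ?thesis using triangle_exact'[OF tri z] by blast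
  qed
  \<comment> \<open>By surjectivity of the realization each such x factors through the first map of
    the triangle.\<close>
  have kill: "g \<cdot> x = mzero T (sh_obj T (- p) L) X'" if L: "L \<in> S" and x: "x \<in> Mor T (sh_obj T (- p) L) X"
    for L x
  proof -
    have L_obj: "L \<in> obj T" using L S_obj by blast
    obtain y where y: "y \<in> Mor T L P" "f \<cdot> y = sh_mor T p x"
      using f_surj[OF L, of "sh_mor T p x"] sh_mor_transpose(1)[OF x L_obj] by auto
    have y': "sh_mor T (- p) y \<in> Mor T (sh_obj T (- p) L) ?C" using sh_mor_Mor[OF y(1)] .
    have "x = ?f \<cdot> sh_mor T (- p) y"
      using sh_mor_cmp[OF y(1) f, of "- p"] y(2) sh_mor_inverse(2)[OF x, of p] by simp
    then have "g \<cdot> x = (g \<cdot> ?f) \<cdot> sh_mor T (- p) y" using cmp_assoc[OF y' f' g] by simp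
    then show ?thesis using triangle_cmp[OF tri] mzero_cmp[OF y' X'] by simp
  qed
  \<comment> \<open>The obstruction is a map P -> \<Sigma>^p Y, and it vanishes because objects of S
    have only zero maps to \<Sigma>^p Y.\<close>
  have factor: "\<exists>w\<in>Mor T X' Y. w \<cdot> g = u" if Y: "Y \<in> H_le0 T S" and u: "u \<in> Mor T X Y" for Y u
  proof -
    have Y_obj: "Y \<in> obj T" using Mor_obj(2)[OF u] .
    have uf: "u \<cdot> ?f \<in> Mor T ?C Y" using cmp_Mor[OF f' u] .
    have "u \<cdot> ?f = mzero T ?C Y"
    proof (rule transpose_eq_mzero[OF uf P])
      fix v assume v: "v \<in> Mor T P (sh_obj T (- (- p)) Y)"
      show "v = mzero T P (sh_obj T (- (- p)) Y)"
      proof (rule P_maps[OF v], intro ballI)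
        fix L v assume L: "L \<in> S" and v: "v \<in> Mor T L (sh_obj T (- (- p)) Y)"
        have "- p < 0" using p by simp
        then have "v = mzero T (sh_obj T (- p) L) Y" if "v \<in> Mor T (sh_obj T (- p) L) Y" for v
          using Y L that unfolding H_le0_iff[OF S_obj] by blast
        then show "v = mzero T L (sh_obj T (- (- p)) Y)"
          using transpose_eq_mzero'[OF _ Y_obj, of v L p] v by simp
      qed
    qed
    then show ?thesis using triangle_coexact[OF tri u] by blast
  qed
  show thesis using that[OF g inj surj kill factor] .
qed

text \<open>The conclusions of \<open>kill_cohomology\<close> as one predicate, so that a choice
  operator can pick the successive stages.\<close>

definition killing :: "int \<Rightarrow> 'o \<Rightarrow> 'o \<Rightarrow> 'm \<Rightarrow> bool"
  where "killing p X X' g \<longleftrightarrow> g \<in> Mor T X X' \<and>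
    (\<forall>L\<in>S. \<forall>k\<ge>0. (\<forall>x\<in>Mor T (sh_obj T k L) X. g \<cdot> x = mzero T (sh_obj T k L) X' \<longrightarrow>
         x = mzero T (sh_obj T k L) X) \<and>
       (\<forall>z\<in>Mor T (sh_obj T k L) X'. \<exists>x\<in>Mor T (sh_obj T k L) X. g \<cdot> x = z)) \<and>
    (\<forall>L\<in>S. \<forall>x\<in>Mor T (sh_obj T (- p) L) X. g \<cdot> x = mzero T (sh_obj T (- p) L) X') \<and>
    (\<forall>Y\<in>H_le0 T S. \<forall>u\<in>Mor T X Y. \<exists>w\<in>Mor T X' Y. w \<cdot> g = u)"

lemma killing_ex:
  assumes "X \<in> obj T" "p > 0"
  shows "\<exists>r. killing p X (fst r) (snd r)"
proof (rule kill_cohomology[OF assms])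
  fix X' g
  assume "g \<in> Mor T X X'"
    "\<And>L k x. L \<in> S \<Longrightarrow> k \<ge> 0 \<Longrightarrow> x \<in> Mor T (sh_obj T k L) X \<Longrightarrow>
      g \<cdot> x = mzero T (sh_obj T k L) X' \<Longrightarrow> x = mzero T (sh_obj T k L) X"
    "\<And>L k z. L \<in> S \<Longrightarrow> k \<ge> 0 \<Longrightarrow> z \<in> Mor T (sh_obj T k L) X' \<Longrightarrow>
      \<exists>x\<in>Mor T (sh_obj T k L) X. g \<cdot> x = z"
    "\<And>L x. L \<in> S \<Longrightarrow> x \<in> Mor T (sh_obj T (- p) L) X \<Longrightarrow> g \<cdot> x = mzero T (sh_obj T (- p) L) X'"
    "\<And>Y u. Y \<in> H_le0 T S \<Longrightarrow> u \<in> Mor T X Y \<Longrightarrow> \<exists>w\<in>Mor T X' Y. w \<cdot> g = u"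
  then have "killing p X X' g" unfolding killing_def by blast
  then have "killing p X (fst (X', g)) (snd (X', g))" by simp
  then show ?thesis ..
qed

text \<open>The left truncation is the homotopy colimit of a sequence of such cones in which every
  \<open>p > 0\<close> occurs infinitely often.\<close>

lemma truncation:
  assumes X: "X \<in> obj T"
  obtains V g where "g \<in> Mor T X V" "V \<in> H_le0 T S"
    "\<And>L k x. L \<in> S \<Longrightarrow> k \<ge> 0 \<Longrightarrow> x \<in> Mor T (sh_obj T k L) X \<Longrightarrow>
      g \<cdot> x = mzero T (sh_obj T k L) V \<Longrightarrow> x = mzero T (sh_obj T k L) X"
    "\<And>L k z. L \<in> S \<Longrightarrow> k \<ge> 0 \<Longrightarrow> z \<in> Mor T (sh_obj T k L) V \<Longrightarrow>
      \<exists>x\<in>Mor T (sh_obj T k L) X. g \<cdot> x = z"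
    "\<And>Y u. Y \<in> H_le0 T S \<Longrightarrow> u \<in> Mor T X Y \<Longrightarrow> \<exists>w\<in>Mor T V Y. w \<cdot> g = u"
proof -
  \<comment> \<open>The first component of \<open>prod_decode\<close> takes every natural number
    infinitely often; adding 1 makes the degrees positive.\<close>
  define p where "p n = int (fst (prod_decode n)) + 1" for n
  define step where "step q Y = (SOME r. killing q Y (fst r) (snd r))" for q Y
  define Xs where "Xs = rec_nat X (\<lambda>n Y. fst (step (p n) Y))"
  define s where "s n = snd (step (p n) (Xs n))" for n
  have Xs_0: "Xs 0 = X" and Xs_Suc: "Xs (Suc n) = fst (step (p n) (Xs n))" for n
    by (simp_all add: Xs_def)
  have step: "killing (p n) Y (fst (step (p n) Y)) (snd (step (p n) Y))" if "Y \<in> obj T" for Y n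
    using someI_ex[OF killing_ex[OF that, of "p n"]] unfolding step_def p_def by simp
  have Xs: "Xs n \<in> obj T" for n
  proof (induction n)
    case (Suc n)
    then show ?case using step[OF Suc, of n] Mor_obj(2) unfolding killing_def Xs_Suc by blast
  qed (simp add: Xs_0 X)
  have kill: "killing (p n) (Xs n) (Xs (Suc n)) (s n)" for n
    using step[OF Xs] by (simp add: Xs_Suc s_def)
  have s: "s n \<in> Mor T (Xs n) (Xs (Suc n))" for n
    using kill by (simp add: killing_def)
  have s_inj: "x = mzero T (sh_obj T k L) (Xs n)"
    if "L \<in> S" "k \<ge> 0" "x \<in> Mor T (sh_obj T k L) (Xs n)" "s n \<cdot> x = mzero T (sh_obj T k L) (Xs (Suc n))"
    for L k n x
    using kill[of n] that unfolding killing_def by blast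
  have s_surj: "\<exists>x\<in>Mor T (sh_obj T k L) (Xs n). s n \<cdot> x = z"
    if "L \<in> S" "k \<ge> 0" "z \<in> Mor T (sh_obj T k L) (Xs (Suc n))" for L k n z
    using kill[of n] that unfolding killing_def by blast
  have s_kill: "s n \<cdot> x = mzero T (sh_obj T (- p n) L) (Xs (Suc n))"
    if "L \<in> S" "x \<in> Mor T (sh_obj T (- p n) L) (Xs n)" for L n x
    using kill[of n] that unfolding killing_def by blast
  have s_factor: "\<exists>w\<in>Mor T (Xs (Suc n)) Y. w \<cdot> s n = u"
    if "Y \<in> H_le0 T S" "u \<in> Mor T (Xs n) Y" for Y n u
    using kill[of n] that unfolding killing_def by blast
  obtain V g where g: "\<And>n. g n \<in> Mor T (Xs n) V" and gs: "\<And>n. g (Suc n) \<cdot> s n = g n"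
    and colim: "\<And>Y u. \<forall>n. u n \<in> Mor T (Xs n) Y \<Longrightarrow> \<forall>n. u (Suc n) \<cdot> s n = u n \<Longrightarrow>
      \<exists>w\<in>Mor T V Y. \<forall>n. w \<cdot> g n = u n"
    and g_surj: "\<And>K z. finitary U K \<Longrightarrow> z \<in> Mor T K V \<Longrightarrow> \<exists>n. \<exists>x\<in>Mor T K (Xs n). z = g n \<cdot> x"
    and g_zero: "\<And>K \<phi>. finitary U K \<Longrightarrow> \<forall>n. \<phi> n \<in> Mor T K (Xs n) \<Longrightarrow>
      \<forall>n. \<phi> (Suc n) = s n \<cdot> \<phi> n \<Longrightarrow> g 0 \<cdot> \<phi> 0 = mzero T K V \<Longrightarrow> \<exists>n. \<phi> n = mzero T K (Xs n)"
    by (rule hocolim[where s = s and X = Xs, OF coproducts small_nat s]) (rule that)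
  have g0: "g 0 \<in> Mor T X V" using g[of 0] Xs_0 by simp
  have V_obj: "V \<in> obj T" using Mor_obj(2)[OF g0] .
  have surj: "\<exists>x\<in>Mor T (sh_obj T k L) X. g 0 \<cdot> x = z"
    if L: "L \<in> S" and k: "k \<ge> 0" and z: "z \<in> Mor T (sh_obj T k L) V" for L k z
  proof -
    obtain n x where x: "x \<in> Mor T (sh_obj T k L) (Xs n)" "z = g n \<cdot> x"
      using g_surj[OF finitary_generator[OF L] z] by blast
    \<comment> \<open>A class found at stage n descends to stage 0, since the transition maps are
      surjective for k >= 0.\<close>
    have "\<exists>x'\<in>Mor T (sh_obj T k L) (Xs 0). g 0 \<cdot> x' = z"
      using x
    proof (induction n arbitrary: x)
      case (Suc n)
      obtain x' where x': "x' \<in> Mor T (sh_obj T k L) (Xs n)" "s n \<cdot> x' = x"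
        using s_surj[OF L k Suc.prems(1)] by blast
      have "z = g n \<cdot> x'" using cmp_assoc[OF x'(1) s g] gs x'(2) Suc.prems(2) by simp
      then show ?case using Suc.IH x'(1) by blast
    qed blast
    then show ?thesis by (simp add: Xs_0)
  qed
  have inj: "x = mzero T (sh_obj T k L) X" if L: "L \<in> S" and k: "k \<ge> 0"
    and x: "x \<in> Mor T (sh_obj T k L) X" and 0: "g 0 \<cdot> x = mzero T (sh_obj T k L) V" for L k x
  proof -
    \<comment> \<open>The images of x along the sequence. As x dies in V, one of them is zero, and
      injectivity of the transition maps brings this back to x.\<close>
    define \<phi> where "\<phi> = rec_nat x (\<lambda>n y. s n \<cdot> y)"
    have \<phi>_0: "\<phi> 0 = x" and \<phi>_Suc: "\<phi> (Suc n) = s n \<cdot> \<phi> n" for n by (simp_all add: \<phi>_def)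
    have \<phi>: "\<phi> n \<in> Mor T (sh_obj T k L) (Xs n)" for n
      by (induction n) (simp_all add: \<phi>_0 x Xs_0 \<phi>_Suc cmp_Mor[OF _ s])
    obtain n where "\<phi> n = mzero T (sh_obj T k L) (Xs n)"
      using g_zero[OF finitary_generator[OF L], of \<phi> k] \<phi> \<phi>_Suc 0 \<phi>_0 by auto
    then have "\<phi> 0 = mzero T (sh_obj T k L) (Xs 0)"
    proof (induction n)
      case (Suc n)
      have "s n \<cdot> \<phi> n = mzero T (sh_obj T k L) (Xs (Suc n))" using Suc.prems \<phi>_Suc[of n] by metis
      then show ?case using Suc.IH s_inj[OF L k \<phi>] by blast
    qed
    then show ?thesis by (simp add: \<phi>_0 Xs_0)
  qed
  have V: "V \<in> H_le0 T S"
    unfolding H_le0_iff[OF S_obj]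
  proof (intro conjI ballI allI impI V_obj)
    fix L k z assume L: "L \<in> S" and k: "k < 0" and z: "z \<in> Mor T (sh_obj T k L) V"
    let ?K = "sh_obj T k L"
    obtain n x where x: "x \<in> Mor T ?K (Xs n)" "z = g n \<cdot> x"
      using g_surj[OF finitary_generator[OF L] z] by blast
    \<comment> \<open>A stage not before n that treats degree -k: the first component of the code
      gives \<open>p m\<close> = -k, and the second keeps m at least n.\<close>
    define m where "m = prod_encode (nat (- k - 1), n)"
    have "n \<le> m" unfolding m_def by (rule le_prod_encode_2)
    then have "\<exists>x'\<in>Mor T ?K (Xs m). z = g m \<cdot> x'"
    proof (induction rule: dec_induct)
      case (step m)
      then obtain x' where x': "x' \<in> Mor T ?K (Xs m)" "z = g m \<cdot> x'" by blast
      have "z = g (Suc m) \<cdot> (s m \<cdot> x')" using cmp_assoc[OF x'(1) s g] gs x'(2) by simp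
      then show ?case using cmp_Mor[OF x'(1) s] by blast
    qed (use x in blast)
    then obtain x' where x': "x' \<in> Mor T ?K (Xs m)" "z = g m \<cdot> x'" by blast
    have "- p m = k" using k by (simp add: p_def m_def)
    then have "s m \<cdot> x' = mzero T ?K (Xs (Suc m))" using s_kill[OF L, of x' m] x'(1) by simp
    then have "g (Suc m) \<cdot> (s m \<cdot> x') = mzero T ?K V"
      using cmp_mzero[OF g generator_obj[OF L]] by simp
    then show "z = mzero T ?K V" using cmp_assoc[OF x'(1) s g] gs x'(2) by simp
  qed
  have factor: "\<exists>w\<in>Mor T V Y. w \<cdot> g 0 = u" if Y: "Y \<in> H_le0 T S" and u: "u \<in> Mor T X Y" for Y u
  proof -
    \<comment> \<open>Extensions to the successive stages are chosen one after the other. They are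
      compatible by construction, so V receives an extension of all of them.\<close>
    define nxt where "nxt n v = (SOME w. w \<in> Mor T (Xs (Suc n)) Y \<and> w \<cdot> s n = v)" for n v
    have nxt: "nxt n v \<in> Mor T (Xs (Suc n)) Y \<and> nxt n v \<cdot> s n = v" if "v \<in> Mor T (Xs n) Y" for n v
      using someI_ex[of "\<lambda>w. w \<in> Mor T (Xs (Suc n)) Y \<and> w \<cdot> s n = v"] s_factor[OF Y that]
      unfolding nxt_def by blast
    define us where "us = rec_nat u nxt"
    have us_0: "us 0 = u" and us_Suc: "us (Suc n) = nxt n (us n)" for n by (simp_all add: us_def)
    have us: "us n \<in> Mor T (Xs n) Y" for n
      by (induction n) (use u nxt in \<open>auto simp: us_0 us_Suc Xs_0\<close>)
    obtain w where "w \<in> Mor T V Y" "\<And>n. w \<cdot> g n = us n"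
      using colim[of us Y] us nxt[OF us] us_Suc by auto
    then show ?thesis using us_0 by metis
  qed
  show thesis using that[OF g0 V inj surj factor] .
qed

text \<open>W is the cocone of the truncation map; its cohomology and both isomorphisms are read off
  the long exact sequence.\<close>

lemma truncation_triangle_ex:
  assumes X: "X \<in> obj T"
  obtains W V f g h where "truncation_triangle T (H_gt0 T S) (H_le0 T S) W X V f g h"
    "\<And>p. p \<le> 0 \<Longrightarrow> smodule_iso T S (H_obj T p X) (H_obj T p V) (H_mor T p g)"
    "\<And>p. p > 0 \<Longrightarrow> smodule_iso T S (H_obj T p W) (H_obj T p X) (H_mor T p f)"
proof -
  obtain V g where g: "g \<in> Mor T X V" and V: "V \<in> H_le0 T S"
    and inj: "\<And>L k x. L \<in> S \<Longrightarrow> k \<ge> 0 \<Longrightarrow> x \<in> Mor T (sh_obj T k L) X \<Longrightarrow>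
      g \<cdot> x = mzero T (sh_obj T k L) V \<Longrightarrow> x = mzero T (sh_obj T k L) X"
    and surj: "\<And>L k z. L \<in> S \<Longrightarrow> k \<ge> 0 \<Longrightarrow> z \<in> Mor T (sh_obj T k L) V \<Longrightarrow>
      \<exists>x\<in>Mor T (sh_obj T k L) X. g \<cdot> x = z"
    by (rule truncation[OF X]) (rule that)
  have V0: "z = mzero T (sh_obj T k L) V" if "L \<in> S" "k < 0" "z \<in> Mor T (sh_obj T k L) V" for L k z
    using V that unfolding H_le0_iff[OF S_obj] by blast
  obtain W f h where tri: "triangle T W X V f g h" using cocone[OF g] by blast
  note f = triangle_Mor(1)[OF tri] and h = triangle_Mor(3)[OF tri] and W = triangle_obj(1)[OF tri]
  \<comment> \<open>The bound is -1 because the kernel of f at k comes from maps \<Sigma>^{k+1}L ->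
    V, and these lift to X as soon as k + 1 >= 0.\<close>
  have f_inj: "x = mzero T (sh_obj T k L) W" if L: "L \<in> S" and k: "k \<ge> - 1"
    and x: "x \<in> Mor T (sh_obj T k L) W" and 0: "f \<cdot> x = mzero T (sh_obj T k L) X" for L k x
  proof -
    have L_obj: "L \<in> obj T" using L S_obj by blast
    obtain z where z: "z \<in> Mor T (sh_obj T 1 (sh_obj T k L)) V" "h \<cdot> z = sh_mor T 1 x"
      using triangle_exact_shift[OF tri x 0] by blast
    obtain y where y: "y \<in> Mor T (sh_obj T (1 + k) L) X" "g \<cdot> y = z"
      using surj[OF L, of "1 + k" z] k z(1) sh_obj_sh_obj[OF L_obj, of 1 k] by auto
    have "h \<cdot> z = mzero T (sh_obj T (1 + k) L) (sh_obj T 1 W)"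
      using cmp_assoc[OF y(1) g h] y(2) triangle_cmp'[OF tri] mzero_cmp[OF y(1) sh_obj_closed[OF W]]
      by simp
    then have "sh_mor T 1 x = mzero T (sh_obj T 1 (sh_obj T k L)) (sh_obj T 1 W)"
      using z(2) sh_obj_sh_obj[OF L_obj, of 1 k] by simp
    then show ?thesis using sh_mor_eq_mzero_iff[OF x] by blast
  qed
  \<comment> \<open>At k = -1 surjectivity of g on H^0 decides; for smaller k the maps
    \<Sigma>^{k+1}L -> V are already zero.\<close>
  have f_inj': "x = mzero T (sh_obj T k L) W" if L: "L \<in> S" and k: "k < 0"
    and x: "x \<in> Mor T (sh_obj T k L) W" and 0: "f \<cdot> x = mzero T (sh_obj T k L) X" for L k x
  proof (cases "k = - 1")
    case True
    then show ?thesis using f_inj[OF L _ x 0] by simp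
  next
    case False
    have L_obj: "L \<in> obj T" using L S_obj by blast
    obtain z where z: "z \<in> Mor T (sh_obj T 1 (sh_obj T k L)) V" "h \<cdot> z = sh_mor T 1 x"
      using triangle_exact_shift[OF tri x 0] by blast
    have "z = mzero T (sh_obj T 1 (sh_obj T k L)) V"
      using V0[OF L, of "1 + k" z] False k z(1) sh_obj_sh_obj[OF L_obj, of 1 k] by simp
    then have "sh_mor T 1 x = mzero T (sh_obj T 1 (sh_obj T k L)) (sh_obj T 1 W)"
      using z(2) cmp_mzero[OF h Mor_obj(1)[OF z(1)]] by simp
    then show ?thesis using sh_mor_eq_mzero_iff[OF x] by blast
  qed
  have "W \<in> H_gt0 T S"
    unfolding H_gt0_iff[OF S_obj]
  proof (intro conjI ballI allI impI W)
    fix L k x assume L: "L \<in> S" and k: "(0::int) \<le> k" and x: "x \<in> Mor T (sh_obj T k L) W"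
    have "g \<cdot> (f \<cdot> x) = mzero T (sh_obj T k L) V"
      using cmp_assoc[OF x f g] triangle_cmp[OF tri] mzero_cmp[OF x Mor_obj(2)[OF g]] by simp
    then have "f \<cdot> x = mzero T (sh_obj T k L) X" using inj[OF L k cmp_Mor[OF x f]] by blast
    then show "x = mzero T (sh_obj T k L) W" using f_inj[OF L _ x] k by simp
  qed
  then have trunc: "truncation_triangle T (H_gt0 T S) (H_le0 T S) W X V f g h"
    using V tri by (simp add: truncation_triangle_def)
  have g_iso: "smodule_iso T S (H_obj T p X) (H_obj T p V) (H_mor T p g)" if "p \<le> 0" for p
    by (rule H_mor_iso[OF S_obj g]) (use inj surj that in auto)
  have f_iso: "smodule_iso T S (H_obj T p W) (H_obj T p X) (H_mor T p f)" if p: "p > 0" for p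
  proof (rule H_mor_iso[OF S_obj f])
    fix L assume L: "L \<in> S"
    show "x = mzero T (sh_obj T (- p) L) W" if "x \<in> Mor T (sh_obj T (- p) L) W"
      "f \<cdot> x = mzero T (sh_obj T (- p) L) X" for x
      using f_inj'[OF L _ that] p by simp
    \<comment> \<open>The obstruction to lifting y is g y, which vanishes as V has no cohomology in
      positive degrees.\<close>
    show "\<exists>x\<in>Mor T (sh_obj T (- p) L) W. f \<cdot> x = y" if y: "y \<in> Mor T (sh_obj T (- p) L) X" for y
      using triangle_exact[OF tri y V0[OF L _ cmp_Mor[OF y g]]] p by auto
  qed
  show thesis using that[OF trunc g_iso f_iso] .
qed

lemma orthogonal:
  assumes X: "X \<in> H_gt0 T S" and Y: "Y \<in> H_le0 T S" and u: "u \<in> Mor T X Y"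
  shows "u = mzero T X Y"
proof -
  have X_obj: "X \<in> obj T" and Y_obj: "Y \<in> obj T" using Mor_obj[OF u] by auto
  obtain V g where g: "g \<in> Mor T X V" and V: "V \<in> H_le0 T S"
    and surj: "\<And>L k z. L \<in> S \<Longrightarrow> k \<ge> 0 \<Longrightarrow> z \<in> Mor T (sh_obj T k L) V \<Longrightarrow>
      \<exists>x\<in>Mor T (sh_obj T k L) X. g \<cdot> x = z"
    and factor: "\<And>Y u. Y \<in> H_le0 T S \<Longrightarrow> u \<in> Mor T X Y \<Longrightarrow> \<exists>w\<in>Mor T V Y. w \<cdot> g = u"
    by (rule truncation[OF X_obj]) (rule that)
  have "zero_object T V"
  proof (rule generated_zero_object[OF Mor_obj(2)[OF g]])
    fix k L z assume L: "L \<in> S" and z: "z \<in> Mor T (sh_obj T k L) V"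
    show "z = mzero T (sh_obj T k L) V"
    proof (cases "k < 0")
      case True
      then show ?thesis using V L z unfolding H_le0_iff[OF S_obj] by blast
    next
      case False
      then obtain x where x: "x \<in> Mor T (sh_obj T k L) X" "g \<cdot> x = z"
        using surj[OF L _ z] by auto
      then have "x = mzero T (sh_obj T k L) X"
        using X L False unfolding H_gt0_iff[OF S_obj] by (meson not_le)
      then show ?thesis using x cmp_mzero[OF g generator_obj[OF L]] by simp
    qed
  qed
  moreover obtain w where w: "w \<in> Mor T V Y" "w \<cdot> g = u" using factor[OF Y u] by blast
  ultimately have "w = mzero T V Y" using zero_object_Mor(2) by blast
  then show ?thesis using w mzero_cmp[OF g Y_obj] by simp
qed

section \<open>The axioms of a weight structure\<close>

text \<open>Both halves of the weight structure have this form, with D the non-negative or the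
  negative integers. The closure properties hold for any D, since vanishing of maps passes to zero
  objects, biproducts and retracts.\<close>

lemma orthogonal_class_additive:
  assumes Q: "Q = {X \<in> obj T. \<forall>L\<in>S. \<forall>k\<in>D. \<forall>v\<in>Mor T (sh_obj T k L) X. v = mzero T (sh_obj T k L) X}"
  shows "full_additive_subcategory T Q" "stable_under_summands T Q"
proof -
  have zero: "Z \<in> Q" if Z: "zero_object T Z" for Z
    using zero_object_Mor(1)[OF Z] Z unfolding Q zero_object_def by blast
  have biprod: "B \<in> Q" if X: "X \<in> Q" and Y: "Y \<in> Q" and B: "B \<in> obj T"
    and bi: "is_biproduct T X Y B i j p q" for X Y B i j p q
    unfolding Q
  proof (intro CollectI conjI ballI B)
    fix L k v assume L: "L \<in> S" and k: "k \<in> D" and v: "v \<in> Mor T (sh_obj T k L) B"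
    let ?K = "sh_obj T k L"
    have i: "i \<in> Mor T X B" and j: "j \<in> Mor T Y B" and p: "p \<in> Mor T B X" and q: "q \<in> Mor T B Y"
      and id: "madd T (i \<cdot> p) (j \<cdot> q) = idn T B"
      using bi by (auto simp: is_biproduct_def)
    have pv: "p \<cdot> v = mzero T ?K X" using X L k cmp_Mor[OF v p] unfolding Q by blast
    have qv: "q \<cdot> v = mzero T ?K Y" using Y L k cmp_Mor[OF v q] unfolding Q by blast
    have K: "?K \<in> obj T" using generator_obj[OF L] .
    have "v = madd T ((i \<cdot> p) \<cdot> v) ((j \<cdot> q) \<cdot> v)"
      using cmp_madd_left[OF v cmp_Mor[OF p i] cmp_Mor[OF q j]] idn_cmp[OF v] id by simp
    also have "\<dots> = mzero T ?K B"
      using cmp_assoc[OF v p i] cmp_assoc[OF v q j] pv qv cmp_mzero[OF i K] cmp_mzero[OF j K]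
        madd_mzero(1)[OF mzero_Mor[OF K B]] by simp
    finally show "v = mzero T ?K B" .
  qed
  obtain Z where Z: "zero_object T Z" using ex_zero_object by blast
  show "full_additive_subcategory T Q"
    unfolding full_additive_subcategory_def
  proof (intro conjI ballI)
    show "Q \<subseteq> obj T" by (auto simp: Q)
    show "\<exists>Z\<in>Q. zero_object T Z" using zero Z by blast
    fix X Y assume X: "X \<in> Q" and Y: "Y \<in> Q"
    then have "X \<in> obj T" "Y \<in> obj T" by (auto simp: Q)
    then obtain B i j p q where "B \<in> obj T" "is_biproduct T X Y B i j p q"
      using ex_biproduct by blast
    then show "\<exists>B\<in>Q. \<exists>i j p q. is_biproduct T X Y B i j p q" using biprod[OF X Y] by blast
  qed
  show "stable_under_summands T Q"
    unfolding stable_under_summands_def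
  proof (intro ballI impI)
    fix B X assume B: "B \<in> Q" and X: "X \<in> obj T" and "direct_summand T X B"
    then obtain Y i j p q where "is_biproduct T X Y B i j p q" unfolding direct_summand_def by blast
    then have i: "i \<in> Mor T X B" and p: "p \<in> Mor T B X" and pi: "p \<cdot> i = idn T X"
      by (auto simp: is_biproduct_def)
    show "X \<in> Q"
      unfolding Q
    proof (intro CollectI conjI ballI X)
      fix L k v assume L: "L \<in> S" and k: "k \<in> D" and v: "v \<in> Mor T (sh_obj T k L) X"
      have "i \<cdot> v = mzero T (sh_obj T k L) B" using B L k cmp_Mor[OF v i] unfolding Q by blast
      then have "p \<cdot> (i \<cdot> v) = mzero T (sh_obj T k L) X" using cmp_mzero[OF p generator_obj[OF L]] by simp
      then show "v = mzero T (sh_obj T k L) X" using cmp_assoc[OF v i p] pi idn_cmp[OF v] by simp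
    qed
  qed
qed

text \<open>Shifting X by m translates degrees by -m. With m = -1 this keeps k >= 0 and with m = 1
  it keeps k < 0, which is (w1).\<close>

lemma orthogonal_class_shift:
  assumes X: "X \<in> obj T" and L: "L \<in> S" and v: "v \<in> Mor T (sh_obj T k L) (sh_obj T m X)"
    and 0: "\<And>v. v \<in> Mor T (sh_obj T (k - m) L) X \<Longrightarrow> v = mzero T (sh_obj T (k - m) L) X"
  shows "v = mzero T (sh_obj T k L) (sh_obj T m X)"
proof (rule transpose_eq_mzero'[OF v X])
  have L_obj: "L \<in> obj T" using L S_obj by blast
  show "v = mzero T (sh_obj T (- m) (sh_obj T k L)) X" if "v \<in> Mor T (sh_obj T (- m) (sh_obj T k L)) X" for v
    using 0[of v] that sh_obj_sh_obj[OF L_obj, of "- m" k] by simp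
qed

lemma weight_structure_H: "weight_structure T (H_gt0 T S) (H_le0 T S)"
  unfolding weight_structure_def
proof (intro conjI ballI)
  have gt: "H_gt0 T S = {X \<in> obj T. \<forall>L\<in>S. \<forall>k\<in>{0..}. \<forall>v\<in>Mor T (sh_obj T k L) X.
      v = mzero T (sh_obj T k L) X}"
    using H_gt0_iff[OF S_obj] by auto
  have le: "H_le0 T S = {X \<in> obj T. \<forall>L\<in>S. \<forall>k\<in>{..<0}. \<forall>v\<in>Mor T (sh_obj T k L) X.
      v = mzero T (sh_obj T k L) X}"
    using H_le0_iff[OF S_obj] by auto
  show "full_additive_subcategory T (H_gt0 T S)" "stable_under_summands T (H_gt0 T S)"
    using orthogonal_class_additive[OF gt] by auto
  show "full_additive_subcategory T (H_le0 T S)" "stable_under_summands T (H_le0 T S)"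
    using orthogonal_class_additive[OF le] by auto
  show "sh_obj T (- 1) X \<in> H_gt0 T S" if X: "X \<in> H_gt0 T S" for X
  proof -
    have X_obj: "X \<in> obj T" using X by (simp add: gt)
    show ?thesis
      unfolding gt
    proof (intro CollectI conjI ballI sh_obj_closed[OF X_obj])
      fix L k v assume L: "L \<in> S" and k: "k \<in> {0::int..}"
        and v: "v \<in> Mor T (sh_obj T k L) (sh_obj T (- 1) X)"
      have "k - - 1 \<in> {0..}" using k by simp
      then show "v = mzero T (sh_obj T k L) (sh_obj T (- 1) X)"
        by (intro orthogonal_class_shift[OF X_obj L v]) (use X L in \<open>unfold gt, blast\<close>)
    qed
  qed
  show "sh_obj T 1 X \<in> H_le0 T S" if X: "X \<in> H_le0 T S" for X
  proof -
    have X_obj: "X \<in> obj T" using X by (simp add: le)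
    show ?thesis
      unfolding le
    proof (intro CollectI conjI ballI sh_obj_closed[OF X_obj])
      fix L k v assume L: "L \<in> S" and k: "k \<in> {..<0::int}"
        and v: "v \<in> Mor T (sh_obj T k L) (sh_obj T 1 X)"
      have "k - 1 \<in> {..<0}" using k by simp
      then show "v = mzero T (sh_obj T k L) (sh_obj T 1 X)"
        by (intro orthogonal_class_shift[OF X_obj L v]) (use X L in \<open>unfold le, blast\<close>)
    qed
  qed
  show "Mor T X Y = {mzero T X Y}" if X: "X \<in> H_gt0 T S" and Y: "Y \<in> H_le0 T S" for X Y
  proof -
    have "X \<in> obj T" "Y \<in> obj T" using X Y by (auto simp: H_gt0_def H_le0_def)
    then show ?thesis using orthogonal[OF X Y] mzero_Mor[of X Y] by blast
  qed
  show "\<exists>W V f g h. truncation_triangle T (H_gt0 T S) (H_le0 T S) W X V f g h" if "X \<in> obj T" for X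
    by (rule truncation_triangle_ex[OF that]) blast
qed

end

theorem theorem4p1:
  fixes T :: "('o, 'm) triang_cat" and S :: "'o set"
  assumes "universe TYPE('u)"
    and "triangulated_category T" and "locally_small TYPE('u) T"
    and "has_small_coproducts TYPE('u) T"
    and "full_additive_subcategory T S" and "essentially_small TYPE('u) T S"
    and "stable_under_summands T S"
    and a: "compactly_generates TYPE('u) T S"
    and b: "\<forall>L \<in> S. \<forall>M \<in> S. \<forall>p < 0. Mor T L (sh_obj T p M) = {mzero T L (sh_obj T p M)}"
    and c: "semisimple_Mod TYPE('u) TYPE('m) T S"
  shows "(\<exists>!(Tgt0, Tle0). weight_structure T Tgt0 Tle0 \<and>
           Tle0 = H_le0 T S \<and> Tgt0 = H_gt0 T S)
       \<and> (\<forall>X \<in> obj T. \<exists>U V f g h.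
           truncation_triangle T (H_gt0 T S) (H_le0 T S) U X V f g h \<and>
           (\<forall>p \<le> 0. smodule_iso T S (H_obj T p X) (H_obj T p V) (H_mor T p g)) \<and>
           (\<forall>p > 0. smodule_iso T S (H_obj T p U) (H_obj T p X) (H_mor T p f)))"
proof -
  have S: "S \<subseteq> obj T" using assms(5) by (simp add: full_additive_subcategory_def)
  interpret triangulated_category T by fact
  interpret semisimple_generated T "TYPE('u)" S
    by unfold_locales (use assms S in blast)+
  show ?thesis
  proof (intro conjI ballI)
    \<comment> \<open>Both classes are prescribed, so uniqueness is immediate and the content is
      that they form a weight structure.\<close>
    show "\<exists>!(Tgt0, Tle0). weight_structure T Tgt0 Tle0 \<and> Tle0 = H_le0 T S \<and> Tgt0 = H_gt0 T S"
      using weight_structure_H by auto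
    fix X assume X: "X \<in> obj T"
    show "\<exists>U V f g h. truncation_triangle T (H_gt0 T S) (H_le0 T S) U X V f g h \<and>
        (\<forall>p \<le> 0. smodule_iso T S (H_obj T p X) (H_obj T p V) (H_mor T p g)) \<and>
        (\<forall>p > 0. smodule_iso T S (H_obj T p U) (H_obj T p X) (H_mor T p f))"
      by (rule truncation_triangle_ex[OF X]) blast
  qed
qed

end
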